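(* The spectrum of the linear operator $A : \mathcal{D} \subset L^2(\mathbb{T}) \to L^2(\mathbb{T})$ given by $$A f := (c_*^2 - 2 \eta_* )\, \partial_x f - \frac{1}{\pi} \int_{\mathbb{T}} \eta_*' f\, dx + \frac{1}{2} \Pi_0 \partial_x^{-1} \Pi_0 f$$ completely covers the closed vertical strip given by $$\sigma(A) = \left\{ \lambda \in \mathbb{C} : \quad -\frac{\pi}{4} \leq {\rm Re}(\lambda) \leq \frac{\pi}{4} \right\}.$$
   Context: $\mathbb{T}=\mathbb{R}/2\pi\mathbb{Z}$, and $L^2(\mathbb{T})$ is the Hilbert space of complex-valued functions. $c_* := \frac{\pi}{2\sqrt{2}}$. The peaked profile is $\eta_*(x) = \frac{1}{16}(\pi^2 - 4\pi|x| + 2x^2)$ for $x\in[-\pi,\pi]$, extended $2\pi$-periodically; hence $\eta_*'(x) = -\frac14(\pi-|x|)\,{\rm sign}(x)$ on $[-\pi,\pi]$, and $c_*^2 - 2\eta_*(x) = \frac14 x(2\pi - x)$ for $x\in[0,2\pi]$. The operator $\Pi_0 f = f - \frac{1}{2\pi}\int_{\mathbb{T}} f\,dx$ is the projection onto zero-mean functions, and $\Pi_0\partial_x^{-1}\Pi_0$ maps $f\in L^2(\mathbb{T})$ to the unique $2\pi$-periodic zero-mean function whose derivative is $\Pi_0 f$; in Fourier series, $\sum_n f_n e^{inx} \mapsto \sum_{n\neq 0} \frac{f_n}{in}e^{inx}$. The domain is $$\mathcal{D} := \{ f \in L^2(\mathbb{T}) : (c_*^2 - 2\eta_* ) f' \in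 L^2(\mathbb{T})\},$$ where $f'$ is the weak derivative on $(0,2\pi)$ (functions in $\mathcal{D}$ need not be continuous across the peak $x=0$). $\sigma(A)=\mathbb{C}\setminus\rho(A)$ is the spectrum, the complement of the resolvent set, of the unbounded operator $A$ in $L^2(\mathbb{T})$. *)

theory Defs
  imports "HOL-Analysis.Analysis"
begin

section \<open>The Hilbert space of square-integrable functions on the circle\<close>

text \<open>
  The circle of length \<open>2\<pi>\<close> is represented by \<open>[0, 2\<pi>]\<close> with Lebesgue measure (the endpoints are
  a null set), and \<open>L\<^sup>2\<close> consists of classes of functions up to equality almost everywhere there;
  the values of a representative outside \<open>[0, 2\<pi>]\<close> are irrelevant. The peak sits at the endpoints.
\<close>

abbreviation circle_measure :: "real measure" where
  "circle_measure \<equiv> lebesgue_on {0..2*pi}"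

definition square_integrable :: "(real \<Rightarrow> complex) \<Rightarrow> bool" where
  "square_integrable f \<longleftrightarrow>
     f \<in> borel_measurable circle_measure \<and> integrable circle_measure (\<lambda>x. (norm (f x))\<^sup>2)"

definition l2_eq :: "(real \<Rightarrow> complex) \<Rightarrow> (real \<Rightarrow> complex) \<Rightarrow> bool" where
  "l2_eq f g \<longleftrightarrow>
     square_integrable f \<and> square_integrable g \<and> (AE x in circle_measure. f x = g x)"

lemma square_integrable_zero: "square_integrable (\<lambda>_. 0)"
  by (simp add: square_integrable_def)

lemma square_integrable_mult_left:
  assumes "square_integrable f"
  shows "square_integrable (\<lambda>x. c * f x)"
  using assms by (auto simp: square_integrable_def norm_mult power_mult_distrib)

lemma square_integrable_add:
  assumes "square_integrable f" "square_integrable g"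
  shows "square_integrable (\<lambda>x. f x + g x)"
  unfolding square_integrable_def
proof
  have [measurable]: "f \<in> borel_measurable circle_measure" "g \<in> borel_measurable circle_measure"
    using assms by (auto simp: square_integrable_def)
  show "(\<lambda>x. f x + g x) \<in> borel_measurable circle_measure" by measurable
  have le: "(norm (a + b))\<^sup>2 \<le> 2 * (norm a)\<^sup>2 + 2 * (norm b)\<^sup>2" for a b :: complex
  proof -
    have "(norm (a + b))\<^sup>2 \<le> (norm a + norm b)\<^sup>2"
      by (intro power_mono norm_triangle_ineq) auto
    also have "\<dots> \<le> 2 * (norm a)\<^sup>2 + 2 * (norm b)\<^sup>2"
      using zero_le_power2[of "norm a - norm b"] by (simp add: power2_eq_square algebra_simps)
    finally show ?thesis .
  qed
  show "integrable circle_measure (\<lambda>x. (norm (f x + g x))\<^sup>2)"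
  proof (rule Bochner_Integration.integrable_bound)
    show "integrable circle_measure (\<lambda>x. 2 * (norm (f x))\<^sup>2 + 2 * (norm (g x))\<^sup>2)"
      using assms unfolding square_integrable_def
      by (intro Bochner_Integration.integrable_add integrable_mult_right) auto
    show "AE x in circle_measure. norm ((norm (f x + g x))\<^sup>2)
        \<le> norm (2 * (norm (f x))\<^sup>2 + 2 * (norm (g x))\<^sup>2)"
    proof (rule AE_I2)
      show "norm ((norm (f x + g x))\<^sup>2) \<le> norm (2 * (norm (f x))\<^sup>2 + 2 * (norm (g x))\<^sup>2)" for x
        using le[of "f x" "g x"] by simp
    qed
  qed measurable
qed

lemma integrable_inner_of_square_integrable:
  assumes "square_integrable f" "square_integrable g"
  shows "integrable circle_measure (\<lambda>x. f x \<bullet> g x)"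
proof -
  have [measurable]: "f \<in> borel_measurable circle_measure" "g \<in> borel_measurable circle_measure"
    using assms by (auto simp: square_integrable_def)
  have le: "\<bar>a \<bullet> b\<bar> \<le> (norm a)\<^sup>2 + (norm b)\<^sup>2" for a b :: complex
  proof -
    have "\<bar>a \<bullet> b\<bar> \<le> norm a * norm b" by (rule Cauchy_Schwarz_ineq2)
    also have "\<dots> \<le> 2 * norm a * norm b" by simp
    also have "\<dots> \<le> (norm a)\<^sup>2 + (norm b)\<^sup>2" by (rule sum_squares_bound)
    finally show ?thesis .
  qed
  show ?thesis
  proof (rule Bochner_Integration.integrable_bound)
    show "integrable circle_measure (\<lambda>x. (norm (f x))\<^sup>2 + (norm (g x))\<^sup>2)"
      using assms unfolding square_integrable_def
      by (intro Bochner_Integration.integrable_add) auto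
    show "AE x in circle_measure. norm (f x \<bullet> g x) \<le> norm ((norm (f x))\<^sup>2 + (norm (g x))\<^sup>2)"
    proof (rule AE_I2)
      show "norm (f x \<bullet> g x) \<le> norm ((norm (f x))\<^sup>2 + (norm (g x))\<^sup>2)" for x
        using le[of "f x" "g x"] by simp
    qed
  qed measurable
qed

lemma l2_eq_mult_left:
  assumes "l2_eq f g"
  shows "l2_eq (\<lambda>x. c * f x) (\<lambda>x. c * g x)"
proof -
  have "AE x in circle_measure. f x = g x"
    using assms by (simp add: l2_eq_def)
  then have "AE x in circle_measure. c * f x = c * g x"
    by eventually_elim simp
  with assms show ?thesis
    by (simp add: l2_eq_def square_integrable_mult_left)
qed

quotient_type l2 = "real \<Rightarrow> complex" / partial: l2_eq
proof (rule part_equivpI)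
  show "\<exists>f. l2_eq f f"
    by (rule exI[of _ "\<lambda>_. 0"]) (simp add: l2_eq_def square_integrable_zero)
  show "symp l2_eq"
    by (rule sympI) (simp add: l2_eq_def eq_commute)
  show "transp l2_eq"
  proof (rule transpI)
    fix f g h assume fg: "l2_eq f g" and gh: "l2_eq g h"
    then have "AE x in circle_measure. f x = g x" "AE x in circle_measure. g x = h x"
      by (simp_all add: l2_eq_def)
    then have "AE x in circle_measure. f x = h x"
      by eventually_elim simp
    with fg gh show "l2_eq f h"
      by (simp add: l2_eq_def)
  qed
qed

instantiation l2 :: real_inner
begin

lift_definition zero_l2 :: l2 is "\<lambda>_. 0"
  by (simp add: l2_eq_def square_integrable_zero)

lift_definition plus_l2 :: "l2 \<Rightarrow> l2 \<Rightarrow> l2" is "\<lambda>f g x. f x + g x"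
proof -
  fix f f' g g'
  assume fg: "l2_eq f f'" "l2_eq g g'"
  then have "AE x in circle_measure. f x = f' x" "AE x in circle_measure. g x = g' x"
    by (simp_all add: l2_eq_def)
  then have "AE x in circle_measure. f x + g x = f' x + g' x"
    by eventually_elim simp
  with fg show "l2_eq (\<lambda>x. f x + g x) (\<lambda>x. f' x + g' x)"
    by (simp add: l2_eq_def square_integrable_add)
qed

lift_definition uminus_l2 :: "l2 \<Rightarrow> l2" is "\<lambda>f x. - f x"
  using l2_eq_mult_left[of _ _ "- 1"] by simp

definition minus_l2 :: "l2 \<Rightarrow> l2 \<Rightarrow> l2" where
  "minus_l2 f g = f + - g"

lift_definition scaleR_l2 :: "real \<Rightarrow> l2 \<Rightarrow> l2" is "\<lambda>r f x. of_real r * f x"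
  by (rule l2_eq_mult_left)

lift_definition inner_l2 :: "l2 \<Rightarrow> l2 \<Rightarrow> real" is "\<lambda>f g. LINT x|circle_measure. f x \<bullet> g x"
proof -
  fix f f' g g'
  assume "l2_eq f f'" "l2_eq g g'"
  then have m: "f \<in> borel_measurable circle_measure" "f' \<in> borel_measurable circle_measure"
      "g \<in> borel_measurable circle_measure" "g' \<in> borel_measurable circle_measure"
    and ae: "AE x in circle_measure. f x = f' x" "AE x in circle_measure. g x = g' x"
    by (auto simp: l2_eq_def square_integrable_def)
  note [measurable] = m
  show "(LINT x|circle_measure. f x \<bullet> g x) = (LINT x|circle_measure. f' x \<bullet> g' x)"
  proof (rule integral_cong_AE)
    show "AE x in circle_measure. f x \<bullet> g x = f' x \<bullet> g' x"
      using ae by eventually_elim simp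
  qed measurable
qed

definition norm_l2 :: "l2 \<Rightarrow> real" where "norm_l2 f = sqrt (f \<bullet> f)"

definition dist_l2 :: "l2 \<Rightarrow> l2 \<Rightarrow> real" where "dist_l2 f g = norm (f - g)"

definition sgn_l2 :: "l2 \<Rightarrow> l2" where "sgn_l2 f = inverse (norm f) *\<^sub>R f"

definition uniformity_l2 :: "(l2 \<times> l2) filter" where
  "uniformity_l2 = (INF e\<in>{0<..}. principal {(f, g). dist f g < e})"

definition open_l2 :: "l2 set \<Rightarrow> bool" where
  "open_l2 U \<longleftrightarrow> (\<forall>f\<in>U. eventually (\<lambda>(f', g). f' = f \<longrightarrow> g \<in> U) uniformity)"

instance
proof
  fix f g h :: l2 and r s :: real and U :: "l2 set"
  show "f + g + h = f + (g + h)"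
    by transfer (auto simp: l2_eq_def add.assoc intro!: square_integrable_add)
  show "f + g = g + f"
    by transfer (auto simp: l2_eq_def add.commute intro!: square_integrable_add)
  show "0 + f = f"
    by transfer (auto simp: l2_eq_def)
  show "- f + f = 0"
    by transfer (auto simp: l2_eq_def square_integrable_zero)
  show "f - g = f + - g"
    by (rule minus_l2_def)
  show "r *\<^sub>R (f + g) = r *\<^sub>R f + r *\<^sub>R g"
    by transfer (auto simp: l2_eq_def distrib_left
        intro!: square_integrable_add square_integrable_mult_left)
  show "(r + s) *\<^sub>R f = r *\<^sub>R f + s *\<^sub>R f"
    by transfer (auto simp: l2_eq_def distrib_right
        intro!: square_integrable_add square_integrable_mult_left)
  show "r *\<^sub>R s *\<^sub>R f = (r * s) *\<^sub>R f"
    by transfer (auto simp: l2_eq_def mult.assoc intro!: square_integrable_mult_left)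
  show "1 *\<^sub>R f = f"
    by transfer (auto simp: l2_eq_def)
  show "dist f g = norm (f - g)"
    by (rule dist_l2_def)
  show "sgn f = inverse (norm f) *\<^sub>R f"
    by (rule sgn_l2_def)
  show "(uniformity :: (l2 \<times> l2) filter) = (INF e\<in>{0<..}. principal {(x, y). dist x y < e})"
    by (rule uniformity_l2_def)
  show "open U = (\<forall>x\<in>U. \<forall>\<^sub>F (x', y) in uniformity. x' = x \<longrightarrow> y \<in> U)"
    by (rule open_l2_def)
  show "f \<bullet> g = g \<bullet> f"
    by transfer (simp add: inner_commute)
  show "(f + g) \<bullet> h = f \<bullet> h + g \<bullet> h"
    by transfer (simp add: l2_eq_def inner_add_left integrable_inner_of_square_integrable)
  show "(r *\<^sub>R f) \<bullet> g = r * (f \<bullet> g)"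
    by transfer (simp flip: scaleR_conv_of_real)
  show "0 \<le> f \<bullet> f"
    by transfer simp
  show "(f \<bullet> f = 0) = (f = 0)"
  proof transfer
    fix f assume "l2_eq f f"
    then have f: "square_integrable f" by (simp add: l2_eq_def)
    have "(LINT x|circle_measure. f x \<bullet> f x) = 0 \<longleftrightarrow> (AE x in circle_measure. f x \<bullet> f x = 0)"
      by (intro integral_nonneg_eq_0_iff_AE integrable_inner_of_square_integrable f) auto
    then show "(LINT x|circle_measure. f x \<bullet> f x) = 0 \<longleftrightarrow> l2_eq f (\<lambda>_. 0)"
      using f by (simp add: l2_eq_def square_integrable_zero)
  qed
  show "norm f = sqrt (f \<bullet> f)"
    by (rule norm_l2_def)
qed

end

lift_definition scaleC :: "complex \<Rightarrow> l2 \<Rightarrow> l2" is "\<lambda>c f x. c * f x"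
  by (rule l2_eq_mult_left)


section \<open>Spectrum of an unbounded operator\<close>

text \<open>
  An unbounded operator is given by its domain \<open>D\<close> and a map \<open>A\<close> of which only the restriction to
  \<open>D\<close> matters. A point \<open>z\<close> is in the resolvent set iff \<open>A - z : D \<rightarrow> L\<^sup>2\<close> has an everywhere defined
  bounded two-sided inverse. If \<open>A\<close> is complex linear, then so is this inverse.
\<close>

definition resolvent_set :: "l2 set \<Rightarrow> (l2 \<Rightarrow> l2) \<Rightarrow> complex set" where
  "resolvent_set D A = {z. \<exists>R. bounded_linear R \<and>
     (\<forall>g. R g \<in> D \<and> A (R g) - scaleC z (R g) = g) \<and>
     (\<forall>f\<in>D. R (A f - scaleC z f) = f)}"

definition spectrum :: "l2 set \<Rightarrow> (l2 \<Rightarrow> l2) \<Rightarrow> complex set" where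
  "spectrum D A = - resolvent_set D A"


section \<open>Weak derivatives on the open interval\<close>

text \<open>Test functions are the smooth functions with compact support in \<open>(0, 2\<pi>)\<close>.\<close>

definition test_function :: "(real \<Rightarrow> real) \<Rightarrow> bool" where
  "test_function \<phi> \<longleftrightarrow>
     (\<forall>n x. ((deriv ^^ n) \<phi>) differentiable (at x)) \<and>
     (\<exists>a b. 0 < a \<and> b < 2*pi \<and> (\<forall>x. x \<notin> {a..b} \<longrightarrow> \<phi> x = 0))"

definition locally_integrable :: "(real \<Rightarrow> complex) \<Rightarrow> bool" where
  "locally_integrable f \<longleftrightarrow>
     (\<forall>a b. 0 < a \<and> b < 2*pi \<longrightarrow> integrable (lebesgue_on {a..b}) f)"

definition has_weak_deriv :: "(real \<Rightarrow> complex) \<Rightarrow> (real \<Rightarrow> complex) \<Rightarrow> bool" where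
  "has_weak_deriv f g \<longleftrightarrow> locally_integrable f \<and> locally_integrable g \<and>
     (\<forall>\<phi>. test_function \<phi> \<longrightarrow>
        (LINT x|lebesgue_on {0<..<2*pi}. f x * of_real (deriv \<phi> x)) =
        - (LINT x|lebesgue_on {0<..<2*pi}. g x * of_real (\<phi> x)))"

text \<open>The weak derivative is unique up to a null set, so the choice below is immaterial.\<close>

definition weak_deriv :: "(real \<Rightarrow> complex) \<Rightarrow> real \<Rightarrow> complex" where
  "weak_deriv f = (SOME g. has_weak_deriv f g)"


section \<open>The linearised operator at the peaked wave\<close>

definition c_star :: real where
  "c_star = pi / (2 * sqrt 2)"

text \<open>\<open>y\<close> is the representative of \<open>x\<close> modulo \<open>2\<pi>\<close> in \<open>[-\<pi>, \<pi>)\<close>.\<close>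

definition eta_star :: "real \<Rightarrow> real" where
  "eta_star x = (let y = x - 2*pi * of_int \<lfloor>(x + pi) / (2*pi)\<rfloor>
                 in (pi\<^sup>2 - 4*pi*\<bar>y\<bar> + 2*y\<^sup>2) / 16)"

lemma eta_star_eq:
  assumes "x \<in> {0..2*pi}"
  shows "eta_star x = (pi\<^sup>2 - 4*pi*x + 2*x\<^sup>2) / 16"
proof (cases "x < pi")
  case True
  then have "\<lfloor>(x + pi) / (2*pi)\<rfloor> = 0"
    using assms by (intro floor_unique) (auto simp: field_simps)
  then show ?thesis
    using assms by (simp add: eta_star_def)
next
  case False
  then have "\<lfloor>(x + pi) / (2*pi)\<rfloor> = 1"
    using assms pi_gt_zero by (intro floor_unique) (simp_all add: field_simps del: pi_gt_zero)
  moreover have "\<bar>x - 2*pi\<bar> = 2*pi - x"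
    using assms by simp
  ultimately show ?thesis
    by (simp add: eta_star_def power2_eq_square algebra_simps)
qed

lemma c_star_eta_star:
  assumes "x \<in> {0..2*pi}"
  shows "c_star\<^sup>2 - 2 * eta_star x = x * (2*pi - x) / 4"
  by (simp add: eta_star_eq[OF assms] c_star_def power_divide power_mult_distrib)
     (simp add: power2_eq_square field_simps)

lemma deriv_eta_star:
  assumes "x \<in> {0<..<2*pi}"
  shows "deriv eta_star x = - (pi - x) / 4"
proof (rule DERIV_imp_deriv)
  have "((\<lambda>x. (pi\<^sup>2 - 4*pi*x + 2*x\<^sup>2) / 16) has_real_derivative - (pi - x) / 4) (at x)"
    by (auto intro!: derivative_eq_intros simp: field_simps)
  then show "(eta_star has_real_derivative - (pi - x) / 4) (at x)"
    by (rule has_field_derivative_transform_within_open[where S = "{0<..<2*pi}"])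
       (use assms in \<open>auto simp: eta_star_eq\<close>)
qed

definition zero_mean_proj :: "(real \<Rightarrow> complex) \<Rightarrow> real \<Rightarrow> complex" where
  "zero_mean_proj f x = f x - (LINT t|circle_measure. f t) / (2*pi)"

definition antiderivative :: "(real \<Rightarrow> complex) \<Rightarrow> real \<Rightarrow> complex" where
  "antiderivative f x = (LINT t|lebesgue_on {0..x}. f t)"

text \<open>
  For \<open>f\<close> of zero mean the antiderivative vanishes at \<open>0\<close> and at \<open>2\<pi>\<close>, hence is a periodic primitive;
  the outer projection selects the one of zero mean.
\<close>

definition zero_mean_primitive :: "(real \<Rightarrow> complex) \<Rightarrow> real \<Rightarrow> complex" where
  "zero_mean_primitive f = zero_mean_proj (antiderivative (zero_mean_proj f))"

lemma zero_mean_primitive: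
  assumes f: "integrable circle_measure f"
  defines "h \<equiv> zero_mean_primitive f"
  shows "(LINT x|circle_measure. h x) = 0"
    and "h 0 = h (2*pi)"
    and "\<lbrakk>0 \<le> x; x \<le> y; y \<le> 2*pi\<rbrakk>
           \<Longrightarrow> h y - h x = (LINT t|lebesgue_on {x..y}. zero_mean_proj f t)"
    and "continuous_on {0..2*pi} h"
proof -
  have mean: "integrable circle_measure (zero_mean_proj u)"
    "(LINT x|circle_measure. zero_mean_proj u x) = 0" if "integrable circle_measure u" for u
  proof -
    have m: "measure circle_measure (space circle_measure) = 2*pi"
      by (simp add: measure_restrict_space)
    have c: "integrable circle_measure (\<lambda>_. c)" for c :: complex
      by (simp add: integrable_restrict_space)
    show "integrable circle_measure (zero_mean_proj u)"
      unfolding zero_mean_proj_def using that c by (intro Bochner_Integration.integrable_diff)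
    show "(LINT x|circle_measure. zero_mean_proj u x) = 0"
      unfolding zero_mean_proj_def using that c m
      by (simp add: scaleR_conv_of_real)
  qed
  define g where "g = zero_mean_proj f"
  have g: "integrable circle_measure g"
    unfolding g_def by (rule mean(1)[OF f])
  have g_on: "integrable (lebesgue_on {a..b}) g" if "0 \<le> a" "b \<le> 2*pi" for a b
    using integrable_subinterval[OF g] that by auto
  have anti: "antiderivative g x = integral {0..x} g" if "0 \<le> x" "x \<le> 2*pi" for x
    unfolding antiderivative_def using g_on that by (intro lebesgue_integral_eq_integral) auto
  have int: "g integrable_on {0..2*pi}"
    using g by (intro integrable_on_lebesgue_on) auto
  have cont: "continuous_on {0..2*pi} (antiderivative g)"
    using indefinite_integral_continuous_1[OF int] by (rule continuous_on_eq) (simp add: anti)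
  have "integrable circle_measure (antiderivative g)"
    using cont by (intro continuous_imp_integrable_real) auto
  then show "(LINT x|circle_measure. h x) = 0"
    unfolding h_def zero_mean_primitive_def g_def[symmetric] by (rule mean(2))
  have h: "h x - h y = antiderivative g x - antiderivative g y" for x y
    by (simp add: h_def zero_mean_primitive_def zero_mean_proj_def[of "antiderivative _"] g_def)
  show diff: "h y - h x = (LINT t|lebesgue_on {x..y}. zero_mean_proj f t)"
    if "0 \<le> x" "x \<le> y" "y \<le> 2*pi" for x y
  proof -
    have "integral {0..x} g + integral {x..y} g = integral {0..y} g"
      using that
      by (intro Henstock_Kurzweil_Integration.integral_combine integrable_on_lebesgue_on g_on) auto
    moreover have "(LINT t|lebesgue_on {x..y}. g t) = integral {x..y} g"
      using that by (intro lebesgue_integral_eq_integral g_on) auto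
    ultimately show ?thesis
      using that by (simp add: h anti algebra_simps flip: g_def)
  qed
  have "h (2*pi) - h 0 = 0"
    using diff[of 0 "2*pi"] mean(2)[OF f] by simp
  then show "h 0 = h (2*pi)" by simp
  show "continuous_on {0..2*pi} h"
    unfolding h_def zero_mean_primitive_def g_def[symmetric] zero_mean_proj_def[of "antiderivative _"]
    using cont by (intro continuous_on_diff continuous_on_const)
qed

definition weighted_deriv :: "(real \<Rightarrow> complex) \<Rightarrow> real \<Rightarrow> complex" where
  "weighted_deriv f x = of_real (c_star\<^sup>2 - 2 * eta_star x) * weak_deriv f x"

definition dom_A :: "l2 set" where
  "dom_A = {f. (\<exists>g. has_weak_deriv (rep_l2 f) g) \<and> square_integrable (weighted_deriv (rep_l2 f))}"

text \<open>
  At the peak, the endpoints of \<open>[0, 2\<pi>]\<close>, \<open>deriv eta_star\<close> has an unspecified value, which does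
  not affect the integral.
\<close>

definition op_A :: "l2 \<Rightarrow> l2" where
  "op_A f = abs_l2 (\<lambda>x. weighted_deriv (rep_l2 f) x
     - 1 / pi * (LINT t|circle_measure. of_real (deriv eta_star t) * rep_l2 f t)
     + 1 / 2 * zero_mean_primitive (rep_l2 f) x)"

end

theory Submission
  imports Defs
begin

text \<open>
  Write \<open>w(x) = x (2\<pi> - x) / 4\<close> for the weight on \<open>[0, 2\<pi>]\<close> and \<open>V f\<close> for the primitive of
  \<open>f - mean f\<close> that vanishes at the peak. An integration by parts shows that the rank-one term
  \<open>- (1/\<pi>) \<integral> \<eta>\<^sub>*' f\<close> is half the mean of \<open>V f\<close>, which is exactly what the projection in
  \<open>\<Pi>\<^sub>0 \<partial>\<^sup>-\<^sup>1 \<Pi>\<^sub>0\<close> has removed. Hence \<open>A f = w f' + V f / 2\<close> (\<open>nonlocal_part_eq\<close>, \<open>op_A_eq\<close>).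

  This operator can be integrated once. Since \<open>w'' = - 1/2\<close>, a function \<open>F\<close> with \<open>F' = f\<close> satisfies
  \<open>w f' + F / 2 = (w F' - w' F)'\<close>, so the equation \<open>A f - z f = g\<close> for \<open>g\<close> and \<open>f\<close> of zero mean becomes
  \<open>w F' = (w' + z) F + G\<close>, where \<open>F = V f\<close> and \<open>G = V g\<close> both vanish at the peak. The
  homogeneous equation is solved by \<open>F = \<rho> w\<close> with the integrating factor
  \<open>\<rho> = (x / (2\<pi> - x)) powr (2 z / \<pi>)\<close>, for which \<open>w \<rho>' = z \<rho>\<close>. Everything is decided by the
  size of \<open>\<bar>\<rho>\<bar>\<close> at the two ends, where \<open>\<bar>\<rho>\<bar>\<^sup>2\<close> behaves like the powers
  \<open>\<plusminus> 4 Re z / \<pi>\<close> of the distance to the peak: \<open>\<rho>\<close> is square integrable iff \<open>\<bar>Re z\<bar> < \<pi>/4\<close>.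

  For \<open>\<bar>Re z\<bar> < \<pi>/4\<close> the function \<open>f = (\<rho> w)' = \<rho> (w' + z)\<close> is an eigenfunction
  (\<open>eigenfunction_exists\<close>). On the boundary of the strip the resolvent cannot be bounded, because
  eigenvalues accumulate there (\<open>strip_in_spectrum\<close>).

  For \<open>\<bar>Re z\<bar> > \<pi>/4\<close> three facts give a bounded resolvent (\<open>resolvent_set_outside_strip\<close>).
  There are no eigenvalues: by the Cauchy-Schwarz inequality \<open>\<bar>V f\<bar>\<close> is at most a multiple of
  \<open>sqrt w\<close>, while \<open>\<bar>\<rho>\<bar> sqrt w\<close> is now unbounded (\<open>no_eigenvalue_outside_strip\<close>). The first-order
  equation has a solution with \<open>\<bar>F\<bar> \<le> K sqrt w / (\<bar>Re z\<bar> - \<pi>/4)\<close> whenever \<open>\<bar>G\<bar> \<le> K sqrt w\<close>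
  (\<open>first_order_solution\<close>). Finally \<open>f = F'\<close> is controlled in \<open>L\<^sup>2\<close> by an energy identity,
  \<open>(w \<bar>f\<bar>\<^sup>2 + \<bar>F\<bar>\<^sup>2 / 2)' = (w' + 2 Re z) \<bar>f\<bar>\<^sup>2 + 2 Re (g cnj f)\<close>, in which
  \<open>\<bar>w'\<bar> \<le> \<pi>/2 < 2 \<bar>Re z\<bar>\<close> and the boundary terms are bounded by the previous estimate
  (\<open>energy_estimate\<close>). The mean is handled separately: \<open>A\<close> annihilates constants.

  Functions in the domain and right-hand sides are only absolutely continuous and square integrable,
  so the calculus is done for pairs of a function and an integrable density of it
  (\<open>primitive_on\<close>), and weak derivatives are identified with such densities by testing against
  explicit smooth bumps (\<open>has_weak_deriv_unique\<close>, \<open>has_weak_deriv_imp_interior_primitive\<close>).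
\<close>

section \<open>Absolutely continuous functions\<close>

text \<open>
  Absolute continuity on an interval, carried by the density \<open>f\<close>: a pointwise derivative of \<open>F\<close>
  need not exist everywhere.
\<close>

definition primitive_on :: "real \<Rightarrow> real \<Rightarrow> (real \<Rightarrow> complex) \<Rightarrow> (real \<Rightarrow> complex) \<Rightarrow> bool" where
  "primitive_on a b F f \<longleftrightarrow>
     f absolutely_integrable_on {a..b} \<and> (\<forall>x\<in>{a..b}. integral {a..x} f = F x - F a)"

lemma primitive_on_integral:
  assumes "primitive_on a b F f" "a \<le> x" "x \<le> y" "y \<le> b"
  shows "integral {x..y} f = F y - F x"
proof -
  have "f integrable_on {a..b}"
    using assms(1) by (simp add: primitive_on_def absolutely_integrable_on_def)
  then have "f integrable_on {a..y}"
    using assms by (auto intro: integrable_subinterval_real)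
  then have "integral {a..x} f + integral {x..y} f = integral {a..y} f"
    using assms by (intro Henstock_Kurzweil_Integration.integral_combine) auto
  moreover have "integral {a..x} f = F x - F a" "integral {a..y} f = F y - F a"
    using assms by (auto simp: primitive_on_def)
  ultimately show ?thesis
    by (metis add_diff_cancel_left' diff_diff_eq2 diff_add_cancel add_diff_eq)
qed

lemma primitive_on_absolutely_integrable:
  assumes "primitive_on a b F f" "a \<le> x" "y \<le> b"
  shows "f absolutely_integrable_on {x..y}"
  using assms absolutely_integrable_on_subinterval[of "{a..b}" f x y] by (auto simp: primitive_on_def)

lemma primitive_onI:
  assumes "f absolutely_integrable_on {a..b}"
    and "\<And>x. a \<le> x \<Longrightarrow> x \<le> b \<Longrightarrow> integral {a..x} f = F x - F a"
  shows "primitive_on a b F f"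
  using assms by (simp add: primitive_on_def)

lemma primitive_on_subinterval:
  assumes "primitive_on a b F f" "a \<le> c" "d \<le> b"
  shows "primitive_on c d F f"
proof (rule primitive_onI)
  show "f absolutely_integrable_on {c..d}"
    using assms by (auto intro: primitive_on_absolutely_integrable)
  show "integral {c..x} f = F x - F c" if "c \<le> x" "x \<le> d" for x
    using assms that by (auto intro: primitive_on_integral)
qed

lemma primitive_on_continuous:
  assumes "primitive_on a b F f"
  shows "continuous_on {a..b} F"
proof -
  have "f integrable_on {a..b}"
    using assms by (simp add: primitive_on_def absolutely_integrable_on_def)
  then have "continuous_on {a..b} (\<lambda>x. F a + integral {a..x} f)"
    by (intro continuous_intros indefinite_integral_continuous_1)
  then show ?thesis
    by (rule continuous_on_eq) (use assms in \<open>simp add: primitive_on_def\<close>)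
qed

lemma primitive_on_C1:
  assumes "\<And>x. a \<le> x \<Longrightarrow> x \<le> b \<Longrightarrow> (F has_vector_derivative f x) (at x)"
    and "continuous_on {a..b} f"
  shows "primitive_on a b F f"
proof (rule primitive_onI)
  show "f absolutely_integrable_on {a..b}"
    using assms(2) by (rule absolutely_integrable_continuous_real)
  show "integral {a..x} f = F x - F a" if "a \<le> x" "x \<le> b" for x
    using that assms(1)
    by (intro integral_unique fundamental_theorem_of_calculus)
       (auto intro: has_vector_derivative_at_within)
qed

lemma primitive_on_spike:
  assumes "primitive_on a b F f" "negligible N"
    and "\<And>x. x \<in> {a..b} \<Longrightarrow> x \<notin> N \<Longrightarrow> g x = f x"
    and "\<And>x. x \<in> {a..b} \<Longrightarrow> G x = F x"
  shows "primitive_on a b G g"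
proof (rule primitive_onI)
  show "g absolutely_integrable_on {a..b}"
    by (rule absolutely_integrable_spike[where f = f and S = N])
       (use assms(1-3) in \<open>auto simp: primitive_on_def\<close>)
  show "integral {a..x} g = G x - G a" if "a \<le> x" "x \<le> b" for x
  proof -
    have "integral {a..x} g = integral {a..x} f"
      by (rule integral_spike[OF assms(2)]) (use that assms(3) in auto)
    also have "\<dots> = F x - F a"
      using that assms(1) by (auto intro: primitive_on_integral)
    finally show ?thesis
      using that assms(4) by simp
  qed
qed

lemma primitive_on_add:
  assumes "primitive_on a b F f" "primitive_on a b G g"
  shows "primitive_on a b (\<lambda>x. F x + G x) (\<lambda>x. f x + g x)"
proof (rule primitive_onI)
  show "(\<lambda>x. f x + g x) absolutely_integrable_on {a..b}"
    using assms by (simp add: primitive_on_def set_integral_add)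
  show "integral {a..x} (\<lambda>x. f x + g x) = F x + G x - (F a + G a)" if "a \<le> x" "x \<le> b" for x
  proof -
    have "f absolutely_integrable_on {a..x}" "g absolutely_integrable_on {a..x}"
      using that assms by (auto intro: primitive_on_absolutely_integrable)
    then have "integral {a..x} (\<lambda>x. f x + g x) = integral {a..x} f + integral {a..x} g"
      by (intro Henstock_Kurzweil_Integration.integral_add) (auto simp: absolutely_integrable_on_def)
    with that assms show ?thesis
      by (simp add: primitive_on_def)
  qed
qed

lemma primitive_on_linear:
  assumes "primitive_on a b F f" "bounded_linear h"
  shows "primitive_on a b (\<lambda>x. h (F x)) (\<lambda>x. h (f x))"
proof (rule primitive_onI)
  interpret bounded_linear h by fact
  show "(\<lambda>x. h (f x)) absolutely_integrable_on {a..b}"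
    using assms absolutely_integrable_linear[of "{a..b}" f h] by (simp add: primitive_on_def o_def)
  show "integral {a..x} (\<lambda>x. h (f x)) = h (F x) - h (F a)" if "a \<le> x" "x \<le> b" for x
  proof -
    have "f integrable_on {a..x}"
      using that assms primitive_on_absolutely_integrable[of a b F f a x]
      by (auto simp: absolutely_integrable_on_def)
    then have "integral {a..x} (\<lambda>x. h (f x)) = h (integral {a..x} f)"
      using assms(2) integral_linear[of f "{a..x}" h] by (simp add: o_def)
    with that assms show ?thesis
      by (simp add: primitive_on_integral diff)
  qed
qed

lemma primitive_on_const: "primitive_on a b (\<lambda>_. c) (\<lambda>_. 0)"
  by (rule primitive_on_C1) auto

text \<open>
  Cut \<open>[a, b]\<close> at points where \<open>H\<close> takes equally spaced values: \<open>n\<close> pieces each contribute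
  \<open>O(1/n\<^sup>2)\<close>, hence \<open>O(1/n)\<close> in total.
\<close>

lemma constant_if_increments_quadratic:
  fixes D :: "real \<Rightarrow> 'a::real_normed_vector" and H :: "real \<Rightarrow> real"
  assumes ab: "a \<le> b" and H: "continuous_on {a..b} H"
    and D: "\<And>x y. a \<le> x \<Longrightarrow> x \<le> y \<Longrightarrow> y \<le> b \<Longrightarrow> norm (D y - D x) \<le> C * (H y - H x)\<^sup>2"
  shows "D b = D a"
proof -
  define L where "L = H b - H a"
  have D': "norm (D y - D x) \<le> C * (H y - H x)\<^sup>2" if xy: "x \<in> {a..b}" "y \<in> {a..b}" for x y
  proof (cases "x \<le> y")
    case True
    then show ?thesis using D[of x y] xy by simp
  next
    case False
    then have "norm (D x - D y) \<le> C * (H x - H y)\<^sup>2" using D[of y x] xy by simp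
    then show ?thesis by (subst norm_minus_commute, subst power2_commute)
  qed
  have bound: "norm (D b - D a) \<le> C * L\<^sup>2 / real n" if n: "n > 0" for n
  proof -
    have "\<exists>x\<in>{a..b}. H x = H a + real i / real n * L" if "i \<le> n" for i
    proof -
      have "H a + real i / real n * L \<in> closed_segment (H a) (H b)"
      proof -
        have "H a + real i / real n * L = (1 - real i / real n) *\<^sub>R H a + (real i / real n) *\<^sub>R H b"
          by (simp add: L_def algebra_simps diff_divide_distrib)
        then show ?thesis
          unfolding closed_segment_def using that n
          by (intro CollectI exI[of _ "real i / real n"]) auto
      qed
      moreover have "closed_segment (H a) (H b) \<subseteq> H ` {a..b}"
      proof -
        have "connected (H ` {a..b})" using H by (intro connected_continuous_image) auto
        then have "convex (H ` {a..b})"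
          by (simp add: is_interval_convex_1 flip: is_interval_connected_1)
        then show ?thesis using ab by (intro closed_segment_subset) auto
      qed
      ultimately show ?thesis by (metis (no_types, lifting) imageE subsetD)
    qed
    then obtain x where x: "\<And>i. i \<le> n \<Longrightarrow> x i \<in> {a..b} \<and> H (x i) = H a + real i / real n * L"
      by metis
    have "H (x 0) = H a" "H (x n) = H b"
      using x[of 0] x[of n] n by (auto simp: L_def)
    moreover have "x 0 \<in> {a..b}" "x n \<in> {a..b}"
      using x by auto
    ultimately have "norm (D a - D (x 0)) \<le> 0" "norm (D b - D (x n)) \<le> 0"
      using D'[of "x 0" a] D'[of "x n" b] ab by simp_all
    then have x0: "D (x 0) = D a" and xn: "D (x n) = D b"
      by simp_all
    have step: "norm (D (x (Suc i)) - D (x i)) \<le> C * (L / n)\<^sup>2" if "i < n" for i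
    proof -
      have "H (x (Suc i)) - H (x i) = L / n"
        using x[of i] x[of "Suc i"] that by (simp add: add_divide_distrib distrib_right)
      moreover have "x i \<in> {a..b}" "x (Suc i) \<in> {a..b}"
        using x[of i] x[of "Suc i"] that by auto
      ultimately show ?thesis using D'[of "x i" "x (Suc i)"] by simp
    qed
    have "D b - D a = (\<Sum>i<n. D (x (Suc i)) - D (x i))"
      using sum_lessThan_telescope[of "\<lambda>i. D (x i)" n] by (simp add: x0 xn)
    also have "norm \<dots> \<le> (\<Sum>i<n. C * (L / n)\<^sup>2)"
      by (intro sum_norm_le step) auto
    also have "\<dots> = C * L\<^sup>2 / real n"
      using n by (simp add: power2_eq_square)
    finally show ?thesis .
  qed
  have "(\<lambda>n. C * L\<^sup>2 / real n) \<longlonglongrightarrow> 0"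
    by (rule lim_const_over_n)
  then have "norm (D b - D a) \<le> 0"
    by (rule LIMSEQ_le_const) (use bound in \<open>auto intro!: exI[of _ 1]\<close>)
  then show ?thesis by simp
qed

lemma absolutely_integrable_continuous_mult:
  fixes F f :: "real \<Rightarrow> complex"
  assumes "continuous_on {a..b} F" "f absolutely_integrable_on {a..b}"
  shows "(\<lambda>x. F x * f x) absolutely_integrable_on {a..b}"
proof (rule absolutely_integrable_bounded_measurable_product[of "(*)"])
  show "bilinear ((*) :: complex \<Rightarrow> complex \<Rightarrow> complex)"
    by (rule bilinear_times)
  show "F \<in> borel_measurable (lebesgue_on {a..b})"
    using assms(1) by (intro continuous_imp_measurable_on_sets_lebesgue) auto
  show "bounded (F ` {a..b})"
    using assms(1) by (intro compact_imp_bounded compact_continuous_image) auto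
qed (use assms in auto)

text \<open>
  The product rule for absolutely continuous functions. On a short interval the defect
  \<open>F G - \<integral> (f G + F g)\<close> changes by at most twice the square of the increment of
  \<open>H = \<integral> (\<bar>f\<bar> + \<bar>g\<bar>)\<close>; so the defect is constant.
\<close>

lemma primitive_on_mult:
  assumes F: "primitive_on a b F f" and G: "primitive_on a b G g"
  shows "primitive_on a b (\<lambda>x. F x * G x) (\<lambda>x. f x * G x + F x * g x)"
proof (rule primitive_onI)
  have f: "f absolutely_integrable_on {a..b}" and g: "g absolutely_integrable_on {a..b}"
    using F G by (auto simp: primitive_on_def)
  have cF: "continuous_on {a..b} F" and cG: "continuous_on {a..b} G"
    using F G by (auto intro: primitive_on_continuous)
  let ?p = "\<lambda>x. f x * G x + F x * g x"
  have fG: "(\<lambda>x. f x * G x) absolutely_integrable_on {a..b}"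
    using absolutely_integrable_continuous_mult[OF cG f] by (simp add: mult.commute)
  have Fg: "(\<lambda>x. F x * g x) absolutely_integrable_on {a..b}"
    using absolutely_integrable_continuous_mult[OF cF g] .
  show p: "?p absolutely_integrable_on {a..b}"
    using fG Fg by (rule set_integral_add)
  define h where "h = (\<lambda>x. norm (f x) + norm (g x))"
  have h: "h integrable_on {a..b}"
    using f g unfolding h_def by (intro integrable_add) (auto simp: absolutely_integrable_on_def)
  define H where "H = (\<lambda>x. integral {a..x} h)"
  define D where "D = (\<lambda>x. F x * G x - integral {a..x} ?p)"
  show "integral {a..c} ?p = F c * G c - F a * G a" if c: "a \<le> c" "c \<le> b" for c
  proof -
    have "D c = D a"
    proof (rule constant_if_increments_quadratic[where H = H and C = 3])
      show "a \<le> c" by fact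
      show "continuous_on {a..c} H"
        using indefinite_integral_continuous_1[OF h] c unfolding H_def
        by (auto intro: continuous_on_subset)
      show "norm (D y - D x) \<le> 3 * (H y - H x)\<^sup>2" if xy: "a \<le> x" "x \<le> y" "y \<le> c" for x y
      proof -
        have sub: "{x..y} \<subseteq> {a..b}" using xy c by auto
        have hxy: "h integrable_on {x..y}"
          using integrable_subinterval_real[OF h sub] .
        have Hxy: "H y - H x = integral {x..y} h"
          using Henstock_Kurzweil_Integration.integral_combine[of a x y h]
            integrable_subinterval_real[OF h, of a y] xy c
          by (simp add: H_def algebra_simps)
        have f': "f absolutely_integrable_on {x..y}" and g': "g absolutely_integrable_on {x..y}"
          and fG': "(\<lambda>x. f x * G x) absolutely_integrable_on {x..y}"
          and Fg': "(\<lambda>x. F x * g x) absolutely_integrable_on {x..y}"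
          using absolutely_integrable_on_subinterval[OF _ sub] f g fG Fg by auto
        have small: "norm (F t - F x) \<le> H y - H x" "norm (G t - G x) \<le> H y - H x"
          if t: "x \<le> t" "t \<le> y" for t
        proof -
          have ht: "h integrable_on {x..t}"
            using integrable_subinterval_real[OF h] t xy c by auto
          have "integral {x..t} h \<le> integral {x..y} h"
            using t hxy ht by (intro integral_subset_le) (auto simp: h_def)
          moreover have "norm (integral {x..t} f) \<le> integral {x..t} h"
            using f' ht t absolutely_integrable_on_subinterval[of "{x..y}" f x t]
            by (intro integral_norm_bound_integral) (auto simp: absolutely_integrable_on_def h_def)
          moreover have "norm (integral {x..t} g) \<le> integral {x..t} h"
            using g' ht t absolutely_integrable_on_subinterval[of "{x..y}" g x t]
            by (intro integral_norm_bound_integral) (auto simp: absolutely_integrable_on_def h_def)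
          ultimately show "norm (F t - F x) \<le> H y - H x" "norm (G t - G x) \<le> H y - H x"
            using primitive_on_integral[OF F, of x t] primitive_on_integral[OF G, of x t] Hxy t xy c
            by auto
        qed
        have nonneg: "0 \<le> H y - H x"
          unfolding Hxy by (rule Henstock_Kurzweil_Integration.integral_nonneg[OF hxy]) (simp add: h_def)
        \<comment> \<open>?q is the density after freezing both factors at the left endpoint x.\<close>
        let ?q = "\<lambda>t. f t * (G t - G x) + (F t - F x) * g t"
        have int: "(\<lambda>t. f t * G x) integrable_on {x..y}" "(\<lambda>t. F x * g t) integrable_on {x..y}"
          "(\<lambda>t. f t * G t) integrable_on {x..y}" "(\<lambda>t. F t * g t) integrable_on {x..y}"
          using f' g' fG' Fg' unfolding absolutely_integrable_on_def
          by (auto intro: integrable_on_mult_left integrable_on_mult_right)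
        have q: "?q integrable_on {x..y}"
          unfolding right_diff_distrib left_diff_distrib
          by (intro integrable_add integrable_diff int)
        have "integral {x..y} ?p = integral {x..y} (\<lambda>t. ?q t + (f t * G x + F x * g t))"
          by (intro integral_cong) (simp add: algebra_simps)
        also have "\<dots> = integral {x..y} ?q + ((F y - F x) * G x + F x * (G y - G x))"
          using q int primitive_on_integral[OF F, of x y] primitive_on_integral[OF G, of x y] xy c
          by (simp add: Henstock_Kurzweil_Integration.integral_add integrable_add)
        finally have p_q: "integral {x..y} ?p = integral {x..y} ?q
            + ((F y - F x) * G x + F x * (G y - G x))" .
        have "integral {a..y} ?p = integral {a..x} ?p + integral {x..y} ?p"
          using absolutely_integrable_on_subinterval[OF p, of a y] xy c
          by (subst Henstock_Kurzweil_Integration.integral_combine)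
             (auto simp: absolutely_integrable_on_def)
        then have "D y - D x = F y * G y - F x * G x - integral {x..y} ?p"
          by (simp add: D_def)
        also have "\<dots> = (F y - F x) * (G y - G x) - integral {x..y} ?q"
        proof -
          have "Fy * Gy - Fx * Gx - (I + ((Fy - Fx) * Gx + Fx * (Gy - Gx)))
              = (Fy - Fx) * (Gy - Gx) - I" for Fx Fy Gx Gy I :: complex
            by (simp add: algebra_simps)
          then show ?thesis unfolding p_q .
        qed
        finally have "norm (D y - D x) \<le> norm (F y - F x) * norm (G y - G x) + norm (integral {x..y} ?q)"
          using norm_triangle_ineq4[of "(F y - F x) * (G y - G x)" "integral {x..y} ?q"]
          by (simp only: norm_mult)
        moreover have "norm (F y - F x) * norm (G y - G x) \<le> (H y - H x) * (H y - H x)"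
          using small[of y] xy nonneg by (intro mult_mono) auto
        moreover have "norm (integral {x..y} ?q) \<le> integral {x..y} (\<lambda>t. (H y - H x) * h t)"
        proof (rule integral_norm_bound_integral)
          show "norm (?q t) \<le> (H y - H x) * h t" if "t \<in> {x..y}" for t
          proof -
            have "norm (?q t) \<le> norm (f t) * norm (G t - G x) + norm (F t - F x) * norm (g t)"
              using norm_triangle_ineq[of "f t * (G t - G x)" "(F t - F x) * g t"]
              by (simp only: norm_mult)
            also have "\<dots> \<le> norm (f t) * (H y - H x) + (H y - H x) * norm (g t)"
              using small[of t] that nonneg by (intro add_mono mult_mono) auto
            finally show ?thesis by (simp add: h_def algebra_simps)
          qed
        next
          show "(\<lambda>t. (H y - H x) * h t) integrable_on {x..y}"
            by (intro integrable_on_mult_right hxy)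
        qed (rule q)
        moreover have "integral {x..y} (\<lambda>t. (H y - H x) * h t) = (H y - H x) * (H y - H x)"
          by (simp add: Hxy)
        ultimately have "norm (D y - D x) \<le> 2 * (H y - H x)\<^sup>2"
          by (simp only: power2_eq_square)
        then show ?thesis
          using zero_le_power2[of "H y - H x"] by linarith
      qed
    qed
    moreover have "D a = F a * G a" by (simp add: D_def)
    ultimately have "F c * G c - integral {a..c} ?p = F a * G a" by (simp only: D_def)
    moreover have "I = X - Y" if "X - I = Y" for X Y I :: complex
      using that by auto
    ultimately show ?thesis by blast
  qed
qed

section \<open>Smooth bumps\<close>

text \<open>
  The functions \<open>p(x) E(x)\<^sup>-\<^sup>k exp (- \<kappa> / E(x))\<close> with \<open>E(x) = (x - a) (b - x)\<close>, extended by zero.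
  For fixed \<open>a\<close>, \<open>b\<close>, \<open>\<kappa>\<close> this family is closed under differentiation, which makes each of its members
  smooth.
\<close>

definition bump_term :: "real \<Rightarrow> real \<Rightarrow> real \<Rightarrow> real poly \<Rightarrow> nat \<Rightarrow> real \<Rightarrow> real" where
  "bump_term a b \<kappa> p k x =
     (if a < x \<and> x < b
      then poly p x * inverse ((x - a) * (b - x)) ^ k * exp (- \<kappa> * inverse ((x - a) * (b - x)))
      else 0)"

definition bump :: "real \<Rightarrow> real \<Rightarrow> real \<Rightarrow> real \<Rightarrow> real" where
  "bump a b \<kappa> = bump_term a b \<kappa> 1 0"

text \<open>
  The exponential beats every power of \<open>1/E\<close>, here the power \<open>k + 2\<close>; this leaves a factor \<open>E\<^sup>2\<close>, and
  hence a zero derivative at the points where the two pieces are glued.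
\<close>

lemma bump_term_quadratic_bound:
  assumes "\<kappa> > 0"
  obtains C where "C \<ge> 0" "\<And>x. \<bar>bump_term a b \<kappa> p k x\<bar> \<le> C * ((x - a) * (b - x))\<^sup>2"
proof -
  have "bounded (poly p ` {a..b})"
    by (intro compact_imp_bounded compact_continuous_image continuous_intros) auto
  then obtain B where B: "B > 0" "\<And>x. a < x \<Longrightarrow> x < b \<Longrightarrow> \<bar>poly p x\<bar> \<le> B"
    by (auto simp: bounded_pos)
  define n where "n = k + 2"
  define M where "M = (real n / \<kappa>) ^ n"
  have M: "y ^ n * exp (- \<kappa> * y) \<le> M" if "y \<ge> 0" for y
  proof -
    have "(\<kappa> * y / n) ^ n \<le> (1 + \<kappa> * y / n) ^ n"
      using that assms by (intro power_mono) auto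
    also have "\<dots> \<le> exp (\<kappa> * y)"
    proof (rule exp_ge_one_plus_x_over_n_power_n)
      have "0 \<le> \<kappa> * y" using that assms by simp
      then show "- real n \<le> \<kappa> * y" by linarith
    qed (simp add: n_def)
    finally have "(\<kappa> * y / n) ^ n * (exp (- (\<kappa> * y)) * M) \<le> exp (\<kappa> * y) * (exp (- (\<kappa> * y)) * M)"
      using assms by (intro mult_right_mono) (auto simp: M_def)
    then have "(\<kappa> * y / n) ^ n * M * exp (- (\<kappa> * y)) \<le> M"
      by (simp add: mult.assoc[symmetric] mult_exp_exp) (simp add: mult_ac)
    moreover have "(\<kappa> * y / n) ^ n * M = y ^ n"
      using assms by (simp add: M_def n_def flip: power_mult_distrib)
    ultimately show ?thesis
      by simp
  qed
  have M0: "M \<ge> 0" using assms by (simp add: M_def)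
  show ?thesis
  proof (rule that[of "B * M"])
    show "\<bar>bump_term a b \<kappa> p k x\<bar> \<le> B * M * ((x - a) * (b - x))\<^sup>2" for x
    proof (cases "a < x \<and> x < b")
      case True
      define E where "E = (x - a) * (b - x)"
      have E: "E > 0" using True by (simp add: E_def)
      have "\<bar>bump_term a b \<kappa> p k x\<bar> = \<bar>poly p x\<bar> * (inverse E ^ n * exp (- \<kappa> * inverse E)) * E\<^sup>2"
      proof -
        have "inverse E * (inverse E * (E * E)) = 1" using E by (simp add: field_simps)
        with True E show ?thesis
          by (simp add: bump_term_def abs_mult E_def[symmetric] n_def power2_eq_square)
      qed
      also have "\<dots> \<le> B * M * E\<^sup>2"
        using M[of "inverse E"] B(2)[of x] True E B(1)
        by (intro mult_right_mono mult_mono) auto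
      finally show ?thesis by (simp add: E_def)
    qed (use B M0 in \<open>auto simp: bump_term_def\<close>)
  qed (use B M0 in simp)
qed

lemma bump_term_has_derivative:
  assumes "\<kappa> > 0"
  obtains q where "\<And>x. (bump_term a b \<kappa> p k has_real_derivative bump_term a b \<kappa> q (k + 2) x) (at x)"
proof -
  define E where "E = [:- a, 1:] * [:b, - 1:]"
  define q where "q = pderiv p * E ^ 2 - smult (of_nat k) (p * pderiv E * E) + smult \<kappa> (p * pderiv E)"
  have Ex: "(x - a) * (b - x) = poly E x" for x
    by (simp add: E_def algebra_simps)
  show ?thesis
  proof (rule that[of q])
    fix x
    show "(bump_term a b \<kappa> p k has_real_derivative bump_term a b \<kappa> q (k + 2) x) (at x)"
    proof (cases "a < x \<and> x < b")
      case True
      have E0: "poly E x \<noteq> 0" using True Ex[of x] by auto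
      define D where "D = inverse (poly E x)"
      define e where "e = exp (- \<kappa> * D)"
      define E' where "E' = poly (pderiv E) x"
      have ED: "poly E x * D = 1" using E0 by (simp add: D_def)
      have D1: "((\<lambda>x. inverse (poly E x)) has_real_derivative - (E' * D\<^sup>2)) (at x)"
        using E0 by (auto intro!: derivative_eq_intros simp: E'_def D_def power2_eq_square)
      have "((\<lambda>x. poly p x * inverse (poly E x) ^ k * exp (- \<kappa> * inverse (poly E x)))
          has_real_derivative (poly (pderiv p) x * D ^ k + poly p x * (of_nat k * D ^ (k - 1) * - (E' * D\<^sup>2))) * e
            + poly p x * D ^ k * (e * (\<kappa> * (E' * D\<^sup>2)))) (at x)"
        by (rule derivative_eq_intros D1 refl poly_DERIV)+ (simp add: D_def e_def algebra_simps)
      also have "(poly (pderiv p) x * D ^ k + poly p x * (of_nat k * D ^ (k - 1) * - (E' * D\<^sup>2))) * e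
            + poly p x * D ^ k * (e * (\<kappa> * (E' * D\<^sup>2)))
          = poly q x * D ^ (k + 2) * e"
      proof -
        have 1: "(poly E x)\<^sup>2 * D ^ (k + 2) = D ^ k"
        proof -
          have "(poly E x)\<^sup>2 * D ^ (k + 2) = (poly E x * D)\<^sup>2 * D ^ k"
            by (simp add: power_add power_mult_distrib power2_eq_square mult_ac)
          then show ?thesis by (simp add: ED)
        qed
        have 2: "of_nat k * (poly E x * D ^ (k + 2)) = of_nat k * D ^ (k - 1) * D\<^sup>2"
        proof (cases k)
          case (Suc j)
          have "poly E x * D ^ (Suc j + 2) = (poly E x * D) * D ^ (j + 2)"
            by (simp add: mult_ac)
          then show ?thesis using Suc by (simp add: ED power_add power2_eq_square)
        qed simp
        have "poly q x * D ^ (k + 2) = poly (pderiv p) x * ((poly E x)\<^sup>2 * D ^ (k + 2))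
            - poly p x * E' * (of_nat k * (poly E x * D ^ (k + 2))) + \<kappa> * poly p x * E' * D ^ (k + 2)"
          by (simp add: q_def E'_def algebra_simps)
        also have "\<dots> = poly (pderiv p) x * D ^ k
            - poly p x * E' * (of_nat k * D ^ (k - 1) * D\<^sup>2) + \<kappa> * poly p x * E' * D ^ (k + 2)"
          by (simp only: 1 2)
        finally have q: "poly q x * D ^ (k + 2) = \<dots>" .
        show ?thesis
          unfolding q by (simp add: algebra_simps power_add power2_eq_square)
      qed
      finally have "((\<lambda>x. poly p x * inverse (poly E x) ^ k * exp (- \<kappa> * inverse (poly E x)))
          has_real_derivative bump_term a b \<kappa> q (k + 2) x) (at x)"
        using True by (simp add: bump_term_def Ex D_def e_def)
      then show ?thesis
        by (rule has_field_derivative_transform_within_open[where S = "{a<..<b}"])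
           (use True in \<open>auto simp: bump_term_def Ex\<close>)
    next
      case False
      obtain C where C: "C \<ge> 0" "\<And>x. \<bar>bump_term a b \<kappa> p k x\<bar> \<le> C * ((x - a) * (b - x))\<^sup>2"
        using bump_term_quadratic_bound[OF assms] by metis
      have z: "bump_term a b \<kappa> p k x = 0" "bump_term a b \<kappa> q (k + 2) x = 0"
        using False by (auto simp: bump_term_def)
      have bound: "\<bar>bump_term a b \<kappa> p k y\<bar> \<le> C * (b - a)\<^sup>2 * \<bar>y - x\<bar>\<^sup>2" for y
      proof (cases "a < y \<and> y < b")
        case True
        have "(y - a) * (b - y) \<le> (b - a) * \<bar>y - x\<bar>"
        proof (cases "x \<le> a")
          case True
          with \<open>a < y \<and> y < b\<close> show ?thesis
            using mult_mono[of "y - a" "\<bar>y - x\<bar>" "b - y" "b - a"] by (simp add: mult.commute)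
        next
          case False
          with \<open>\<not> (a < x \<and> x < b)\<close> \<open>a < y \<and> y < b\<close> show ?thesis
            by (intro mult_mono) auto
        qed
        then have "((y - a) * (b - y))\<^sup>2 \<le> ((b - a) * \<bar>y - x\<bar>)\<^sup>2"
          using True by (intro power_mono) auto
        then have "C * ((y - a) * (b - y))\<^sup>2 \<le> C * ((b - a) * \<bar>y - x\<bar>)\<^sup>2"
          using C(1) by (rule mult_left_mono)
        with C(2)[of y] show ?thesis by (simp add: power_mult_distrib mult.assoc)
      next
        case False
        then have "bump_term a b \<kappa> p k y = 0" by (auto simp: bump_term_def)
        with C(1) show ?thesis by simp
      qed
      have "((\<lambda>y. bump_term a b \<kappa> p k y / (y - x)) \<longlongrightarrow> 0) (at x)"
      proof (rule Lim_null_comparison)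
        show "\<forall>\<^sub>F y in at x. norm (bump_term a b \<kappa> p k y / (y - x)) \<le> C * (b - a)\<^sup>2 * \<bar>y - x\<bar>"
          unfolding eventually_at_filter
        proof (intro always_eventually allI impI)
          fix y assume "y \<noteq> x"
          then show "norm (bump_term a b \<kappa> p k y / (y - x)) \<le> C * (b - a)\<^sup>2 * \<bar>y - x\<bar>"
            using bound[of y] by (simp add: abs_divide divide_le_eq power2_eq_square mult.assoc)
        qed
        show "((\<lambda>y. C * (b - a)\<^sup>2 * \<bar>y - x\<bar>) \<longlongrightarrow> 0) (at x)"
          by (auto intro!: tendsto_eq_intros)
      qed
      then show ?thesis
        unfolding has_field_derivative_iff z by simp
    qed
  qed
qed

lemma deriv_funpow_bump:
  assumes "\<kappa> > 0"
  shows "\<exists>p k. (deriv ^^ n) (bump a b \<kappa>) = bump_term a b \<kappa> p k"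
proof (induction n)
  case 0
  show ?case by (auto simp: bump_def)
next
  case (Suc n)
  then obtain p k where pk: "(deriv ^^ n) (bump a b \<kappa>) = bump_term a b \<kappa> p k" by blast
  obtain q where "\<And>x. (bump_term a b \<kappa> p k has_real_derivative bump_term a b \<kappa> q (k + 2) x) (at x)"
    using bump_term_has_derivative[OF assms] by blast
  then have "deriv (bump_term a b \<kappa> p k) = bump_term a b \<kappa> q (k + 2)"
    by (intro ext DERIV_imp_deriv)
  then show ?case by (auto simp: pk)
qed

lemma bump_smooth:
  assumes "\<kappa> > 0"
  shows "((deriv ^^ n) (bump a b \<kappa>)) differentiable (at x)"
  using deriv_funpow_bump[OF assms, of n a b] bump_term_has_derivative[OF assms]
  by (metis real_differentiable_def)

lemma continuous_on_bump:
  assumes "\<kappa> > 0"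
  shows "continuous_on S (bump a b \<kappa>)"
  using bump_smooth[OF assms, of 0]
  by (auto intro!: differentiable_imp_continuous_on differentiable_at_imp_differentiable_on)

lemma bump_eq_0: "x \<notin> {a<..<b} \<Longrightarrow> bump a b \<kappa> x = 0"
  by (auto simp: bump_def bump_term_def)

lemma bump_pos: "x \<in> {a<..<b} \<Longrightarrow> bump a b \<kappa> x > 0"
  by (auto simp: bump_def bump_term_def)

lemma bump_nonneg: "bump a b \<kappa> x \<ge> 0"
  using bump_pos[of x a b \<kappa>] bump_eq_0[of x a b \<kappa>] by (cases "x \<in> {a<..<b}") auto

lemma bump_le_1: "\<kappa> > 0 \<Longrightarrow> bump a b \<kappa> x \<le> 1"
  by (auto simp: bump_def bump_term_def)

lemma test_function_bump:
  assumes "\<kappa> > 0" "0 < a" "b < 2*pi"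
  shows "test_function (bump a b \<kappa>)"
  unfolding test_function_def
  using assms bump_smooth bump_eq_0[of _ a b]
  by (intro conjI exI[of _ a] exI[of _ b]) auto

text \<open>
  Used for the primitive of a combination of two bumps with zero integral.
\<close>

lemma test_function_primitive:
  assumes h: "\<And>n x. ((deriv ^^ n) h) differentiable (at x)"
    and \<Theta>: "\<And>x. (\<Theta> has_real_derivative h x) (at x)"
    and supp: "0 < a" "b < 2*pi" "\<And>x. x \<notin> {a..b} \<Longrightarrow> \<Theta> x = 0"
  shows "test_function \<Theta>"
proof -
  have "deriv \<Theta> = h"
    using \<Theta> by (intro ext DERIV_imp_deriv)
  then have "((deriv ^^ n) \<Theta>) differentiable (at x)" for n x
    using h \<Theta> real_differentiable_def by (cases n) (auto simp: funpow_Suc_right simp del: funpow.simps)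
  with supp show ?thesis
    unfolding test_function_def by blast
qed

lemma test_functionE:
  assumes "test_function \<phi>"
  obtains a b where "0 < a" "b < 2*pi" "\<And>x. x \<notin> {a..b} \<Longrightarrow> \<phi> x = 0"
    "\<And>x. x \<notin> {a..b} \<Longrightarrow> deriv \<phi> x = 0" "continuous_on UNIV (deriv \<phi>)"
    "\<And>x. (\<phi> has_real_derivative deriv \<phi> x) (at x)"
proof -
  obtain a b where ab: "0 < a" "b < 2*pi" and supp: "\<And>x. x \<notin> {a..b} \<Longrightarrow> \<phi> x = 0"
    using assms unfolding test_function_def by metis
  have d: "((deriv ^^ n) \<phi>) differentiable (at x)" for n x
    using assms by (simp add: test_function_def)
  show thesis
  proof (rule that[OF ab supp])
    show "continuous_on UNIV (deriv \<phi>)"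
      using d[of 1] by (auto intro!: differentiable_imp_continuous_on differentiable_at_imp_differentiable_on)
    show "(\<phi> has_real_derivative deriv \<phi> x) (at x)" for x
      using d[of 0] by (simp add: DERIV_deriv_iff_real_differentiable)
    show "deriv \<phi> x = 0" if "x \<notin> {a..b}" for x
    proof (rule DERIV_imp_deriv)
      have "((\<lambda>_. 0) has_real_derivative 0) (at x)" by simp
      then show "(\<phi> has_real_derivative 0) (at x)"
        by (rule has_field_derivative_transform_within_open[where S = "- {a..b}"])
           (use that supp in auto)
    qed
  qed auto
qed

lemma deriv_funpow_diff_mult:
  fixes f g :: "real \<Rightarrow> real"
  assumes "\<And>n x. ((deriv ^^ n) f) differentiable (at x)" "\<And>n x. ((deriv ^^ n) g) differentiable (at x)"
  shows "(deriv ^^ n) (\<lambda>x. f x - c * g x) = (\<lambda>x. (deriv ^^ n) f x - c * (deriv ^^ n) g x)"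
proof (induction n)
  case (Suc n)
  have "deriv (\<lambda>x. (deriv ^^ n) f x - c * (deriv ^^ n) g x) x
      = deriv ((deriv ^^ n) f) x - c * deriv ((deriv ^^ n) g) x" for x
    using assms by (intro DERIV_imp_deriv DERIV_diff DERIV_cmult)
      (auto simp: DERIV_deriv_iff_real_differentiable)
  with Suc show ?case by auto
qed simp

section \<open>Weak derivatives and absolutely continuous representatives\<close>

lemma absolutely_integrable_iff_lebesgue_on:
  fixes f :: "real \<Rightarrow> 'a::euclidean_space"
  assumes "S \<in> sets lebesgue"
  shows "f absolutely_integrable_on S \<longleftrightarrow> integrable (lebesgue_on S) f"
  using assms by (simp add: set_integrable_def integrable_restrict_space)

text \<open>
  The density is the almost everywhere limit of its averages over short intervals.
\<close>

lemma ae_zero_if_interval_integrals_zero: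
  fixes k :: "real \<Rightarrow> 'a::euclidean_space"
  assumes k: "k integrable_on {a..b}"
    and z: "\<And>x y. a \<le> x \<Longrightarrow> x \<le> y \<Longrightarrow> y \<le> b \<Longrightarrow> integral {x..y} k = 0"
  obtains N where "negligible N" "\<And>x. x \<in> {a<..<b} - N \<Longrightarrow> k x = 0"
proof -
  define f where "f x = (if x \<in> {a..b} then k x else 0)" for x
  have "f integrable_on UNIV"
    using integrable_restrict_UNIV[of "{a..b}" k] k unfolding f_def by (simp only:)
  then have "f integrable_on cbox c d" for c d
    using integrable_on_subcbox by blast
  then obtain N where N: "negligible N"
    "\<And>x e. x \<notin> N \<Longrightarrow> 0 < e \<Longrightarrow> \<exists>d>0. \<forall>h. 0 < h \<and> h < d \<longrightarrow>
        norm (integral (cbox x (x + h *\<^sub>R One)) f /\<^sub>R h ^ DIM(real) - f x) < e"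
    using integrable_ccontinuous_explicit[of f] by blast
  show ?thesis
  proof (rule that[OF N(1)])
    fix x assume x: "x \<in> {a<..<b} - N"
    have "norm (f x) < e" if "e > 0" for e
    proof -
      obtain d where d: "d > 0" "\<And>h. 0 < h \<Longrightarrow> h < d \<Longrightarrow> norm (integral {x..x + h} f /\<^sub>R h - f x) < e"
        using N(2)[of x e] x \<open>e > 0\<close> by auto
      define h where "h = min (d / 2) (b - x)"
      have h: "0 < h" "h < d" "x + h \<le> b" using d(1) x by (auto simp: h_def)
      have "integral {x..x + h} f = integral {x..x + h} k"
        using x h by (intro integral_cong) (auto simp: f_def)
      also have "\<dots> = 0" using x h by (intro z) auto
      finally show ?thesis using d(2)[of h] h by simp
    qed
    then have "f x = 0"
      by (metis norm_le_zero_iff not_less less_irrefl)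
    then show "k x = 0" using x by (simp add: f_def)
  qed
qed

lemma lebesgue_integral_restrict_support:
  fixes g :: "real \<Rightarrow> complex"
  assumes "{a..b} \<subseteq> S" "S \<in> sets lebesgue" "g absolutely_integrable_on {a..b}"
    and "\<And>x. x \<in> S \<Longrightarrow> x \<notin> {a..b} \<Longrightarrow> g x = 0"
  shows "integrable (lebesgue_on S) g" "(LINT x|lebesgue_on S. g x) = integral {a..b} g"
proof -
  have g: "integrable (lebesgue_on {a..b}) g"
    using assms by (simp add: absolutely_integrable_iff_lebesgue_on)
  have eq: "indicator S x *\<^sub>R g x = indicator {a..b} x *\<^sub>R g x" for x
    using assms by (auto simp: indicator_def)
  show "integrable (lebesgue_on S) g"
    using g assms(2) by (simp add: integrable_restrict_space eq)
  have "(LINT x|lebesgue_on S. g x) = (LINT x|lebesgue_on {a..b}. g x)"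
    using assms(2) by (simp add: integral_restrict_space eq)
  also have "\<dots> = integral {a..b} g"
    using g by (intro lebesgue_integral_eq_integral) auto
  finally show "(LINT x|lebesgue_on S. g x) = integral {a..b} g" .
qed

lemma locally_integrable_iff:
  "locally_integrable f \<longleftrightarrow> (\<forall>a b. 0 < a \<and> b < 2*pi \<longrightarrow> f absolutely_integrable_on {a..b})"
  by (simp add: locally_integrable_def absolutely_integrable_iff_lebesgue_on)

lemma test_integral:
  assumes f: "locally_integrable f" and \<phi>: "continuous_on UNIV \<phi>"
    and ab: "0 < a" "b < 2*pi" "\<And>x. x \<notin> {a..b} \<Longrightarrow> \<phi> x = 0"
  shows "(\<lambda>x. f x * of_real (\<phi> x)) absolutely_integrable_on {a..b}"
    and "integrable (lebesgue_on {0<..<2*pi}) (\<lambda>x. f x * of_real (\<phi> x))"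
    and "(LINT x|lebesgue_on {0<..<2*pi}. f x * of_real (\<phi> x)) = integral {a..b} (\<lambda>x. f x * of_real (\<phi> x))"
proof -
  have c: "continuous_on {a..b} (\<lambda>x. complex_of_real (\<phi> x))"
    using \<phi> by (auto intro!: continuous_intros intro: continuous_on_subset)
  have "f absolutely_integrable_on {a..b}"
    using f ab by (simp add: locally_integrable_iff)
  from absolutely_integrable_continuous_mult[OF c this]
  show *: "(\<lambda>x. f x * of_real (\<phi> x)) absolutely_integrable_on {a..b}"
    by (simp add: mult.commute)
  have sub: "{a..b} \<subseteq> {0<..<2*pi}" using ab by auto
  show "integrable (lebesgue_on {0<..<2*pi}) (\<lambda>x. f x * of_real (\<phi> x))"
    and "(LINT x|lebesgue_on {0<..<2*pi}. f x * of_real (\<phi> x)) = integral {a..b} (\<lambda>x. f x * of_real (\<phi> x))"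
    using lebesgue_integral_restrict_support[OF sub _ *] ab(3) by auto
qed

text \<open>
  As \<open>\<kappa>\<close> tends to \<open>0\<close>, the bumps on \<open>(a, b)\<close> increase to the indicator function of that interval, so
  dominated convergence turns vanishing bump integrals into vanishing interval integrals.
\<close>

lemma ae_zero_if_bump_integrals_zero:
  assumes k: "locally_integrable k"
    and z: "\<And>a b \<kappa>. 0 < a \<Longrightarrow> a < b \<Longrightarrow> b < 2*pi \<Longrightarrow> \<kappa> > 0 \<Longrightarrow>
      (LINT x|lebesgue_on {0<..<2*pi}. k x * of_real (bump a b \<kappa> x)) = 0"
  obtains N where "negligible N" "\<And>x. x \<in> {0<..<2*pi} - N \<Longrightarrow> k x = 0"
proof -
  have int0: "integral {a..b} k = 0" if ab: "0 < a" "a \<le> b" "b < 2*pi" for a b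
  proof (cases "a = b")
    case False
    have kab: "k absolutely_integrable_on {a..b}"
      using k ab by (simp add: locally_integrable_iff)
    define \<kappa> where "\<kappa> n = 1 / real (Suc n)" for n
    define f where "f n x = k x * of_real (bump a b (\<kappa> n) x)" for n x
    have \<kappa>: "\<kappa> n > 0" for n by (simp add: \<kappa>_def)
    have f: "f n absolutely_integrable_on {a..b}" "integral {a..b} (f n) = 0" for n
    proof -
      have *: "x \<notin> {a..b} \<Longrightarrow> bump a b (\<kappa> n) x = 0" for x by (auto intro: bump_eq_0)
      show "f n absolutely_integrable_on {a..b}" "integral {a..b} (f n) = 0"
        using test_integral[OF k continuous_on_bump[OF \<kappa>] ab(1,3) *] z[of a b "\<kappa> n"] ab False \<kappa>
        unfolding f_def by auto
    qed
    define g where "g x = (if x \<in> {a<..<b} then k x else 0)" for x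
    have conv: "(\<lambda>n. f n x) \<longlonglongrightarrow> g x" if "x \<in> {a..b}" for x
    proof (cases "x \<in> {a<..<b}")
      case True
      have "(\<lambda>n. exp (- \<kappa> n * inverse ((x - a) * (b - x)))) \<longlonglongrightarrow> exp (- 0 * inverse ((x - a) * (b - x)))"
        unfolding \<kappa>_def by (intro tendsto_intros LIMSEQ_Suc[OF lim_const_over_n])
      then have "(\<lambda>n. bump a b (\<kappa> n) x) \<longlonglongrightarrow> 1"
        using True by (simp add: bump_def bump_term_def)
      then have "(\<lambda>n. f n x) \<longlonglongrightarrow> k x * of_real 1"
        unfolding f_def by (intro tendsto_intros)
      with True show ?thesis by (simp add: g_def)
    next
      case False
      then have "f n x = 0" "g x = 0" for n by (auto simp: f_def g_def bump_eq_0)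
      then show ?thesis by simp
    qed
    have "(\<lambda>n. integral {a..b} (f n)) \<longlonglongrightarrow> integral {a..b} g"
    proof (rule dominated_convergence(2)[where h = "\<lambda>x. norm (k x)"])
      show "norm (f n x) \<le> norm (k x)" for n x
        using bump_nonneg[of a b "\<kappa> n" x] bump_le_1[of "\<kappa> n" a b x] \<kappa>
        by (simp add: f_def norm_mult mult_left_le)
    qed (use f kab conv in \<open>auto simp: absolutely_integrable_on_def\<close>)
    then have "integral {a..b} g = 0"
      using f by (simp add: LIMSEQ_const_iff)
    moreover have "integral {a..b} g = integral {a..b} k"
      by (rule integral_spike[of "{a, b}"]) (auto simp: g_def)
    ultimately show ?thesis by simp
  qed simp
  have ae: "\<exists>N. negligible N \<and> (\<forall>x\<in>{a<..<b} - N. k x = 0)" if ab: "0 < a" "b < 2*pi" for a b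
  proof -
    have "k integrable_on {a..b}"
      using k ab by (simp add: locally_integrable_iff absolutely_integrable_on_def)
    moreover have "integral {x..y} k = 0" if "a \<le> x" "x \<le> y" "y \<le> b" for x y
      using that ab by (intro int0) auto
    ultimately show ?thesis
      by (rule ae_zero_if_interval_integrals_zero) auto
  qed
  have "\<exists>N. negligible N \<and> (\<forall>x\<in>{1 / real (Suc n)<..<2*pi - 1 / real (Suc n)} - N. k x = 0)" for n
    by (rule ae) auto
  then obtain N where N: "\<And>n. negligible (N n)"
    "\<And>n x. x \<in> {1 / real (Suc n)<..<2*pi - 1 / real (Suc n)} - N n \<Longrightarrow> k x = 0"
    by metis
  show ?thesis
  proof (rule that[of "\<Union>n. N n"])
    show "negligible (\<Union>n. N n)" using N(1) by (intro negligible_countable_Union) auto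
    fix x assume x: "x \<in> {0<..<2*pi} - (\<Union>n. N n)"
    then have "0 < min x (2*pi - x)" by auto
    then obtain n where "1 / real (Suc n) < min x (2*pi - x)"
      using reals_Archimedean[of "min x (2*pi - x)"] by (metis inverse_eq_divide)
    with x show "k x = 0" by (intro N(2)[of x n]) auto
  qed
qed

lemma has_weak_deriv_unique:
  assumes "has_weak_deriv f g" "has_weak_deriv f h"
  obtains N where "negligible N" "\<And>x. x \<in> {0<..<2*pi} - N \<Longrightarrow> g x = h x"
proof -
  have g: "locally_integrable g" and h: "locally_integrable h"
    using assms by (auto simp: has_weak_deriv_def)
  have gh: "locally_integrable (\<lambda>x. g x - h x)"
    using g h unfolding locally_integrable_def by auto
  have z: "(LINT x|lebesgue_on {0<..<2*pi}. (g x - h x) * of_real (bump a b \<kappa> x)) = 0"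
    if ab: "0 < a" "a < b" "b < 2*pi" and \<kappa>: "\<kappa> > 0" for a b \<kappa>
  proof -
    have *: "x \<notin> {a..b} \<Longrightarrow> bump a b \<kappa> x = 0" for x by (auto intro: bump_eq_0)
    have t: "test_function (bump a b \<kappa>)"
      using ab \<kappa> by (intro test_function_bump) auto
    have "- (LINT x|lebesgue_on {0<..<2*pi}. g x * of_real (bump a b \<kappa> x))
      = - (LINT x|lebesgue_on {0<..<2*pi}. h x * of_real (bump a b \<kappa> x))"
      using assms t by (simp add: has_weak_deriv_def)
    then show ?thesis
      using test_integral(2)[OF g continuous_on_bump[OF \<kappa>] ab(1,3) *]
        test_integral(2)[OF h continuous_on_bump[OF \<kappa>] ab(1,3) *]
      by (simp add: left_diff_distrib)
  qed
  obtain N where "negligible N" "\<And>x. x \<in> {0<..<2*pi} - N \<Longrightarrow> g x - h x = 0"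
    using ae_zero_if_bump_integrals_zero[OF gh z] by blast
  then show ?thesis
    by (intro that[of N]) auto
qed

text \<open>
  Absolute continuity on compact subintervals of the open interval. Nothing is assumed at the peak,
  where functions in the domain may jump or blow up.
\<close>

definition interior_primitive :: "(real \<Rightarrow> complex) \<Rightarrow> (real \<Rightarrow> complex) \<Rightarrow> bool" where
  "interior_primitive F f \<longleftrightarrow> (\<forall>a b. 0 < a \<and> b < 2*pi \<longrightarrow> primitive_on a b F f)"

lemma interior_primitiveD:
  "interior_primitive F f \<Longrightarrow> 0 < a \<Longrightarrow> b < 2*pi \<Longrightarrow> primitive_on a b F f"
  by (simp add: interior_primitive_def)

lemma interior_primitive_continuous:
  assumes "interior_primitive F f"
  shows "continuous_on {0<..<2*pi} F"
proof (rule continuous_at_imp_continuous_on, rule ballI)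
  fix x assume x: "x \<in> {0<..<2*pi}"
  have "continuous_on {x / 2..(x + 2*pi) / 2} F"
    using x assms by (intro primitive_on_continuous interior_primitiveD) auto
  then show "isCont F x"
    by (rule continuous_on_interior) (use x in auto)
qed

lemma interior_primitive_cong:
  assumes "interior_primitive F f" "\<And>x. x \<in> {0<..<2*pi} \<Longrightarrow> g x = f x"
  shows "interior_primitive F g"
  unfolding interior_primitive_def
proof (intro allI impI)
  fix a b :: real assume ab: "0 < a \<and> b < 2*pi"
  then have "primitive_on a b F f" using assms(1) by (simp add: interior_primitive_def)
  then show "primitive_on a b F g"
    by (rule primitive_on_spike[OF _ negligible_empty]) (use assms(2) ab in auto)
qed

lemma interior_primitive_C1:
  assumes "\<And>x. x \<in> {0<..<2*pi} \<Longrightarrow> (F has_vector_derivative f x) (at x)" "continuous_on {0<..<2*pi} f"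
  shows "interior_primitive F f"
  unfolding interior_primitive_def
proof (intro allI impI)
  fix a b :: real assume ab: "0 < a \<and> b < 2*pi"
  show "primitive_on a b F f"
  proof (rule primitive_on_C1)
    show "continuous_on {a..b} f"
      using assms(2) by (rule continuous_on_subset) (use ab in auto)
  qed (use assms(1) ab in auto)
qed

lemma interior_primitive_mult:
  assumes "interior_primitive F f" "interior_primitive G g"
  shows "interior_primitive (\<lambda>x. F x * G x) (\<lambda>x. f x * G x + F x * g x)"
  using assms unfolding interior_primitive_def by (auto intro!: primitive_on_mult)

lemma interior_primitive_add:
  assumes "interior_primitive F f" "interior_primitive G g"
  shows "interior_primitive (\<lambda>x. F x + G x) (\<lambda>x. f x + g x)"
  using assms unfolding interior_primitive_def by (auto intro!: primitive_on_add)

lemma interior_primitive_linear: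
  assumes "interior_primitive F f" "bounded_linear h"
  shows "interior_primitive (\<lambda>x. h (F x)) (\<lambda>x. h (f x))"
  using assms(1) primitive_on_linear[of _ _ F f h] assms(2) unfolding interior_primitive_def by blast

lemma interior_primitive_const: "interior_primitive (\<lambda>_. c) (\<lambda>_. 0)"
  unfolding interior_primitive_def by (auto intro!: primitive_on_const)

lemma interior_primitive_zero_constant:
  assumes F: "interior_primitive F f" and N: "negligible N" "\<And>x. x \<in> {0<..<2*pi} - N \<Longrightarrow> f x = 0"
  shows "\<exists>C. \<forall>x\<in>{0<..<2*pi}. F x = C"
proof -
  have inc: "F b = F a" if ab: "0 < a" "a \<le> b" "b < 2*pi" for a b
  proof -
    have "F b - F a = integral {a..b} f"
      using primitive_on_integral[OF interior_primitiveD[OF F ab(1,3)], of a b] ab by simp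
    also have "\<dots> = integral {a..b} (\<lambda>_. 0)"
      by (rule integral_spike[OF N(1)]) (use N(2) ab in auto)
    finally show ?thesis by simp
  qed
  have "F x = F pi" if "x \<in> {0<..<2*pi}" for x
  proof (cases "x \<le> pi")
    case True
    then have "F pi = F x" using that by (intro inc) auto
    then show ?thesis by (rule sym)
  next
    case False
    then show ?thesis using that by (intro inc) auto
  qed
  then show ?thesis by blast
qed

lemma interior_primitive_locally_integrable:
  assumes "interior_primitive F f"
  shows "locally_integrable f"
  using assms unfolding interior_primitive_def locally_integrable_iff primitive_on_def by blast

lemma continuous_locally_integrable:
  assumes "continuous_on {0<..<2*pi} f"
  shows "locally_integrable f"
  unfolding locally_integrable_iff
  using assms by (auto intro!: absolutely_integrable_continuous_real elim!: continuous_on_subset)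

text \<open>
  The product rule for \<open>f \<phi>\<close> on an interval slightly larger than the support of \<open>\<phi>\<close>, where the
  boundary values vanish.
\<close>

lemma interior_primitive_has_weak_deriv:
  assumes f: "interior_primitive f k"
  shows "has_weak_deriv f k"
  unfolding has_weak_deriv_def
proof (intro conjI allI impI)
  show lf: "locally_integrable f"
    using f by (intro continuous_locally_integrable interior_primitive_continuous)
  show lk: "locally_integrable k"
    using f by (rule interior_primitive_locally_integrable)
  fix \<phi> assume \<phi>: "test_function \<phi>"
  then obtain a b where ab: "0 < a" "b < 2*pi" and supp: "\<And>x. x \<notin> {a..b} \<Longrightarrow> \<phi> x = 0"
    and dsupp: "\<And>x. x \<notin> {a..b} \<Longrightarrow> deriv \<phi> x = 0" and cont: "continuous_on UNIV (deriv \<phi>)"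
    and d: "\<And>x. (\<phi> has_real_derivative deriv \<phi> x) (at x)"
    by (rule test_functionE) blast
  have cont0: "continuous_on UNIV \<phi>"
    using d by (intro DERIV_continuous_on) (auto intro: has_field_derivative_at_within)
  define a' b' where "a' = min a pi / 2" and "b' = (max b pi + 2*pi) / 2"
  have ab': "0 < a'" "a' < a" "b < b'" "b' < 2*pi" "a' \<le> b'"
    using ab pi_gt_zero by (auto simp: a'_def b'_def min_def max_def field_simps)
  have \<phi>0: "\<phi> x = 0" if "x \<notin> {a'..b'}" for x
    using that ab' by (intro supp) auto
  have d\<phi>0: "deriv \<phi> x = 0" if "x \<notin> {a'..b'}" for x
    using that ab' by (intro dsupp) auto
  have "primitive_on a' b' (\<lambda>x. complex_of_real (\<phi> x)) (\<lambda>x. complex_of_real (deriv \<phi> x))"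
  proof (rule primitive_on_C1)
    show "((\<lambda>x. complex_of_real (\<phi> x)) has_vector_derivative complex_of_real (deriv \<phi> x)) (at x)" for x
      using d[of x] by (intro has_vector_derivative_of_real)
        (simp flip: has_real_derivative_iff_has_vector_derivative)
    show "continuous_on {a'..b'} (\<lambda>x. complex_of_real (deriv \<phi> x))"
      using cont by (auto intro!: continuous_intros elim!: continuous_on_subset)
  qed
  with interior_primitiveD[OF f ab'(1,4)]
  have p: "primitive_on a' b' (\<lambda>x. f x * of_real (\<phi> x)) (\<lambda>x. k x * of_real (\<phi> x) + f x * of_real (deriv \<phi> x))"
    by (rule primitive_on_mult)
  have i1: "(\<lambda>x. k x * of_real (\<phi> x)) absolutely_integrable_on {a'..b'}"
    and e1: "(LINT x|lebesgue_on {0<..<2*pi}. k x * of_real (\<phi> x)) = integral {a'..b'} (\<lambda>x. k x * of_real (\<phi> x))"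
    using test_integral[OF lk cont0 ab'(1,4) \<phi>0] by auto
  have i2: "(\<lambda>x. f x * of_real (deriv \<phi> x)) absolutely_integrable_on {a'..b'}"
    and e2: "(LINT x|lebesgue_on {0<..<2*pi}. f x * of_real (deriv \<phi> x)) = integral {a'..b'} (\<lambda>x. f x * of_real (deriv \<phi> x))"
    using test_integral[OF lf cont ab'(1,4) d\<phi>0] by auto
  have "\<phi> a' = 0" "\<phi> b' = 0" using ab' by (auto intro: supp)
  then have "integral {a'..b'} (\<lambda>x. k x * of_real (\<phi> x) + f x * of_real (deriv \<phi> x)) = 0"
    using primitive_on_integral[OF p, of a' b'] ab' by simp
  then have "integral {a'..b'} (\<lambda>x. k x * of_real (\<phi> x)) + integral {a'..b'} (\<lambda>x. f x * of_real (deriv \<phi> x)) = 0"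
    using i1 i2 by (simp add: Henstock_Kurzweil_Integration.integral_add absolutely_integrable_on_def)
  then show "(LINT x|lebesgue_on {0<..<2*pi}. f x * of_real (deriv \<phi> x))
      = - (LINT x|lebesgue_on {0<..<2*pi}. k x * of_real (\<phi> x))"
    unfolding e1 e2 by (simp add: add_eq_0_iff)
qed

lemma interior_primitive_exists:
  assumes k: "locally_integrable k"
  obtains F where "interior_primitive F k"
proof -
  define F where "F x = (if pi \<le> x then integral {pi..x} k else - integral {x..pi} k)" for x
  have int: "k integrable_on {a..b}" if "0 < a" "b < 2*pi" for a b
    using k that by (simp add: locally_integrable_iff absolutely_integrable_on_def)
  have "integral {a..x} k = F x - F a" if ax: "0 < a" "a \<le> x" "x < 2*pi" for a x
  proof -
    consider "pi \<le> a" | "a < pi" "pi \<le> x" | "x < pi" by linarith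
    then show ?thesis
    proof cases
      case 1
      then have "integral {pi..a} k + integral {a..x} k = integral {pi..x} k"
        using ax by (intro Henstock_Kurzweil_Integration.integral_combine int) auto
      moreover have "F x = integral {pi..x} k" "F a = integral {pi..a} k"
        using 1 ax by (auto simp: F_def)
      ultimately show ?thesis by (simp add: eq_diff_eq add.commute)
    next
      case 2
      then have "integral {a..pi} k + integral {pi..x} k = integral {a..x} k"
        using ax by (intro Henstock_Kurzweil_Integration.integral_combine int) auto
      moreover have "F x = integral {pi..x} k" "F a = - integral {a..pi} k"
        using 2 ax by (auto simp: F_def)
      ultimately show ?thesis by (simp add: add.commute)
    next
      case 3
      then have "integral {a..x} k + integral {x..pi} k = integral {a..pi} k"
        using ax by (intro Henstock_Kurzweil_Integration.integral_combine int) auto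
      moreover have "F x = - integral {x..pi} k" "F a = - integral {a..pi} k"
        using 3 ax by (auto simp: F_def)
      ultimately show ?thesis by (simp add: algebra_simps)
    qed
  qed
  then have "interior_primitive F k"
    unfolding interior_primitive_def
    using k by (auto intro!: primitive_onI simp: locally_integrable_iff)
  then show thesis by (rule that)
qed

text \<open>
  Du Bois-Reymond's argument: subtracting from a bump \<open>\<theta>\<close> the multiple of a fixed bump \<open>\<theta>0\<close> with
  the same integral leaves the derivative of a test function. Hence \<open>\<integral> u \<theta>\<close> is proportional to
  \<open>\<integral> \<theta>\<close>, that is, \<open>u - C\<close> is orthogonal to every bump for a suitable constant \<open>C\<close>.
\<close>

lemma weak_deriv_zero_imp_constant:
  assumes "has_weak_deriv u (\<lambda>_. 0)"
  obtains C N where "negligible N" "\<And>x. x \<in> {0<..<2*pi} - N \<Longrightarrow> u x = C"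
proof -
  let ?L = "\<lambda>g. LINT x|lebesgue_on {0<..<2*pi}. g x :: complex"
  have u: "locally_integrable u" using assms by (simp add: has_weak_deriv_def)
  have z: "?L (\<lambda>x. u x * of_real (deriv \<phi> x)) = 0" if "test_function \<phi>" for \<phi>
    using assms that by (simp add: has_weak_deriv_def)
  have pi2: "(2::real) < 2 * pi" using pi_gt3 by simp
  define \<theta>0 where "\<theta>0 = bump 1 2 1"
  have c0: "continuous_on S \<theta>0" for S unfolding \<theta>0_def by (rule continuous_on_bump) simp
  define I0 where "I0 = integral {1..2} \<theta>0"
  have I0: "I0 \<noteq> 0"
  proof
    assume "I0 = 0"
    then have "\<forall>x\<in>{1..2}. \<theta>0 x = 0"
      using integral_eq_0_iff[of 1 2 \<theta>0] c0 bump_nonneg by (simp add: I0_def \<theta>0_def)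
    then show False using bump_pos[of "3/2" 1 2 1] by (force simp: \<theta>0_def)
  qed
  have s0: "\<theta>0 x = 0" if "x \<notin> {1..2}" for x using that by (auto simp: \<theta>0_def intro: bump_eq_0)
  define C where "C = ?L (\<lambda>x. u x * of_real (\<theta>0 x)) / of_real I0"
  have one: "locally_integrable (\<lambda>_. C)"
    by (rule continuous_locally_integrable) auto
  have uC: "locally_integrable (\<lambda>x. u x - C)"
    using u one unfolding locally_integrable_def by auto
  have "?L (\<lambda>x. (u x - C) * of_real (bump a b \<kappa> x)) = 0"
    if ab: "0 < a" "a < b" "b < 2*pi" and \<kappa>: "\<kappa> > 0" for a b \<kappa>
  proof -
    define \<theta> where "\<theta> = bump a b \<kappa>"
    have c: "continuous_on S \<theta>" for S unfolding \<theta>_def by (rule continuous_on_bump[OF \<kappa>])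
    have s: "\<theta> x = 0" if "x \<notin> {a..b}" for x using that by (auto simp: \<theta>_def intro: bump_eq_0)
    define I where "I = integral {a..b} \<theta>"
    define h where "h x = \<theta> x - I / I0 * \<theta>0 x" for x
    define a' b' where "a' = min a 1" and "b' = max b 2"
    have ab': "0 < a'" "b' < 2*pi" "a' \<le> a" "a' \<le> 1" "b \<le> b'" "2 \<le> b'"
      using ab pi2 by (auto simp: a'_def b'_def)
    have ch: "continuous_on S h" for S
      unfolding h_def by (intro continuous_intros c c0)
    have sh: "h x = 0" if "x \<notin> {a'..b'}" for x
      using that s[of x] s0[of x] ab' by (auto simp: h_def)
    have Ih: "integral {a'..b'} h = 0"
    proof -
      have "integral {a'..b'} \<theta> = integral {a..b} \<theta>" "integral {a'..b'} \<theta>0 = integral {1..2} \<theta>0"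
        using s s0 ab' by (auto intro!: integral_spike_set negligible_subset[OF negligible_empty])
      then show ?thesis
        using I0 unfolding h_def
        by (subst Henstock_Kurzweil_Integration.integral_diff)
           (auto simp: I_def I0_def intro!: integrable_continuous_real continuous_intros c c0)
    qed
    obtain H where H: "\<And>x. (H has_vector_derivative h x) (at x)"
      using einterval_antiderivative[of "-\<infinity>" "\<infinity>" h] ch[of UNIV]
      by (auto simp: continuous_on_eq_continuous_at)
    define \<Theta> where "\<Theta> x = H x - H a'" for x
    have d\<Theta>: "(\<Theta> has_real_derivative h x) (at x)" for x
      unfolding \<Theta>_def using H[of x]
      by (auto simp: has_real_derivative_iff_has_vector_derivative intro!: derivative_eq_intros)
    have H_int: "H y - H x = integral {x..y} h" if "x \<le> y" for x y
      using that H
      by (intro integral_unique[symmetric] fundamental_theorem_of_calculus)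
         (auto intro: has_vector_derivative_at_within)
    have "\<Theta> x = 0" if x: "x \<notin> {a'..b'}" for x
    proof (cases "x < a'")
      case True
      then have "integral {x..a'} h = integral {x..a'} (\<lambda>_. 0)"
        using sh by (intro integral_spike[of "{a'}"]) auto
      then show ?thesis using H_int[of x a'] True by (simp add: \<Theta>_def)
    next
      case False
      then have "integral {a'..x} h = integral {a'..b'} h"
        using x sh by (auto intro!: integral_spike_set negligible_subset[OF negligible_empty])
      then show ?thesis using H_int[of a' x] False Ih by (simp add: \<Theta>_def)
    qed
    moreover have "((deriv ^^ n) h) differentiable (at x)" for n x
    proof -
      have sm: "((deriv ^^ n) \<theta>) differentiable (at x)" "((deriv ^^ n) \<theta>0) differentiable (at x)" for n x
        using \<kappa> by (auto simp: \<theta>_def \<theta>0_def intro!: bump_smooth)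
      have "(deriv ^^ n) h = (\<lambda>x. (deriv ^^ n) \<theta> x - I / I0 * (deriv ^^ n) \<theta>0 x)"
        unfolding h_def by (rule deriv_funpow_diff_mult[OF sm])
      then show ?thesis using sm I0 by (auto intro!: derivative_intros)
    qed
    ultimately have "test_function \<Theta>"
      using d\<Theta> ab'(1,2) by (intro test_function_primitive[of h \<Theta> a' b']) auto
    from z[OF this] have Lh: "?L (\<lambda>x. u x * of_real (h x)) = 0"
      using DERIV_imp_deriv[OF d\<Theta>] by simp
    have u\<theta>: "integrable (lebesgue_on {0<..<2*pi}) (\<lambda>x. u x * of_real (\<theta> x))"
      using test_integral(2)[OF u c ab(1,3) s] by auto
    have C\<theta>: "integrable (lebesgue_on {0<..<2*pi}) (\<lambda>x. C * of_real (\<theta> x))"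
      "?L (\<lambda>x. C * of_real (\<theta> x)) = integral {a..b} (\<lambda>x. C * of_real (\<theta> x))"
      using test_integral(2,3)[OF one c ab(1,3) s] by auto
    have u\<theta>0: "integrable (lebesgue_on {0<..<2*pi}) (\<lambda>x. u x * of_real (\<theta>0 x))"
      using test_integral(2)[OF u c0 zero_less_one pi2 s0] by auto
    have "?L (\<lambda>x. u x * of_real (h x)) = ?L (\<lambda>x. u x * of_real (\<theta> x) - of_real (I / I0) * (u x * of_real (\<theta>0 x)))"
      by (simp add: h_def algebra_simps)
    also have "\<dots> = ?L (\<lambda>x. u x * of_real (\<theta> x)) - of_real (I / I0) * ?L (\<lambda>x. u x * of_real (\<theta>0 x))"
      using u\<theta> u\<theta>0 by (subst Bochner_Integration.integral_diff) auto
    also have "of_real (I / I0) * ?L (\<lambda>x. u x * of_real (\<theta>0 x)) = C * of_real I"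
      by (simp add: C_def)
    also have "C * of_real I = ?L (\<lambda>x. C * of_real (\<theta> x))"
    proof -
      have "integral {a..b} (\<lambda>x. complex_of_real (\<theta> x)) = of_real I"
        using integral_linear[of \<theta> "{a..b}" complex_of_real] bounded_linear_of_real
          integrable_continuous_real[OF c]
        by (simp add: I_def o_def)
      then show ?thesis unfolding C\<theta>(2) by simp
    qed
    finally have "?L (\<lambda>x. u x * of_real (\<theta> x)) - ?L (\<lambda>x. C * of_real (\<theta> x)) = 0"
      by (simp add: Lh)
    then show ?thesis
      using u\<theta> C\<theta>(1) unfolding left_diff_distrib \<theta>_def[symmetric]
      by (subst Bochner_Integration.integral_diff) auto
  qed
  then obtain N where "negligible N" "\<And>x. x \<in> {0<..<2*pi} - N \<Longrightarrow> u x - C = 0"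
    using ae_zero_if_bump_integrals_zero[OF uC] by blast
  then show thesis by (intro that[of N C]) auto
qed

lemma has_weak_deriv_imp_interior_primitive:
  assumes "has_weak_deriv f k"
  obtains F N where "interior_primitive F k" "negligible N"
    "\<And>x. x \<in> {0<..<2*pi} - N \<Longrightarrow> f x = F x"
proof -
  have f: "locally_integrable f" and k: "locally_integrable k"
    using assms by (auto simp: has_weak_deriv_def)
  obtain F where F: "interior_primitive F k"
    using interior_primitive_exists[OF k] .
  have wF: "has_weak_deriv F k"
    using F by (rule interior_primitive_has_weak_deriv)
  then have lF: "locally_integrable F" by (simp add: has_weak_deriv_def)
  have "has_weak_deriv (\<lambda>x. f x - F x) (\<lambda>_. 0)"
    unfolding has_weak_deriv_def
  proof (intro conjI allI impI)
    show "locally_integrable (\<lambda>x. f x - F x)"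
      using f lF unfolding locally_integrable_def by auto
    show "locally_integrable (\<lambda>_. 0)"
      by (rule continuous_locally_integrable) auto
    fix \<phi> assume \<phi>: "test_function \<phi>"
    then obtain a b where ab: "0 < a" "b < 2*pi"
      and d: "\<And>x. x \<notin> {a..b} \<Longrightarrow> deriv \<phi> x = 0" and cont: "continuous_on UNIV (deriv \<phi>)"
      by (rule test_functionE) blast
    have "(LINT x|lebesgue_on {0<..<2*pi}. f x * of_real (deriv \<phi> x))
        = (LINT x|lebesgue_on {0<..<2*pi}. F x * of_real (deriv \<phi> x))"
      using assms wF \<phi> by (simp add: has_weak_deriv_def)
    then show "(LINT x|lebesgue_on {0<..<2*pi}. (f x - F x) * of_real (deriv \<phi> x))
        = - (LINT x|lebesgue_on {0<..<2*pi}. 0 * of_real (\<phi> x))"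
      using test_integral(2)[OF f cont ab d] test_integral(2)[OF lF cont ab d]
      unfolding left_diff_distrib by (subst Bochner_Integration.integral_diff) auto
  qed
  from weak_deriv_zero_imp_constant[OF this]
  obtain C N where N: "negligible N" and C: "\<forall>x\<in>{0<..<2*pi} - N. f x - F x = C"
    by (metis (no_types, lifting))
  show ?thesis
  proof (rule that[of "\<lambda>x. F x + C" N])
    show "interior_primitive (\<lambda>x. F x + C) k"
      unfolding interior_primitive_def
    proof (intro allI impI)
      fix a b :: real assume "0 < a \<and> b < 2*pi"
      then have "primitive_on a b F k"
        using F by (simp add: interior_primitive_def)
      from primitive_on_add[OF this primitive_on_const]
      show "primitive_on a b (\<lambda>x. F x + C) k" by simp
    qed
    show "f x = F x + C" if "x \<in> {0<..<2*pi} - N" for x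
      using C that by (simp add: algebra_simps)
  qed fact
qed

section \<open>Square-integrable functions and their classes\<close>

lemma ae_circleI:
  assumes "negligible N" "\<And>x. x \<in> {0<..<2*pi} - N \<Longrightarrow> P x"
  shows "AE x in circle_measure. P x"
proof -
  have "negligible (N \<union> {0, 2*pi})"
    using assms(1) by simp
  then have "AE x in lebesgue. x \<notin> N \<union> {0, 2*pi}"
    by (intro AE_not_in) (simp add: negligible_iff_null_sets)
  then have "AE x in lebesgue. x \<in> {0..2*pi} \<longrightarrow> P x"
    by eventually_elim (use assms(2) in force)
  then show ?thesis
    by (subst AE_restrict_space_iff) auto
qed

lemma ae_circleD:
  assumes "AE x in circle_measure. P x"
  obtains N where "negligible N" "\<And>x. x \<in> {0<..<2*pi} - N \<Longrightarrow> P x"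
proof -
  have "AE x in lebesgue. x \<in> {0..2*pi} \<longrightarrow> P x"
    using assms by (subst (asm) AE_restrict_space_iff) auto
  then obtain N where "N \<in> null_sets lebesgue" "{x \<in> space lebesgue. \<not> (x \<in> {0..2*pi} \<longrightarrow> P x)} \<subseteq> N"
    by (auto simp: eventually_ae_filter)
  then have "negligible N" "\<forall>x. 0 \<le> x \<and> x \<le> 2*pi \<and> x \<notin> N \<longrightarrow> P x"
    by (auto simp: negligible_iff_null_sets)
  then show thesis
    by (intro that[of N]) auto
qed

lemma square_integrable_iff:
  "square_integrable f \<longleftrightarrow>
     f absolutely_integrable_on {0..2*pi} \<and> (\<lambda>x. (norm (f x))\<^sup>2) integrable_on {0..2*pi}"
proof
  assume f: "square_integrable f"
  then have m: "f \<in> borel_measurable circle_measure"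
    and i: "(\<lambda>x. (norm (f x))\<^sup>2) integrable_on {0..2*pi}"
    by (auto simp: square_integrable_def intro: integrable_on_lebesgue_on)
  have "norm (f x) \<le> 1 + (norm (f x))\<^sup>2" for x
    using zero_le_power2[of "norm (f x) - 1/2"] by (simp add: power2_eq_square algebra_simps)
  moreover have "(\<lambda>x. 1 + (norm (f x))\<^sup>2) integrable_on {0..2*pi}"
    using i by (intro integrable_add integrable_const_ivl)
  ultimately have "f absolutely_integrable_on {0..2*pi}"
    by (intro measurable_bounded_by_integrable_imp_absolutely_integrable[OF m]) auto
  with i show "f absolutely_integrable_on {0..2*pi} \<and> (\<lambda>x. (norm (f x))\<^sup>2) integrable_on {0..2*pi}"
    by simp
next
  assume f: "f absolutely_integrable_on {0..2*pi} \<and> (\<lambda>x. (norm (f x))\<^sup>2) integrable_on {0..2*pi}"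
  then have "(\<lambda>x. (norm (f x))\<^sup>2) absolutely_integrable_on {0..2*pi}"
    by (intro nonnegative_absolutely_integrable_1) auto
  with f show "square_integrable f"
    by (simp add: square_integrable_def absolutely_integrable_imp_borel_measurable
        absolutely_integrable_iff_lebesgue_on)
qed

lemma square_integrable_integrable_on:
  assumes "square_integrable f" "0 \<le> x" "y \<le> 2*pi"
  shows "f integrable_on {x..y}"
  using assms integrable_subinterval_real[of f 0 "2*pi" x y]
  by (auto simp: square_integrable_iff absolutely_integrable_on_def)

text \<open>
  Almost everywhere statements are phrased with a negligible set and the open interval, so that the
  endpoints never have to be discussed.
\<close>

lemma square_integrable_spike:
  assumes "square_integrable f" "negligible N" "\<And>x. x \<in> {0<..<2*pi} - N \<Longrightarrow> g x = f x"
  shows "square_integrable g" "integral {0..2*pi} (\<lambda>x. (norm (g x))\<^sup>2) = integral {0..2*pi} (\<lambda>x. (norm (f x))\<^sup>2)"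
proof -
  let ?N = "N \<union> {0, 2*pi}"
  have N: "negligible ?N" using assms(2) by simp
  have eq: "g x = f x" if "x \<in> {0..2*pi} - ?N" for x
    using that assms(3)[of x] by auto
  show "square_integrable g"
    unfolding square_integrable_iff
  proof
    show "g absolutely_integrable_on {0..2*pi}"
      by (rule absolutely_integrable_spike[OF _ N eq]) (use assms(1) in \<open>simp_all add: square_integrable_iff\<close>)
    show "(\<lambda>x. (norm (g x))\<^sup>2) integrable_on {0..2*pi}"
      by (rule integrable_spike[OF _ N]) (use assms(1) eq in \<open>simp_all add: square_integrable_iff\<close>)
  qed
  show "integral {0..2*pi} (\<lambda>x. (norm (g x))\<^sup>2) = integral {0..2*pi} (\<lambda>x. (norm (f x))\<^sup>2)"
    by (rule integral_spike[OF N]) (use eq in simp)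
qed

definition norm_sq :: "(real \<Rightarrow> complex) \<Rightarrow> real" where
  "norm_sq f = integral {0..2*pi} (\<lambda>x. (norm (f x))\<^sup>2)"

lemma norm_sq_nonneg: "norm_sq f \<ge> 0"
  unfolding norm_sq_def
  by (cases "(\<lambda>x. (norm (f x))\<^sup>2) integrable_on {0..2*pi}")
     (auto intro: Henstock_Kurzweil_Integration.integral_nonneg simp: not_integrable_integral)

text \<open>
  The Cauchy-Schwarz inequality for \<open>f\<close> and the indicator function of \<open>[x, y]\<close>, from
  \<open>2 \<bar>f\<bar> \<le> s \<bar>f\<bar>\<^sup>2 + 1/s\<close> with the optimal parameter \<open>s\<close>.
\<close>

lemma norm_integral_le_norm_sq:
  assumes f: "square_integrable f" and xy: "0 \<le> x" "x \<le> y" "y \<le> 2*pi"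
  shows "(norm (integral {x..y} f))\<^sup>2 \<le> (y - x) * norm_sq f"
proof (cases "integral {x..y} f = 0 \<or> x = y")
  case True
  then show ?thesis using xy norm_sq_nonneg[of f] by auto
next
  case False
  define d where "d = y - x"
  define I where "I = norm (integral {x..y} f)"
  define s where "s = d / I"
  have pos: "d > 0" "I > 0" "s > 0" using False xy by (auto simp: d_def I_def s_def)
  have sub: "{x..y} \<subseteq> {0..2*pi}" using xy by auto
  have fi: "f absolutely_integrable_on {x..y}"
    using f absolutely_integrable_on_subinterval[of "{0..2*pi}" f x y] sub by (simp add: square_integrable_iff)
  have f2: "(\<lambda>t. (norm (f t))\<^sup>2) integrable_on {0..2*pi}" "(\<lambda>t. (norm (f t))\<^sup>2) integrable_on {x..y}"
    using f integrable_subinterval_real[OF _ sub] by (auto simp: square_integrable_iff)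
  have "I \<le> integral {x..y} (\<lambda>t. (s * (norm (f t))\<^sup>2 + 1 / s) / 2)"
    unfolding I_def
  proof (rule integral_norm_bound_integral)
    show "norm (f t) \<le> (s * (norm (f t))\<^sup>2 + 1 / s) / 2" for t
    proof -
      have "0 \<le> (s * norm (f t) - 1)\<^sup>2 / s" using pos by simp
      also have "\<dots> = s * (norm (f t))\<^sup>2 + 1 / s - 2 * norm (f t)"
        using pos by (simp add: power2_eq_square field_simps)
      finally show ?thesis by simp
    qed
    show "(\<lambda>t. (s * (norm (f t))\<^sup>2 + 1 / s) / 2) integrable_on {x..y}"
      using f2(2) by (intro integrable_on_divide integrable_add integrable_on_mult_right integrable_const_ivl)
  qed (use fi in \<open>simp add: absolutely_integrable_on_def\<close>)
  also have "\<dots> = (s * integral {x..y} (\<lambda>t. (norm (f t))\<^sup>2) + d / s) / 2"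
  proof -
    have "integral {x..y} (\<lambda>t. s * (norm (f t))\<^sup>2 + 1 / s)
        = integral {x..y} (\<lambda>t. s * (norm (f t))\<^sup>2) + integral {x..y} (\<lambda>t. 1 / s)"
      using f2(2)
      by (intro Henstock_Kurzweil_Integration.integral_add integrable_on_mult_right integrable_const_ivl)
    then show ?thesis using xy by (simp add: d_def)
  qed
  also have "integral {x..y} (\<lambda>t. (norm (f t))\<^sup>2) \<le> norm_sq f"
    unfolding norm_sq_def using f2 sub by (intro integral_subset_le) auto
  finally have "I \<le> (s * norm_sq f + d / s) / 2" using pos by simp
  then have "I * I \<le> d * norm_sq f"
    using pos by (simp add: s_def field_simps)
  then show ?thesis by (simp add: I_def d_def power2_eq_square)
qed

lemma l2_eqI:
  assumes "square_integrable f" "negligible N" "\<And>x. x \<in> {0<..<2*pi} - N \<Longrightarrow> g x = f x"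
  shows "l2_eq g f"
  unfolding l2_eq_def using assms square_integrable_spike(1)[OF assms]
  by (auto intro: ae_circleI)

lemma abs_l2_eqI:
  assumes "square_integrable f" "negligible N" "\<And>x. x \<in> {0<..<2*pi} - N \<Longrightarrow> g x = f x"
  shows "abs_l2 g = abs_l2 f"
  using Quotient_rel[OF Quotient_l2, of g f] l2_eqI[OF assms] by simp

lemma abs_l2_eq_iff:
  assumes "square_integrable f" "square_integrable g"
  shows "abs_l2 f = abs_l2 g \<longleftrightarrow> (AE x in circle_measure. f x = g x)"
  using Quotient_rel[OF Quotient_l2, of f g] assms by (auto simp: l2_eq_def)

lemma l2_eq_refl: "square_integrable f \<Longrightarrow> l2_eq f f"
  by (simp add: l2_eq_def)

lemma square_integrable_rep: "square_integrable (rep_l2 f)"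
  using Quotient_rep_reflp[OF Quotient_l2, of f] by (simp add: l2_eq_def)

lemma abs_rep_l2: "abs_l2 (rep_l2 f) = f"
  by (rule Quotient_abs_rep[OF Quotient_l2])

lemma rep_abs_l2:
  assumes "square_integrable f"
  obtains N where "negligible N" "\<And>x. x \<in> {0<..<2*pi} - N \<Longrightarrow> rep_l2 (abs_l2 f) x = f x"
proof -
  have "l2_eq (rep_l2 (abs_l2 f)) f"
    using Quotient_rep_abs[OF Quotient_l2, OF l2_eq_refl[OF assms]] .
  then show thesis
    using that ae_circleD[of "\<lambda>x. rep_l2 (abs_l2 f) x = f x"] by (auto simp: l2_eq_def)
qed

lemma abs_l2_add:
  assumes "square_integrable f" "square_integrable g"
  shows "abs_l2 f + abs_l2 g = abs_l2 (\<lambda>x. f x + g x)"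
  using assms by (intro plus_l2.abs_eq l2_eq_refl)

lemma abs_l2_scaleC:
  assumes "square_integrable f"
  shows "scaleC z (abs_l2 f) = abs_l2 (\<lambda>x. z * f x)"
  using assms by (intro scaleC.abs_eq l2_eq_refl)

lemma abs_l2_diff:
  assumes "square_integrable f" "square_integrable g"
  shows "abs_l2 f - abs_l2 g = abs_l2 (\<lambda>x. f x - g x)"
proof -
  have "- abs_l2 g = abs_l2 (\<lambda>x. - g x)"
    using assms by (intro uminus_l2.abs_eq l2_eq_refl)
  then show ?thesis
    using assms square_integrable_mult_left[OF assms(2), of "-1"]
    by (simp add: minus_l2_def abs_l2_add)
qed

lemma norm_abs_l2:
  assumes "square_integrable f"
  shows "norm (abs_l2 f) = sqrt (norm_sq f)"
proof -
  have "abs_l2 f \<bullet> abs_l2 f = (LINT x|circle_measure. (norm (f x))\<^sup>2)"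
    using assms by (subst inner_l2.abs_eq) (auto simp: l2_eq_refl power2_norm_eq_inner)
  also have "\<dots> = norm_sq f"
    unfolding norm_sq_def using assms
    by (intro lebesgue_integral_eq_integral) (auto simp: square_integrable_def)
  finally show ?thesis by (simp add: norm_eq_sqrt_inner)
qed

lemma scaleC_add_right: "scaleC c (f + g) = scaleC c f + scaleC c g"
  by transfer (auto simp: l2_eq_def distrib_left intro!: square_integrable_add square_integrable_mult_left)

lemma scaleC_add_left: "scaleC (c + d) f = scaleC c f + scaleC d f"
  by transfer (auto simp: l2_eq_def distrib_right intro!: square_integrable_add square_integrable_mult_left)

lemma scaleC_scaleC: "scaleC c (scaleC d f) = scaleC (c * d) f"
  by transfer (auto simp: l2_eq_def mult.assoc intro!: square_integrable_mult_left)

lemma scaleC_of_real: "scaleC (of_real r) f = r *\<^sub>R f"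
  by transfer (auto simp: l2_eq_def intro!: square_integrable_mult_left)

lemma norm_scaleC: "norm (scaleC c f) = norm c * norm f"
proof -
  define u where "u = rep_l2 f"
  have u: "square_integrable u" "f = abs_l2 u"
    by (auto simp: u_def square_integrable_rep abs_rep_l2)
  have "norm_sq (\<lambda>x. c * u x) = (norm c)\<^sup>2 * norm_sq u"
    by (simp add: norm_sq_def norm_mult power_mult_distrib)
  then show ?thesis
    by (simp add: u(2) abs_l2_scaleC[OF u(1)] norm_abs_l2 u(1) square_integrable_mult_left real_sqrt_mult)
qed

lemma square_integrable_diff:
  assumes "square_integrable f" "square_integrable g"
  shows "square_integrable (\<lambda>x. f x - g x)"
  using square_integrable_add[OF assms(1) square_integrable_mult_left[OF assms(2), of "-1"]] by simp

lemma square_integrable_const: "square_integrable (\<lambda>_. c)"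
  unfolding square_integrable_iff
  by (auto intro!: absolutely_integrable_continuous_real integrable_const_ivl)

text \<open>
  Turns estimates that are uniform over compact subintervals into square integrability up to the
  peak, by monotone convergence.
\<close>

lemma square_integrable_of_interior_bound:
  fixes f :: "real \<Rightarrow> complex"
  assumes cont: "continuous_on {0<..<2*pi} f"
    and bound: "\<And>a b. 0 < a \<Longrightarrow> a \<le> b \<Longrightarrow> b < 2*pi \<Longrightarrow> integral {a..b} (\<lambda>x. (norm (f x))\<^sup>2) \<le> B"
  shows "square_integrable f" "norm_sq f \<le> B"
proof -
  define I where "I n = {1 / real (Suc n)..2*pi - 1 / real (Suc n)}" for n
  define g where "g n x = (if x \<in> I n then (norm (f x))\<^sup>2 else 0)" for n x
  define h where "h x = (if x \<in> {0<..<2*pi} then (norm (f x))\<^sup>2 else 0)" for x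
  have le1: "1 / real (Suc n) \<le> 1" for n by simp
  have I: "I n \<subseteq> {0<..<2*pi}" "I n \<subseteq> {0..2*pi}" for n
  proof -
    define e where "e = 1 / real (Suc n)"
    have "e > 0" by (simp add: e_def)
    then show "I n \<subseteq> {0<..<2*pi}" "I n \<subseteq> {0..2*pi}"
      unfolding I_def e_def[symmetric] by auto
  qed
  have int_I: "(\<lambda>x. (norm (f x))\<^sup>2) integrable_on I n" for n
    using continuous_on_subset[OF cont I(1)[of n]] unfolding I_def
    by (intro integrable_continuous_real continuous_intros)
  have int_g: "g n integrable_on {0..2*pi}" "integral {0..2*pi} (g n) \<le> B" for n
  proof -
    show "g n integrable_on {0..2*pi}"
      unfolding g_def using int_I I(2)[of n] by (simp add: integrable_restrict_Int Int_absorb2)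
    have "integral {0..2*pi} (g n) = integral (I n) (\<lambda>x. (norm (f x))\<^sup>2)"
      unfolding g_def using I(2)[of n] by (simp add: integral_restrict_Int Int_absorb2)
    also have "\<dots> \<le> B"
    proof -
      define e where "e = 1 / real (Suc n)"
      have "0 < e" "e \<le> 1" using le1[of n] by (auto simp: e_def)
      then show ?thesis
        unfolding I_def e_def[symmetric] using pi_gt3 by (intro bound) auto
    qed
    finally show "integral {0..2*pi} (g n) \<le> B" .
  qed
  have mono: "g n x \<le> g (Suc n) x" for n x
  proof -
    have "1 / real (Suc (Suc n)) \<le> 1 / real (Suc n)" by (simp add: field_simps)
    then have "I n \<subseteq> I (Suc n)" unfolding I_def by auto
    then show ?thesis by (auto simp: g_def)
  qed
  have lim: "(\<lambda>n. g n x) \<longlonglongrightarrow> h x" for x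
  proof (cases "x \<in> {0<..<2*pi}")
    case True
    then have "0 < min x (2*pi - x)" by auto
    then obtain N where N: "1 / real (Suc N) < min x (2*pi - x)"
      using reals_Archimedean[of "min x (2*pi - x)"] by (metis inverse_eq_divide)
    have "g n x = h x" if "n \<ge> N" for n
    proof -
      have "1 / real (Suc n) \<le> 1 / real (Suc N)" using that by (simp add: field_simps)
      with N have "x \<in> I n" unfolding I_def by auto
      with True show ?thesis by (simp add: g_def h_def)
    qed
    then show ?thesis by (intro tendsto_eventually) (auto simp: eventually_sequentially)
  next
    case False
    then have "x \<notin> I n" for n using I(1) by blast
    then have "g n x = 0" "h x = 0" for n using False by (auto simp: g_def h_def)
    then show ?thesis by simp
  qed
  have bdd: "bounded (range (\<lambda>n. integral {0..2*pi} (g n)))"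
  proof (rule boundedI)
    fix y assume "y \<in> range (\<lambda>n. integral {0..2*pi} (g n))"
    then obtain n where n: "y = integral {0..2*pi} (g n)" by auto
    have "0 \<le> integral {0..2*pi} (g n)"
      using int_g(1) by (intro Henstock_Kurzweil_Integration.integral_nonneg) (auto simp: g_def)
    with n int_g(2)[of n] show "norm y \<le> B" by simp
  qed
  have H: "h integrable_on {0..2*pi}" "(\<lambda>n. integral {0..2*pi} (g n)) \<longlonglongrightarrow> integral {0..2*pi} h"
    using monotone_convergence_increasing[of g "{0..2*pi}" h] int_g(1) mono lim bdd by blast+
  have N: "negligible {0, 2*pi}" by simp
  have eq: "(norm (f x))\<^sup>2 = h x" if "x \<in> {0..2*pi} - {0, 2*pi}" for x
    using that by (auto simp: h_def)
  have f2: "(\<lambda>x. (norm (f x))\<^sup>2) integrable_on {0..2*pi}"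
    using H(1) by (rule integrable_spike[OF _ N]) (use eq in auto)
  have "norm_sq f = integral {0..2*pi} h"
    unfolding norm_sq_def by (rule integral_spike[OF N]) (use eq in auto)
  also have "\<dots> \<le> B"
    using H(2) by (rule LIMSEQ_le_const2) (use int_g in auto)
  finally show "norm_sq f \<le> B" .
  have "f absolutely_integrable_on {0<..<2*pi}"
  proof (rule measurable_bounded_by_integrable_imp_absolutely_integrable)
    show "f \<in> borel_measurable (lebesgue_on {0<..<2*pi})"
      using cont by (intro continuous_imp_measurable_on_sets_lebesgue) auto
    have "(\<lambda>x. 1 + (norm (f x))\<^sup>2) integrable_on {0..2*pi}"
      using f2 by (intro integrable_add integrable_const_ivl)
    then show "(\<lambda>x. 1 + (norm (f x))\<^sup>2) integrable_on {0<..<2*pi}"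
      by (simp add: integrable_on_Icc_iff_Ioo)
    show "norm (f x) \<le> 1 + (norm (f x))\<^sup>2" for x
      using zero_le_power2[of "norm (f x) - 1/2"] by (simp add: power2_eq_square algebra_simps)
  qed auto
  then have "f absolutely_integrable_on {0..2*pi}"
    by (simp add: absolutely_integrable_on_Icc_iff_Ioo)
  with f2 show "square_integrable f"
    by (simp add: square_integrable_iff)
qed

section \<open>The operator as w f' + V f / 2\<close>

definition wt :: "real \<Rightarrow> real" where
  "wt x = x * (2*pi - x) / 4"

lemma wt_pos: "x \<in> {0<..<2*pi} \<Longrightarrow> wt x > 0"
  by (simp add: wt_def)

lemma weighted_deriv_eq:
  "x \<in> {0..2*pi} \<Longrightarrow> weighted_deriv f x = of_real (wt x) * weak_deriv f x"
  by (simp add: weighted_deriv_def c_star_eta_star wt_def)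

text \<open>
  The primitive of \<open>f - mean f\<close> that vanishes at the peak; written \<open>V f\<close> in the comments.
\<close>

definition pinned_primitive :: "(real \<Rightarrow> complex) \<Rightarrow> real \<Rightarrow> complex" where
  "pinned_primitive f = antiderivative (zero_mean_proj f)"

lemma square_integrable_zero_mean_proj:
  "square_integrable f \<Longrightarrow> square_integrable (zero_mean_proj f)"
  unfolding zero_mean_proj_def by (intro square_integrable_diff square_integrable_const)

lemma zero_mean_proj_eq:
  assumes "square_integrable f"
  shows "zero_mean_proj f x = f x - integral {0..2*pi} f / (2*pi)"
proof -
  have "integrable circle_measure f"
    using assms by (simp add: square_integrable_iff absolutely_integrable_iff_lebesgue_on)
  then show ?thesis
    unfolding zero_mean_proj_def by (subst lebesgue_integral_eq_integral) auto
qed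

lemma pinned_primitive_primitive:
  assumes f: "square_integrable f"
  shows "primitive_on 0 (2*pi) (pinned_primitive f) (zero_mean_proj f)"
    and "pinned_primitive f 0 = 0" and "pinned_primitive f (2*pi) = 0"
proof -
  let ?g = "zero_mean_proj f"
  have g: "?g absolutely_integrable_on {0..2*pi}"
    using square_integrable_zero_mean_proj[OF f] by (simp add: square_integrable_iff)
  have eq: "pinned_primitive f x = integral {0..x} ?g" if "0 \<le> x" "x \<le> 2*pi" for x
  proof -
    have "?g absolutely_integrable_on {0..x}"
      using g absolutely_integrable_on_subinterval[of "{0..2*pi}" ?g 0 x] that by auto
    then show ?thesis unfolding pinned_primitive_def antiderivative_def
      by (intro lebesgue_integral_eq_integral) (auto simp: absolutely_integrable_iff_lebesgue_on)
  qed
  show z: "pinned_primitive f 0 = 0" by (simp add: eq)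
  show "primitive_on 0 (2*pi) (pinned_primitive f) ?g"
    using g eq by (intro primitive_onI) (auto simp: z)
  have "f integrable_on {0..2*pi}"
    using f by (intro square_integrable_integrable_on) auto
  then have "integral {0..2*pi} ?g = 0"
    unfolding zero_mean_proj_eq[OF f]
    by (subst Henstock_Kurzweil_Integration.integral_diff)
       (auto simp: integrable_const_ivl scaleR_conv_of_real)
  then show "pinned_primitive f (2*pi) = 0" by (simp add: eq)
qed

lemma square_integrable_pinned_primitive:
  assumes "square_integrable u"
  shows "square_integrable (pinned_primitive u)"
  unfolding square_integrable_iff using primitive_on_continuous[OF pinned_primitive_primitive(1)[OF assms]]
  by (auto intro!: absolutely_integrable_continuous_real integrable_continuous_real continuous_intros)

text \<open>
  On \<open>(0, 2\<pi>)\<close> one has \<open>\<eta>\<^sub>*'(x) = (x - \<pi>) / 4\<close>, and \<open>x - \<pi>\<close> is a primitive of \<open>1\<close> with zero mean.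
  Integrating \<open>1 \<sqdot> V f\<close> by parts, without boundary terms, therefore expresses the mean of \<open>V f\<close>
  by \<open>\<integral> \<eta>\<^sub>*' f\<close>: the rank-one term undoes the outer projection.
\<close>

lemma nonlocal_part_eq:
  fixes f :: "real \<Rightarrow> complex"
  assumes f: "square_integrable f"
  shows "- (1 / pi * (LINT t|circle_measure. of_real (deriv eta_star t) * f t))
      + 1 / 2 * zero_mean_primitive f x = 1 / 2 * pinned_primitive f x"
proof -
  let ?V = "pinned_primitive f" and ?g = "zero_mean_proj f"
  define l where "l x = complex_of_real (x - pi)" for x
  have l: "primitive_on 0 (2*pi) l (\<lambda>_. 1)"
  proof (rule primitive_on_C1)
    show "(l has_vector_derivative 1) (at x)" for x
      unfolding l_def by (auto intro!: derivative_eq_intros has_vector_derivative_of_real[of _ 1, simplified])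
  qed auto
  have fa: "f absolutely_integrable_on {0..2*pi}"
    using f by (simp add: square_integrable_iff)
  have V: "?V absolutely_integrable_on {0..2*pi}"
    using primitive_on_continuous[OF pinned_primitive_primitive(1)[OF f]] by (rule absolutely_integrable_continuous_real)
  have lcont: "continuous_on {0..2*pi} l" using primitive_on_continuous[OF l] .
  have lf: "(\<lambda>x. l x * f x) absolutely_integrable_on {0..2*pi}"
    by (rule absolutely_integrable_continuous_mult[OF lcont fa])
  have lg: "(\<lambda>x. l x * ?g x) absolutely_integrable_on {0..2*pi}"
    using square_integrable_zero_mean_proj[OF f]
    by (intro absolutely_integrable_continuous_mult[OF lcont]) (simp add: square_integrable_iff)
  have l0: "integral {0..2*pi} l = 0"
  proof (intro integral_unique)
    have "((\<lambda>x. complex_of_real (x^2 / 2 - pi * x)) has_vector_derivative l x) (at x within {0..2*pi})" for x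
      unfolding l_def by (rule has_vector_derivative_of_real)
        (auto intro!: derivative_eq_intros simp flip: has_real_derivative_iff_has_vector_derivative)
    from fundamental_theorem_of_calculus[OF _ this]
    show "(l has_integral 0) {0..2*pi}"
      by (simp add: power2_eq_square)
  qed
  have "integral {0..2*pi} (\<lambda>x. 1 * ?V x + l x * ?g x) = 0"
    using primitive_on_integral[OF primitive_on_mult[OF l pinned_primitive_primitive(1)[OF f]], of 0 "2*pi"]
    by (simp add: pinned_primitive_primitive(2,3)[OF f])
  then have "integral {0..2*pi} ?V = - integral {0..2*pi} (\<lambda>x. l x * ?g x)"
    using V lg by (simp add: Henstock_Kurzweil_Integration.integral_add absolutely_integrable_on_def eq_neg_iff_add_eq_0)
  also have "integral {0..2*pi} (\<lambda>x. l x * ?g x) = integral {0..2*pi} (\<lambda>x. l x * f x)"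
  proof -
    define m where "m = integral {0..2*pi} f / (2*pi)"
    have "integral {0..2*pi} (\<lambda>x. l x * ?g x) = integral {0..2*pi} (\<lambda>x. l x * f x - l x * m)"
      by (simp add: zero_mean_proj_eq[OF f] m_def algebra_simps)
    also have "\<dots> = integral {0..2*pi} (\<lambda>x. l x * f x) - integral {0..2*pi} (\<lambda>x. l x * m)"
    proof (rule Henstock_Kurzweil_Integration.integral_diff)
      show "(\<lambda>x. l x * f x) integrable_on {0..2*pi}"
        using lf by (simp add: absolutely_integrable_on_def)
      show "(\<lambda>x. l x * m) integrable_on {0..2*pi}"
        using lcont by (intro integrable_continuous_real continuous_intros)
    qed
    also have "integral {0..2*pi} (\<lambda>x. l x * m) = 0" by (simp add: l0)
    finally show ?thesis by simp
  qed
  finally have IV: "integral {0..2*pi} ?V = - integral {0..2*pi} (\<lambda>x. l x * f x)" .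
  have N: "negligible {0, 2*pi}" by simp
  have e: "of_real (deriv eta_star t) * f t = 1 / 4 * (l t * f t)" if "t \<in> {0..2*pi} - {0, 2*pi}" for t
    using that by (subst deriv_eta_star) (auto simp: l_def field_simps)
  have lf4: "(\<lambda>x. 1 / 4 * (l x * f x)) absolutely_integrable_on {0..2*pi}"
    using lf by (rule set_integrable_mult_right)
  have "(\<lambda>t. of_real (deriv eta_star t) * f t) absolutely_integrable_on {0..2*pi}"
    by (rule absolutely_integrable_spike[OF lf4 N e])
  then have "(LINT t|circle_measure. of_real (deriv eta_star t) * f t)
      = integral {0..2*pi} (\<lambda>t. of_real (deriv eta_star t) * f t)"
    by (intro lebesgue_integral_eq_integral) (simp_all add: absolutely_integrable_iff_lebesgue_on)
  also have "\<dots> = integral {0..2*pi} (\<lambda>x. 1 / 4 * (l x * f x))"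
    by (rule integral_spike[OF N]) (rule e[symmetric])
  also have "\<dots> = - 1 / 4 * integral {0..2*pi} ?V" by (simp add: IV)
  finally have A: "(LINT t|circle_measure. of_real (deriv eta_star t) * f t) = - 1 / 4 * integral {0..2*pi} ?V" .
  have "zero_mean_primitive f x = ?V x - integral {0..2*pi} ?V / (2*pi)"
    unfolding zero_mean_primitive_def pinned_primitive_def[symmetric] zero_mean_proj_def
    using V by (subst lebesgue_integral_eq_integral) (auto simp: absolutely_integrable_iff_lebesgue_on)
  then show ?thesis unfolding A by (simp add: field_simps)
qed

lemma pinned_primitive_eq:
  assumes f: "square_integrable f" and x: "0 \<le> x" "x \<le> 2*pi"
  shows "pinned_primitive f x = integral {0..x} f - of_real x * (integral {0..2*pi} f / (2*pi))"
proof -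
  have fi: "f integrable_on {0..x}"
    using f x by (intro square_integrable_integrable_on) auto
  have "pinned_primitive f x = integral {0..x} (zero_mean_proj f)"
    using primitive_on_integral[OF pinned_primitive_primitive(1)[OF f], of 0 x] x by (simp add: pinned_primitive_primitive(2)[OF f])
  also have "\<dots> = integral {0..x} f - of_real x * (integral {0..2*pi} f / (2*pi))"
    unfolding zero_mean_proj_eq[OF f] using fi x
    by (subst Henstock_Kurzweil_Integration.integral_diff)
       (auto simp: integrable_const_ivl scaleR_conv_of_real)
  finally show ?thesis .
qed

lemma pinned_primitive_spike:
  assumes "square_integrable f" "negligible N" "\<And>x. x \<in> {0<..<2*pi} - N \<Longrightarrow> g x = f x"
    and x: "0 \<le> x" "x \<le> 2*pi"
  shows "pinned_primitive g x = pinned_primitive f x"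
proof -
  have N: "negligible (N \<union> {0, 2*pi})" using assms(2) by simp
  have "integral {0..y} g = integral {0..y} f" if "y \<le> 2*pi" for y
    by (rule integral_spike[OF N]) (use that assms(3) in auto)
  then show ?thesis
    using x assms(1) square_integrable_spike(1)[OF assms(1-3)] by (simp add: pinned_primitive_eq)
qed

lemma has_weak_deriv_spike:
  assumes u: "has_weak_deriv u k" and N: "negligible N" and eq: "\<And>x. x \<in> {0<..<2*pi} - N \<Longrightarrow> v x = u x"
  shows "has_weak_deriv v k"
  unfolding has_weak_deriv_def
proof (intro conjI allI impI)
  have lu: "locally_integrable u" using u by (simp add: has_weak_deriv_def)
  show lv: "locally_integrable v"
    unfolding locally_integrable_iff
  proof (intro allI impI)
    fix a b :: real assume ab: "0 < a \<and> b < 2*pi"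
    then have "u absolutely_integrable_on {a..b}" using lu by (simp add: locally_integrable_iff)
    then show "v absolutely_integrable_on {a..b}"
      by (rule absolutely_integrable_spike[OF _ N]) (use eq ab in auto)
  qed
  show "locally_integrable k" using u by (simp add: has_weak_deriv_def)
  fix \<phi> assume \<phi>: "test_function \<phi>"
  then obtain a b where ab: "0 < a" "b < 2*pi"
    and d: "\<And>x. x \<notin> {a..b} \<Longrightarrow> deriv \<phi> x = 0" and cont: "continuous_on UNIV (deriv \<phi>)"
    by (rule test_functionE) blast
  have "(LINT x|lebesgue_on {0<..<2*pi}. v x * of_real (deriv \<phi> x))
      = integral {a..b} (\<lambda>x. v x * of_real (deriv \<phi> x))"
    by (rule test_integral(3)[OF lv cont ab d])
  also have "\<dots> = integral {a..b} (\<lambda>x. u x * of_real (deriv \<phi> x))"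
    by (rule integral_spike[OF N]) (use eq ab in auto)
  also have "\<dots> = (LINT x|lebesgue_on {0<..<2*pi}. u x * of_real (deriv \<phi> x))"
    by (rule test_integral(3)[OF lu cont ab d, symmetric])
  also have "\<dots> = - (LINT x|lebesgue_on {0<..<2*pi}. k x * of_real (\<phi> x))"
    using u \<phi> by (simp add: has_weak_deriv_def)
  finally show "(LINT x|lebesgue_on {0<..<2*pi}. v x * of_real (deriv \<phi> x))
      = - (LINT x|lebesgue_on {0<..<2*pi}. k x * of_real (\<phi> x))" .
qed

text \<open>
  The operator on an arbitrary representative with an arbitrary weak derivative: the choices made by
  the class representative and by \<open>weak_deriv\<close> change the result only on a null set.
\<close>

lemma op_A_eq:
  assumes u: "square_integrable u" and k: "has_weak_deriv u k"
    and wk: "square_integrable (\<lambda>x. of_real (wt x) * k x)"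
  shows "abs_l2 u \<in> dom_A"
    and "op_A (abs_l2 u) = abs_l2 (\<lambda>x. of_real (wt x) * k x + 1 / 2 * pinned_primitive u x)"
proof -
  let ?r = "rep_l2 (abs_l2 u)"
  obtain N where N: "negligible N" "\<And>x. x \<in> {0<..<2*pi} - N \<Longrightarrow> ?r x = u x"
    by (rule rep_abs_l2[OF u]) blast
  have r: "square_integrable ?r" by (rule square_integrable_rep)
  have rk: "has_weak_deriv ?r k" by (rule has_weak_deriv_spike[OF k N])
  then have "has_weak_deriv ?r (weak_deriv ?r)"
    using someI[of "has_weak_deriv ?r" k] by (simp add: weak_deriv_def)
  from has_weak_deriv_unique[OF this rk] obtain M where M: "negligible M" "\<And>x. x \<in> {0<..<2*pi} - M \<Longrightarrow> weak_deriv ?r x = k x"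
    by metis
  have wd: "weighted_deriv ?r x = of_real (wt x) * k x" if "x \<in> {0<..<2*pi} - M" for x
    using that M(2)[OF that] by (subst weighted_deriv_eq) auto
  have "square_integrable (weighted_deriv ?r)"
    by (rule square_integrable_spike(1)[OF wk M(1) wd])
  with rk show "abs_l2 u \<in> dom_A" by (auto simp: dom_A_def)
  have "square_integrable (\<lambda>x. of_real (wt x) * k x + 1 / 2 * pinned_primitive u x)"
    by (intro square_integrable_add wk square_integrable_mult_left square_integrable_pinned_primitive u)
  then show "op_A (abs_l2 u) = abs_l2 (\<lambda>x. of_real (wt x) * k x + 1 / 2 * pinned_primitive u x)"
    unfolding op_A_def
  proof (rule abs_l2_eqI[OF _ M(1)])
    fix x assume x: "x \<in> {0<..<2*pi} - M"
    have "pinned_primitive ?r x = pinned_primitive u x"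
      using x by (intro pinned_primitive_spike[OF u N]) auto
    then show "weighted_deriv ?r x - 1 / pi * (LINT t|circle_measure. of_real (deriv eta_star t) * ?r t)
        + 1 / 2 * zero_mean_primitive ?r x = of_real (wt x) * k x + 1 / 2 * pinned_primitive u x"
      using nonlocal_part_eq[OF r, of x] wd[OF x] by (simp add: algebra_simps)
  qed
qed

text \<open>
  Every class in the domain contains a function that is absolutely continuous off the peak.
\<close>

lemma dom_A_E:
  assumes "f \<in> dom_A"
  obtains u k where "interior_primitive u k" "square_integrable u"
    "square_integrable (\<lambda>x. of_real (wt x) * k x)" "f = abs_l2 u"
proof -
  let ?r = "rep_l2 f"
  define k where "k = weak_deriv ?r"
  have sw: "square_integrable (weighted_deriv ?r)" and ex: "\<exists>g. has_weak_deriv ?r g"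
    using assms by (auto simp: dom_A_def)
  have "has_weak_deriv ?r k"
    using someI_ex[OF ex] by (simp add: k_def weak_deriv_def)
  from has_weak_deriv_imp_interior_primitive[OF this] obtain u N where u: "interior_primitive u k" and N: "negligible N"
    "\<And>x. x \<in> {0<..<2*pi} - N \<Longrightarrow> ?r x = u x"
    by metis
  have N': "u x = ?r x" if "x \<in> {0<..<2*pi} - N" for x using N(2)[OF that] by simp
  show thesis
  proof (rule that[OF u])
    show "square_integrable u"
      by (rule square_integrable_spike(1)[OF square_integrable_rep N(1) N'])
    show "square_integrable (\<lambda>x. of_real (wt x) * k x)"
      by (rule square_integrable_spike(1)[OF sw negligible_empty])
         (simp add: weighted_deriv_eq k_def)
    have "abs_l2 u = abs_l2 ?r"
      by (rule abs_l2_eqI[OF square_integrable_rep N(1) N'])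
    then show "f = abs_l2 u" by (simp add: abs_rep_l2)
  qed
qed

lemma pinned_primitive_lincomb:
  assumes u: "square_integrable u" and v: "square_integrable v" and x: "x \<in> {0..2*pi}"
  shows "pinned_primitive (\<lambda>x. u x + c * v x) x = pinned_primitive u x + c * pinned_primitive v x"
proof -
  have s: "square_integrable (\<lambda>x. u x + c * v x)"
    by (intro square_integrable_add square_integrable_mult_left u v)
  have int: "integral {0..y} (\<lambda>x. u x + c * v x) = integral {0..y} u + c * integral {0..y} v"
    if "0 \<le> y" "y \<le> 2*pi" for y
  proof -
    have "integral {0..y} (\<lambda>x. u x + c * v x) = integral {0..y} u + integral {0..y} (\<lambda>x. c * v x)"
      using u v that
      by (intro Henstock_Kurzweil_Integration.integral_add integrable_on_mult_right
          square_integrable_integrable_on) auto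
    then show ?thesis by simp
  qed
  show ?thesis
    using x by (simp add: pinned_primitive_eq[OF s] pinned_primitive_eq[OF u] pinned_primitive_eq[OF v] int)
       (simp add: field_simps)
qed

lemma pinned_primitive_add_const:
  assumes f: "square_integrable f" and x: "x \<in> {0..2*pi}"
  shows "pinned_primitive (\<lambda>x. f x + c) x = pinned_primitive f x"
  using pinned_primitive_lincomb[OF f square_integrable_const[of 1] x, of c] x
  by (simp add: pinned_primitive_eq[OF square_integrable_const] scaleR_conv_of_real)

lemma op_A_lincomb:
  assumes f: "f \<in> dom_A" and g: "g \<in> dom_A"
  shows "f + scaleC c g \<in> dom_A" and "op_A (f + scaleC c g) = op_A f + scaleC c (op_A g)"
proof -
  obtain u k where u: "interior_primitive u k" "square_integrable u"
    "square_integrable (\<lambda>x. of_real (wt x) * k x)" and fu: "f = abs_l2 u"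
    using dom_A_E[OF f] .
  obtain v l where v: "interior_primitive v l" "square_integrable v"
    "square_integrable (\<lambda>x. of_real (wt x) * l x)" and gv: "g = abs_l2 v"
    using dom_A_E[OF g] .
  let ?w = "\<lambda>x. u x + c * v x" and ?n = "\<lambda>x. k x + c * l x"
  have "interior_primitive (\<lambda>x. c * v x) (\<lambda>x. c * l x)"
    using interior_primitive_linear[OF v(1) bounded_linear_mult_right[of c]] by simp
  then have wn: "has_weak_deriv ?w ?n"
    by (intro interior_primitive_has_weak_deriv interior_primitive_add[OF u(1)])
  have w: "square_integrable ?w"
    by (intro square_integrable_add square_integrable_mult_left u v)
  have "square_integrable (\<lambda>x. of_real (wt x) * k x + c * (of_real (wt x) * l x))"
    by (intro square_integrable_add square_integrable_mult_left u v)
  then have sn: "square_integrable (\<lambda>x. of_real (wt x) * ?n x)"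
    by (rule square_integrable_spike(1)[OF _ negligible_empty]) (simp add: algebra_simps)
  have sum: "f + scaleC c g = abs_l2 ?w"
    by (simp add: fu gv abs_l2_scaleC[OF v(2)] abs_l2_add u(2) v(2) square_integrable_mult_left)
  show "f + scaleC c g \<in> dom_A"
    unfolding sum by (rule op_A_eq(1)[OF w wn sn])
  let ?a = "\<lambda>x. of_real (wt x) * k x + 1 / 2 * pinned_primitive u x"
  let ?b = "\<lambda>x. of_real (wt x) * l x + 1 / 2 * pinned_primitive v x"
  have a: "square_integrable ?a"
    by (intro square_integrable_add square_integrable_mult_left u square_integrable_pinned_primitive)
  have b: "square_integrable ?b"
    by (intro square_integrable_add square_integrable_mult_left v square_integrable_pinned_primitive)
  have "op_A (f + scaleC c g) = abs_l2 (\<lambda>x. of_real (wt x) * ?n x + 1 / 2 * pinned_primitive ?w x)"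
    unfolding sum by (rule op_A_eq(2)[OF w wn sn])
  also have "\<dots> = abs_l2 (\<lambda>x. ?a x + c * ?b x)"
  proof (rule abs_l2_eqI[OF _ negligible_empty])
    show "square_integrable (\<lambda>x. ?a x + c * ?b x)"
      by (intro square_integrable_add[OF a] square_integrable_mult_left b)
    fix x :: real assume x: "x \<in> {0<..<2*pi} - {}"
    then show "of_real (wt x) * ?n x + 1 / 2 * pinned_primitive ?w x = ?a x + c * ?b x"
      by (subst pinned_primitive_lincomb[OF u(2) v(2)]) (auto simp: algebra_simps)
  qed
  also have "\<dots> = abs_l2 ?a + scaleC c (abs_l2 ?b)"
    by (subst abs_l2_scaleC[OF b], subst abs_l2_add[OF a square_integrable_mult_left[OF b]]) simp
  also have "\<dots> = op_A f + scaleC c (op_A g)"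
    unfolding fu gv using u v
    by (subst (1 2) op_A_eq(2)) (auto intro: interior_primitive_has_weak_deriv)
  finally show "op_A (f + scaleC c g) = op_A f + scaleC c (op_A g)" .
qed

lemma shifted_op_A_lincomb:
  assumes "f \<in> dom_A" "g \<in> dom_A"
  shows "op_A (f + scaleC c g) - scaleC z (f + scaleC c g)
    = (op_A f - scaleC z f) + scaleC c (op_A g - scaleC z g)"
proof -
  have "scaleC c (op_A g - scaleC z g) = scaleC c (op_A g) - scaleC z (scaleC c g)"
    using scaleC_add_right[of c "op_A g - scaleC z g" "scaleC z g"]
    by (simp add: scaleC_scaleC mult.commute)
  then show ?thesis
    by (simp add: op_A_lincomb[OF assms] scaleC_add_right)
qed

section \<open>The integrating factor\<close>

text \<open>
  The derivative \<open>w'\<close> of the weight.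
\<close>

definition dwt :: "real \<Rightarrow> real" where
  "dwt x = (pi - x) / 2"

lemma wt_has_derivative: "(wt has_real_derivative dwt x) (at x)"
  unfolding wt_def dwt_def by (auto intro!: derivative_eq_intros simp: field_simps)

lemma wt_has_vector_derivative:
  "((\<lambda>x. complex_of_real (wt x)) has_vector_derivative of_real (dwt x)) (at x)"
  using wt_has_derivative
  by (intro has_vector_derivative_of_real) (simp flip: has_real_derivative_iff_has_vector_derivative)

lemma dwt_has_vector_derivative:
  "((\<lambda>x. complex_of_real (dwt x)) has_vector_derivative - 1 / 2) (at x)"
proof -
  have "((\<lambda>x. complex_of_real (dwt x)) has_vector_derivative of_real (- 1 / 2)) (at x)"
    unfolding dwt_def
    by (intro has_vector_derivative_of_real)
       (auto intro!: derivative_eq_intros simp flip: has_real_derivative_iff_has_vector_derivative)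
  then show ?thesis by simp
qed

lemma abs_dwt_le: "x \<in> {0..2*pi} \<Longrightarrow> \<bar>dwt x\<bar> \<le> pi / 2"
  by (auto simp: dwt_def abs_le_iff)

lemma continuous_on_wt [continuous_intros]: "continuous_on S wt"
  unfolding wt_def by (intro continuous_intros) auto

lemma continuous_on_dwt [continuous_intros]: "continuous_on S dwt"
  unfolding dwt_def by (intro continuous_intros) auto

lemma interior_primitive_wt:
  "interior_primitive (\<lambda>x. of_real (wt x)) (\<lambda>x. of_real (dwt x))"
  by (intro interior_primitive_C1 wt_has_vector_derivative continuous_intros)

lemma interior_primitive_dwt:
  "interior_primitive (\<lambda>x. of_real (dwt x) + z) (\<lambda>_. - 1 / 2)"
proof (rule interior_primitive_C1)
  show "((\<lambda>x. complex_of_real (dwt x) + z) has_vector_derivative - 1 / 2) (at x)" for x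
    using has_vector_derivative_add[OF dwt_has_vector_derivative has_vector_derivative_const] by simp
qed auto

text \<open>
  Up to the factor \<open>2/\<pi>\<close> this is the coordinate that turns \<open>w d/dx\<close> into \<open>d/dt\<close>; it sends the two
  sides of the peak to minus and plus infinity.
\<close>

definition logit :: "real \<Rightarrow> real" where
  "logit x = ln x - ln (2*pi - x)"

lemma logit_has_derivative:
  assumes "x \<in> {0<..<2*pi}"
  shows "(logit has_real_derivative pi / (2 * wt x)) (at x)"
proof -
  have "(logit has_real_derivative 1 / x + 1 / (2*pi - x)) (at x)"
    unfolding logit_def using assms by (auto intro!: derivative_eq_intros simp: divide_inverse)
  also have "1 / x + 1 / (2*pi - x) = pi / (2 * wt x)"
    using assms by (simp add: wt_def field_simps)
  finally show ?thesis .
qed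

text \<open>
  This is \<open>(x / (2\<pi> - x)) powr (2 z / \<pi>)\<close>, the solution of \<open>w \<rho>' = z \<rho>\<close> with \<open>\<rho>(\<pi>) = 1\<close>.
\<close>

definition rho :: "complex \<Rightarrow> real \<Rightarrow> complex" where
  "rho z x = exp (of_real (2 / pi * logit x) * z)"

lemma rho_nonzero: "rho z x \<noteq> 0"
  by (simp add: rho_def)

lemma norm_rho: "norm (rho z x) = exp (2 * Re z / pi * logit x)"
  by (simp add: rho_def)

lemma rho_has_derivative:
  assumes x: "x \<in> {0<..<2*pi}"
  shows "(rho z has_vector_derivative z * rho z x / of_real (wt x)) (at x)"
proof -
  have "((\<lambda>x. 2 / pi * logit x) has_real_derivative 1 / wt x) (at x)"
    using x wt_pos[OF x] by (auto intro!: derivative_eq_intros logit_has_derivative)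
  then have "((\<lambda>x. complex_of_real (2 / pi * logit x)) has_vector_derivative of_real (1 / wt x)) (at x)"
    by (intro has_vector_derivative_of_real) (simp flip: has_real_derivative_iff_has_vector_derivative)
  then have l: "((\<lambda>x. complex_of_real (2 / pi * logit x) * z) has_vector_derivative of_real (1 / wt x) * z) (at x)"
    by (rule has_vector_derivative_mult_left)
  have "((exp \<circ> (\<lambda>x. complex_of_real (2 / pi * logit x) * z)) has_vector_derivative
      (of_real (1 / wt x) * z) * exp (complex_of_real (2 / pi * logit x) * z)) (at x)"
    by (rule field_vector_diff_chain_at[OF l]) (rule DERIV_exp)
  then show ?thesis
    by (simp add: rho_def[abs_def] o_def divide_inverse mult_ac)
qed

lemma continuous_on_rho: "continuous_on {0<..<2*pi} (rho z)"
  by (intro continuous_at_imp_continuous_on ballI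
      has_vector_derivative_continuous[OF rho_has_derivative])

section \<open>The resolvent equation outside the strip\<close>

text \<open>
  Variation of constants gives \<open>F = - \<rho> w \<integral> G / (w\<^sup>2 \<rho>)\<close>, integrated from \<open>x\<close> to the end \<open>2\<pi>\<close> at
  which \<open>\<bar>\<rho>\<bar>\<close> is large. The integrand is at most \<open>K \<Phi> / w\<close> with \<open>\<Phi> = 1 / (\<bar>\<rho>\<bar> sqrt w)\<close>, and
  \<open>- \<Phi>' = (Re z + w'/2) \<Phi> / w\<close>, where \<open>Re z + w'/2 \<ge> Re z - \<pi>/4 > 0\<close>. So it is bounded by a
  multiple of \<open>- \<Phi>'\<close>, which integrates to exactly the claimed bound.
\<close>

lemma first_order_solution_pos:
  assumes z: "Re z > pi / 4" and G: "continuous_on {0<..<2*pi} G"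
    and K: "\<And>x. x \<in> {0<..<2*pi} \<Longrightarrow> norm (G x) \<le> K * sqrt (wt x)"
  obtains F where
    "\<And>x. x \<in> {0<..<2*pi} \<Longrightarrow>
      (F has_vector_derivative (G x + (of_real (dwt x) + z) * F x) / of_real (wt x)) (at x)"
    "\<And>x. x \<in> {0<..<2*pi} \<Longrightarrow> norm (F x) \<le> K / (Re z - pi / 4) * sqrt (wt x)"
proof -
  define c where "c = Re z - pi / 4"
  have c: "c > 0" using z by (simp add: c_def)
  define s where "s = 2 * Re z / pi"
  define h where "h x = G x / (of_real (wt x)^2 * rho z x)" for x
  define \<Phi> where "\<Phi> x = exp (- s * logit x) / sqrt (wt x)" for x
  define \<Phi>' where "\<Phi>' x = - (Re z + dwt x / 2) / wt x * \<Phi> x" for x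
  have K0: "K \<ge> 0"
  proof -
    have "0 \<le> K * sqrt (wt pi)" using order_trans[OF norm_ge_zero K[of pi]] by simp
    moreover have "wt pi > 0" by (intro wt_pos) auto
    ultimately show ?thesis by (simp add: zero_le_mult_iff)
  qed
  have \<Phi>_deriv: "(\<Phi> has_real_derivative \<Phi>' x) (at x)" if x: "x \<in> {0<..<2*pi}" for x
  proof -
    have w: "wt x > 0" using x by (rule wt_pos)
    have "((\<lambda>x. exp (- s * logit x)) has_real_derivative exp (- s * logit x) * (- s * (pi / (2 * wt x)))) (at x)"
      using x by (auto intro!: derivative_eq_intros logit_has_derivative)
    moreover have "((\<lambda>x. sqrt (wt x)) has_real_derivative dwt x / (2 * sqrt (wt x))) (at x)"
      using w by (auto intro!: derivative_eq_intros wt_has_derivative simp: field_simps)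
    ultimately have "(\<Phi> has_real_derivative
        (exp (- s * logit x) * (- s * (pi / (2 * wt x))) * sqrt (wt x) - exp (- s * logit x) * (dwt x / (2 * sqrt (wt x))))
          / (sqrt (wt x) * sqrt (wt x))) (at x)"
      unfolding \<Phi>_def using w by (intro DERIV_divide) auto
    also have "(exp (- s * logit x) * (- s * (pi / (2 * wt x))) * sqrt (wt x) - exp (- s * logit x) * (dwt x / (2 * sqrt (wt x))))
          / (sqrt (wt x) * sqrt (wt x)) = \<Phi>' x"
    proof -
      define q where "q = sqrt (wt x)"
      have q: "q > 0" "wt x = q * q" using w by (auto simp: q_def)
      show ?thesis
        unfolding \<Phi>'_def \<Phi>_def q_def[symmetric] q(2) s_def using q(1) by (simp add: field_simps)
    qed
    finally show ?thesis .
  qed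
  have \<Phi>_pos: "\<Phi> x > 0" if "x \<in> {0<..<2*pi}" for x
    using wt_pos[OF that] by (simp add: \<Phi>_def)
  have h_bound: "norm (h x) \<le> - (K / c * \<Phi>' x)" if x: "x \<in> {0<..<2*pi}" for x
  proof -
    have w: "wt x > 0" using x by (rule wt_pos)
    have "norm (h x) = norm (G x) * exp (- s * logit x) / (wt x)^2"
    proof -
      have "norm (h x) = norm (G x) / ((wt x)^2 * exp (s * logit x))"
        using w by (simp add: h_def norm_divide norm_mult norm_power norm_rho s_def)
      then show ?thesis by (simp add: exp_minus field_simps)
    qed
    also have "\<dots> \<le> K * sqrt (wt x) * exp (- s * logit x) / (wt x)^2"
      using K[OF x] by (intro divide_right_mono mult_right_mono) auto
    also have "\<dots> = K * \<Phi> x / wt x"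
    proof -
      define q where "q = sqrt (wt x)"
      have q: "q > 0" "wt x = q * q" using w by (auto simp: q_def)
      show ?thesis unfolding \<Phi>_def q_def[symmetric] q(2) using q(1) by (simp add: field_simps power2_eq_square)
    qed
    also have "\<dots> \<le> K * \<Phi> x / wt x * ((Re z + dwt x / 2) / c)"
    proof -
      have "- (pi / 2) \<le> dwt x" using abs_dwt_le[of x] x by (auto simp: abs_le_iff)
      then have "1 \<le> (Re z + dwt x / 2) / c" using c by (simp add: c_def field_simps)
      moreover have "0 \<le> K * \<Phi> x / wt x" using K0 \<Phi>_pos[OF x] w by simp
      ultimately show ?thesis using mult_left_mono by fastforce
    qed
    also have "\<dots> = - (K / c * \<Phi>' x)"
      unfolding \<Phi>'_def using w c by (simp add: field_simps)
    finally show ?thesis .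
  qed
  have rho_cont: "isCont (rho z) x" if "x \<in> {0<..<2*pi}" for x
    using has_vector_derivative_continuous[OF rho_has_derivative[OF that]] .
  have "isCont h x" if x: "x \<in> {0<..<2*pi}" for x
  proof -
    have "isCont G x" using G x by (auto simp: continuous_on_eq_continuous_at)
    moreover have "isCont wt x"
      using DERIV_isCont[OF wt_has_derivative] .
    ultimately show ?thesis
      unfolding h_def using rho_cont[OF x] wt_pos[OF x]
      by (intro continuous_intros) (auto simp: rho_nonzero)
  qed
  then obtain Y where Y: "\<And>x. x \<in> {0<..<2*pi} \<Longrightarrow> (Y has_vector_derivative h x) (at x)"
    using einterval_antiderivative[of 0 "ereal (2*pi)" h] by (auto simp: zero_ereal_def)
  have Y_incr: "norm (Y y - Y x) \<le> K / c * \<Phi> x - K / c * \<Phi> y" if xy: "0 < x" "x < y" "y < 2*pi" for x y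
  proof -
    have "norm (Y y - Y x) \<le> - (K / c * \<Phi> y) - - (K / c * \<Phi> x)"
    proof (rule differentiable_bound_general[OF xy(2)])
      show "continuous_on {x..y} Y"
        using xy by (intro continuous_at_imp_continuous_on ballI has_vector_derivative_continuous[OF Y]) auto
      have *: "((\<lambda>x. - (K / c * \<Phi> x)) has_real_derivative - (K / c * \<Phi>' t)) (at t)" if "t \<in> {x..y}" for t
        using that xy \<Phi>_deriv by (intro derivative_intros DERIV_cmult) auto
      then show "continuous_on {x..y} (\<lambda>x. - (K / c * \<Phi> x))"
        by (intro continuous_at_imp_continuous_on ballI) (rule DERIV_isCont)
      fix t assume t: "x < t" "t < y"
      show "(Y has_vector_derivative h t) (at t)" using t xy by (intro Y) auto
      show "((\<lambda>x. - (K / c * \<Phi> x)) has_vector_derivative - (K / c * \<Phi>' t)) (at t)"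
        using *[of t] t by (simp add: has_real_derivative_iff_has_vector_derivative)
      show "norm (h t) \<le> - (K / c * \<Phi>' t)" using t xy by (intro h_bound) auto
    qed
    then show ?thesis by simp
  qed
  \<comment> \<open>The improper integral from x to 2 pi is realised as l - Y x, where l is a limit point of Y at
      2 pi; the bound in terms of \<open>\<Phi>\<close> supplies the compactness.\<close>
  define y where "y n = 2*pi - 1 / real (Suc n)" for n
  have y: "pi < y n" "y n < 2*pi" for n
  proof -
    have "1 / real (Suc n) \<le> 1" "0 < 1 / real (Suc n)" by auto
    then show "pi < y n" "y n < 2*pi" unfolding y_def using pi_gt3 by linarith+
  qed
  have y_lim: "y \<longlonglongrightarrow> 2*pi"
    unfolding y_def by (rule tendsto_eq_intros LIMSEQ_Suc[OF lim_const_over_n] refl)+ simp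
  have near: "norm (Y (y n) - Y x) \<le> K / c * \<Phi> x" if "x \<in> {0<..<2*pi}" "x < y n" for x n
    using Y_incr[of x "y n"] that y[of n] \<Phi>_pos[of "y n"] K0 c
    by (smt (verit) divide_nonneg_pos greaterThanLessThan_iff mult_nonneg_nonneg)
  have "bounded (range (\<lambda>n. Y (y n)))"
  proof (rule boundedI)
    fix v assume "v \<in> range (\<lambda>n. Y (y n))"
    then obtain n where "v = Y (y n)" by auto
    then show "norm v \<le> norm (Y pi) + K / c * \<Phi> pi"
      using near[of pi n] y[of n] norm_triangle_sub[of v "Y pi"] by auto
  qed
  then obtain l r where r: "strict_mono (r :: nat \<Rightarrow> nat)" and l: "((\<lambda>n. Y (y n)) \<circ> r) \<longlonglongrightarrow> l"
    using bounded_imp_convergent_subsequence by blast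
  have lY: "norm (l - Y x) \<le> K / c * \<Phi> x" if x: "x \<in> {0<..<2*pi}" for x
  proof -
    have "(\<lambda>n. norm (((\<lambda>n. Y (y n)) \<circ> r) n - Y x)) \<longlonglongrightarrow> norm (l - Y x)"
      by (intro tendsto_intros l)
    moreover have "(y \<circ> r) \<longlonglongrightarrow> 2*pi"
      using y_lim r by (rule LIMSEQ_subseq_LIMSEQ)
    from order_tendstoD(1)[OF this, of x] x have "eventually (\<lambda>n. x < (y \<circ> r) n) sequentially"
      by simp
    then have "eventually (\<lambda>n. norm (((\<lambda>n. Y (y n)) \<circ> r) n - Y x) \<le> K / c * \<Phi> x) sequentially"
      by eventually_elim (use near x in auto)
    ultimately show ?thesis
      by (rule tendsto_upperbound) simp
  qed
  define F where "F x = - (rho z x * of_real (wt x) * (l - Y x))" for x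
  show thesis
  proof (rule that[of F])
    fix x assume x: "x \<in> {0<..<2*pi}"
    have w: "wt x > 0" using x by (rule wt_pos)
    have "(F has_vector_derivative - ((rho z x * of_real (wt x)) * (0 - h x)
        + (rho z x * of_real (dwt x) + z * rho z x / of_real (wt x) * of_real (wt x)) * (l - Y x))) (at x)"
      unfolding F_def
      by (intro has_vector_derivative_minus has_vector_derivative_mult has_vector_derivative_diff
          has_vector_derivative_const rho_has_derivative wt_has_vector_derivative Y x)
    also have "- ((rho z x * of_real (wt x)) * (0 - h x)
        + (rho z x * of_real (dwt x) + z * rho z x / of_real (wt x) * of_real (wt x)) * (l - Y x))
      = (G x + (of_real (dwt x) + z) * F x) / of_real (wt x)"
      using w rho_nonzero[of z x] by (simp add: F_def h_def field_simps power2_eq_square)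
    finally show "(F has_vector_derivative (G x + (of_real (dwt x) + z) * F x) / of_real (wt x)) (at x)" .
    have "norm (F x) \<le> exp (s * logit x) * wt x * (K / c * \<Phi> x)"
    proof -
      have "norm (F x) = exp (s * logit x) * wt x * norm (l - Y x)"
        using w by (simp add: F_def norm_mult norm_rho s_def)
      also have "\<dots> \<le> exp (s * logit x) * wt x * (K / c * \<Phi> x)"
        using lY[OF x] w by (intro mult_left_mono) auto
      finally show ?thesis .
    qed
    also have "\<dots> = K / c * sqrt (wt x)"
    proof -
      define q where "q = sqrt (wt x)"
      have q: "q > 0" "wt x = q * q" using w by (auto simp: q_def)
      show ?thesis unfolding \<Phi>_def q_def[symmetric] q(2) using q(1) by (simp add: exp_minus field_simps)
    qed
    finally show "norm (F x) \<le> K / (Re z - pi / 4) * sqrt (wt x)" by (simp add: c_def)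
  qed
qed

text \<open>
  The reflection \<open>x \<mapsto> 2\<pi> - x\<close> preserves \<open>w\<close> and changes the sign of \<open>w'\<close> and of \<open>d/dx\<close>; it
  exchanges \<open>z\<close> and \<open>- z\<close> and reduces negative real parts to positive ones.
\<close>

lemma first_order_solution:
  assumes z: "\<bar>Re z\<bar> > pi / 4" and G: "continuous_on {0<..<2*pi} G"
    and K: "\<And>x. x \<in> {0<..<2*pi} \<Longrightarrow> norm (G x) \<le> K * sqrt (wt x)"
  obtains F where
    "\<And>x. x \<in> {0<..<2*pi} \<Longrightarrow>
      (F has_vector_derivative (G x + (of_real (dwt x) + z) * F x) / of_real (wt x)) (at x)"
    "\<And>x. x \<in> {0<..<2*pi} \<Longrightarrow> norm (F x) \<le> K / (\<bar>Re z\<bar> - pi / 4) * sqrt (wt x)"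
proof (cases "Re z > 0")
  case True
  with z have "Re z > pi / 4" by simp
  from first_order_solution_pos[OF this G K] that True show thesis by (metis abs_of_pos)
next
  case False
  with z have z': "Re (- z) > pi / 4" by simp
  have refl: "wt (2*pi - x) = wt x" "dwt (2*pi - x) = - dwt x" for x
    by (auto simp: wt_def dwt_def field_simps)
  have G': "continuous_on {0<..<2*pi} (\<lambda>x. - G (2*pi - x))"
    by (intro continuous_intros continuous_on_compose2[OF G]) auto
  have K': "norm (- G (2*pi - x)) \<le> K * sqrt (wt x)" if "x \<in> {0<..<2*pi}" for x
    using K[of "2*pi - x"] that by (simp add: refl)
  obtain F where F: "\<And>x. x \<in> {0<..<2*pi} \<Longrightarrow>
      (F has_vector_derivative (- G (2*pi - x) + (of_real (dwt x) + - z) * F x) / of_real (wt x)) (at x)"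
    "\<And>x. x \<in> {0<..<2*pi} \<Longrightarrow> norm (F x) \<le> K / (Re (- z) - pi / 4) * sqrt (wt x)"
    using first_order_solution_pos[OF z' G' K'] by metis
  show thesis
  proof (rule that[of "\<lambda>x. F (2*pi - x)"])
    fix x assume x: "x \<in> {0<..<2*pi}"
    then have x': "2*pi - x \<in> {0<..<2*pi}" by auto
    have "((\<lambda>x. 2*pi - x) has_vector_derivative - 1) (at x)"
      by (auto intro!: derivative_eq_intros)
    from vector_diff_chain_at[OF this F(1)[OF x']]
    have "((\<lambda>x. F (2*pi - x)) has_vector_derivative
        - ((- G x + - (of_real (dwt x) + z) * F (2*pi - x)) / of_real (wt x))) (at x)"
      by (simp add: o_def refl)
    also have "- ((- G x + - (of_real (dwt x) + z) * F (2*pi - x)) / of_real (wt x))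
        = (G x + (of_real (dwt x) + z) * F (2*pi - x)) / of_real (wt x)"
      by (simp add: minus_divide_left algebra_simps)
    finally show "((\<lambda>x. F (2*pi - x)) has_vector_derivative
        (G x + (of_real (dwt x) + z) * F (2*pi - x)) / of_real (wt x)) (at x)"
.
    show "norm (F (2*pi - x)) \<le> K / (\<bar>Re z\<bar> - pi / 4) * sqrt (wt x)"
      using F(2)[OF x'] False by (simp add: refl)
  qed
qed

text \<open>
  The derivative of \<open>E = w \<bar>f\<bar>\<^sup>2 + \<bar>F\<bar>\<^sup>2 / 2\<close> is \<open>(w' + 2 Re z) \<bar>f\<bar>\<^sup>2 + 2 Re (g cnj f)\<close>: the contributions
  of \<open>F\<close> cancel. As \<open>\<bar>w'\<bar> \<le> \<pi>/2\<close>, the first coefficient has the sign of \<open>Re z\<close> and modulus at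
  least \<open>2 c\<close> with \<open>c = \<bar>Re z\<bar> - \<pi>/4\<close>, and half of it absorbs the term with \<open>g\<close>. The bound \<open>M\<close> for
  \<open>E\<close> replaces vanishing boundary values.
\<close>

lemma energy_estimate:
  assumes z: "\<bar>Re z\<bar> > pi / 4"
    and F: "interior_primitive F f" and f: "interior_primitive f k" and g: "square_integrable g"
    and eq: "\<And>x. x \<in> {0<..<2*pi} \<Longrightarrow> of_real (wt x) * k x = g x + z * f x - 1 / 2 * F x"
    and M: "\<And>x. x \<in> {0<..<2*pi} \<Longrightarrow> wt x * (norm (f x))\<^sup>2 + (norm (F x))\<^sup>2 / 2 \<le> M"
  shows "square_integrable f"
    and "norm_sq f \<le> M / (\<bar>Re z\<bar> - pi / 4) + norm_sq g / (\<bar>Re z\<bar> - pi / 4)\<^sup>2"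
proof -
  define c where "c = \<bar>Re z\<bar> - pi / 4"
  have c: "c > 0" using z by (simp add: c_def)
  define E where "E x = of_real (wt x) * (f x * cnj (f x)) + 1 / 2 * (F x * cnj (F x))" for x
  define E' where "E' x = of_real (dwt x) * (f x * cnj (f x)) + of_real (wt x) * (k x * cnj (f x) + f x * cnj (k x))
      + 1 / 2 * (f x * cnj (F x) + F x * cnj (f x))" for x
  have E: "interior_primitive E E'"
  proof -
    note ff = interior_primitive_mult[OF f interior_primitive_linear[OF f bounded_linear_cnj]]
    note FF = interior_primitive_mult[OF F interior_primitive_linear[OF F bounded_linear_cnj]]
    show ?thesis
      using interior_primitive_add[OF interior_primitive_mult[OF interior_primitive_wt ff]
          interior_primitive_mult[OF interior_primitive_const[of "1 / 2"] FF]]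
      by (simp add: E_def[abs_def] E'_def[abs_def])
  qed
  have ReE: "Re (E x) = wt x * (norm (f x))\<^sup>2 + (norm (F x))\<^sup>2 / 2" for x
    by (simp add: E_def complex_norm_square[symmetric] del: Re_divide_numeral)
  have E_range: "0 \<le> Re (E x)" "Re (E x) \<le> M" if "x \<in> {0<..<2*pi}" for x
    unfolding ReE using M[OF that] wt_pos[OF that] by auto
  have ReE': "Re (E' x) = (dwt x + 2 * Re z) * (norm (f x))\<^sup>2 + 2 * Re (g x * cnj (f x))"
    if x: "x \<in> {0<..<2*pi}" for x
  proof -
    have "E' x = of_real (dwt x) * (f x * cnj (f x)) + ((of_real (wt x) * k x) * cnj (f x) + f x * cnj (of_real (wt x) * k x))
      + 1 / 2 * (f x * cnj (F x) + F x * cnj (f x))"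
      by (simp add: E'_def algebra_simps)
    also have "Re \<dots> = (dwt x + 2 * Re z) * (norm (f x))\<^sup>2 + 2 * Re (g x * cnj (f x))"
      unfolding eq[OF x] cmod_power2 by (simp add: power2_eq_square algebra_simps)
    finally show ?thesis .
  qed
  define \<sigma> where "\<sigma> = sgn (Re z)"
  have \<sigma>: "\<bar>\<sigma>\<bar> = 1" "\<sigma> * Re z = \<bar>Re z\<bar>"
    using z pi_gt_zero by (auto simp: \<sigma>_def sgn_real_def abs_real_def)
  have pointwise: "c * (norm (f x))\<^sup>2 \<le> \<sigma> * Re (E' x) + (norm (g x))\<^sup>2 / c" if x: "x \<in> {0<..<2*pi}" for x
  proof -
    have "\<bar>\<sigma> * dwt x\<bar> \<le> pi / 2" using abs_dwt_le[of x] x \<sigma>(1) by (simp add: abs_mult)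
    then have "2 * c \<le> \<sigma> * dwt x + 2 * \<bar>Re z\<bar>" by (simp add: c_def abs_le_iff)
    then have 1: "2 * c * (norm (f x))\<^sup>2 \<le> (\<sigma> * dwt x + 2 * \<bar>Re z\<bar>) * (norm (f x))\<^sup>2"
      by (rule mult_right_mono) simp
    have "\<bar>\<sigma> * Re (g x * cnj (f x))\<bar> \<le> norm (g x) * norm (f x)"
      using abs_Re_le_cmod[of "g x * cnj (f x)"] \<sigma>(1) by (simp add: abs_mult norm_mult)
    then have 2: "- (2 * norm (g x) * norm (f x)) \<le> 2 * (\<sigma> * Re (g x * cnj (f x)))" by linarith
    have "0 \<le> (c * norm (f x) - norm (g x))\<^sup>2 / c" using c by simp
    also have "\<dots> = c * (norm (f x))\<^sup>2 - 2 * norm (g x) * norm (f x) + (norm (g x))\<^sup>2 / c"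
      using c by (simp add: power2_eq_square field_simps)
    finally have 3: "2 * norm (g x) * norm (f x) \<le> c * (norm (f x))\<^sup>2 + (norm (g x))\<^sup>2 / c" by simp
    have "\<sigma> * Re (E' x) = (\<sigma> * dwt x + 2 * \<bar>Re z\<bar>) * (norm (f x))\<^sup>2 + 2 * (\<sigma> * Re (g x * cnj (f x)))"
      unfolding ReE'[OF x] \<sigma>(2)[symmetric] by (simp add: algebra_simps)
    with 1 2 3 show ?thesis by linarith
  qed
  have bound: "integral {a..b} (\<lambda>x. (norm (f x))\<^sup>2) \<le> M / c + norm_sq g / c\<^sup>2"
    if ab: "0 < a" "a \<le> b" "b < 2*pi" for a b
  proof -
    have pE: "primitive_on a b E E'" using E ab by (simp add: interior_primitive_def)
    have iE: "E' integrable_on {a..b}"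
      using pE by (simp add: primitive_on_def absolutely_integrable_on_def)
    have iE': "(\<lambda>x. \<sigma> * Re (E' x)) integrable_on {a..b}"
      using integrable_linear[OF iE bounded_linear_Re] by (simp add: o_def integrable_on_mult_right)
    have IE: "integral {a..b} (\<lambda>x. \<sigma> * Re (E' x)) = \<sigma> * (Re (E b) - Re (E a))"
      using integral_linear[OF iE bounded_linear_Re] primitive_on_integral[OF pE, of a b] ab
      by (simp add: o_def)
    have g2: "(\<lambda>x. (norm (g x))\<^sup>2) integrable_on {0..2*pi}" using g by (simp add: square_integrable_iff)
    have g2': "(\<lambda>x. (norm (g x))\<^sup>2) integrable_on {a..b}"
      using integrable_subinterval_real[OF g2, of a b] ab by auto
    have cf: "continuous_on {a..b} f"
      using interior_primitive_continuous[OF f] by (rule continuous_on_subset) (use ab in auto)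
    have f2: "(\<lambda>x. (norm (f x))\<^sup>2) integrable_on {a..b}"
      by (intro integrable_continuous_real continuous_intros cf)
    have "c * integral {a..b} (\<lambda>x. (norm (f x))\<^sup>2) = integral {a..b} (\<lambda>x. c * (norm (f x))\<^sup>2)"
      by simp
    also have "\<dots> \<le> integral {a..b} (\<lambda>x. \<sigma> * Re (E' x) + (norm (g x))\<^sup>2 / c)"
    proof (rule integral_le)
      show "(\<lambda>x. c * (norm (f x))\<^sup>2) integrable_on {a..b}" using f2 by (rule integrable_on_mult_right)
      show "(\<lambda>x. \<sigma> * Re (E' x) + (norm (g x))\<^sup>2 / c) integrable_on {a..b}"
        by (intro integrable_add iE' integrable_on_divide g2')
      show "c * (norm (f x))\<^sup>2 \<le> \<sigma> * Re (E' x) + (norm (g x))\<^sup>2 / c" if "x \<in> {a..b}" for x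
        using that ab by (intro pointwise) auto
    qed
    also have "\<dots> = \<sigma> * (Re (E b) - Re (E a)) + integral {a..b} (\<lambda>x. (norm (g x))\<^sup>2) / c"
    proof -
      have "integral {a..b} (\<lambda>x. \<sigma> * Re (E' x) + (norm (g x))\<^sup>2 / c)
          = integral {a..b} (\<lambda>x. \<sigma> * Re (E' x)) + integral {a..b} (\<lambda>x. (norm (g x))\<^sup>2 / c)"
        by (intro Henstock_Kurzweil_Integration.integral_add iE' integrable_on_divide g2')
      then show ?thesis unfolding IE by simp
    qed
    also have "\<dots> \<le> M + norm_sq g / c"
    proof (rule add_mono)
      have "0 \<le> Re (E a)" "Re (E a) \<le> M" "0 \<le> Re (E b)" "Re (E b) \<le> M"
        using ab by (auto intro!: E_range)
      then have "\<bar>Re (E b) - Re (E a)\<bar> \<le> M" by linarith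
      then have "\<bar>\<sigma> * (Re (E b) - Re (E a))\<bar> \<le> M" using \<sigma>(1) by (simp add: abs_mult)
      then show "\<sigma> * (Re (E b) - Re (E a)) \<le> M" by linarith
      have "integral {a..b} (\<lambda>x. (norm (g x))\<^sup>2) \<le> norm_sq g"
        unfolding norm_sq_def using g2 g2' ab by (intro integral_subset_le) auto
      then show "integral {a..b} (\<lambda>x. (norm (g x))\<^sup>2) / c \<le> norm_sq g / c"
        using c by (intro divide_right_mono) auto
    qed
    finally show ?thesis using c by (simp add: field_simps power2_eq_square)
  qed
  from square_integrable_of_interior_bound[OF interior_primitive_continuous[OF f] this]
  show "square_integrable f" "norm_sq f \<le> M / (\<bar>Re z\<bar> - pi / 4) + norm_sq g / (\<bar>Re z\<bar> - pi / 4)\<^sup>2"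
    by (auto simp: c_def)
qed

lemma wt_le: "x \<in> {0..2*pi} \<Longrightarrow> wt x \<le> pi\<^sup>2 / 4"
  using zero_le_power2[of "x - pi"] by (simp add: wt_def power2_eq_square algebra_simps)

text \<open>
  \<open>V u\<close> vanishes at both ends, so the Cauchy-Schwarz inequality bounds \<open>\<bar>V u\<bar>\<^sup>2\<close> by the distance to
  either end; the smaller distance is at most \<open>4 w / \<pi>\<close>.
\<close>

lemma pinned_primitive_bound:
  assumes u: "square_integrable u" and x: "x \<in> {0<..<2*pi}"
  shows "norm (pinned_primitive u x) \<le> sqrt (4 / pi * norm_sq (zero_mean_proj u)) * sqrt (wt x)"
proof -
  let ?g = "zero_mean_proj u" and ?V = "pinned_primitive u"
  define e where "e = norm_sq ?g"
  have g: "square_integrable ?g" using u by (rule square_integrable_zero_mean_proj)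
  note V = pinned_primitive_primitive[OF u]
  have e0: "e \<ge> 0" by (simp add: e_def norm_sq_nonneg)
  have "(norm (?V x))\<^sup>2 \<le> x * e"
    using norm_integral_le_norm_sq[OF g, of 0 x] primitive_on_integral[OF V(1), of 0 x] x
    by (simp add: V(2) e_def)
  moreover have "(norm (?V x))\<^sup>2 \<le> (2*pi - x) * e"
    using norm_integral_le_norm_sq[OF g, of x "2*pi"] primitive_on_integral[OF V(1), of x "2*pi"] x
    by (simp add: V(3) e_def)
  ultimately have "(norm (?V x))\<^sup>2 \<le> min x (2*pi - x) * e"
    by (simp add: min_def)
  also have "\<dots> \<le> (4 / pi * wt x) * e"
  proof (rule mult_right_mono)
    show "min x (2*pi - x) \<le> 4 / pi * wt x"
    proof (cases "x \<le> pi")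
      case True
      then have "x * pi \<le> x * (2*pi - x)" using x by (intro mult_left_mono) auto
      then show ?thesis using True by (simp add: wt_def field_simps)
    next
      case False
      then have "(2*pi - x) * pi \<le> (2*pi - x) * x" using x by (intro mult_left_mono) auto
      then show ?thesis using False by (simp add: wt_def field_simps)
    qed
  qed (rule e0)
  finally have "norm (?V x) \<le> sqrt (4 / pi * e * wt x)"
    by (intro real_le_rsqrt) (simp add: mult_ac)
  then show ?thesis by (simp add: e_def mult_ac flip: real_sqrt_mult)
qed

text \<open>
  The decay of \<open>F\<close> identifies it with the integral of \<open>f\<close> from \<open>0\<close>, and its decay at \<open>2\<pi>\<close> forces \<open>f\<close> to
  have zero mean.
\<close>

lemma pinned_primitive_unique:
  assumes f: "square_integrable f" and F: "interior_primitive F f"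
    and C: "\<And>x. x \<in> {0<..<2*pi} \<Longrightarrow> norm (F x) \<le> C * sqrt (wt x)"
  shows "integral {0..2*pi} f = 0" "\<And>x. x \<in> {0<..<2*pi} \<Longrightarrow> pinned_primitive f x = F x"
proof -
  define H where "H x = integral {0..x} f" for x
  have fi: "f integrable_on {0..2*pi}"
    using f by (simp add: square_integrable_iff absolutely_integrable_on_def)
  have cH: "continuous_on {0..2*pi} H"
    unfolding H_def by (rule indefinite_integral_continuous_1[OF fi])
  define d where "d = H pi - F pi"
  have diff: "H x = F x + d" if x: "x \<in> {0<..<2*pi}" for x
  proof -
    have inc: "H b - H a = F b - F a" if "0 < a" "a \<le> b" "b < 2*pi" for a b
    proof -
      have "integral {0..a} f + integral {a..b} f = integral {0..b} f"
        using that integrable_subinterval_real[OF fi, of 0 b]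
        by (intro Henstock_Kurzweil_Integration.integral_combine) auto
      then have "H b - H a = integral {a..b} f" by (simp add: H_def algebra_simps)
      also have "\<dots> = F b - F a"
        using that by (intro primitive_on_integral[OF interior_primitiveD[OF F, of a b]]) auto
      finally show ?thesis .
    qed
    show ?thesis
      using inc[of x pi] inc[of pi x] x by (cases "x \<le> pi") (auto simp: d_def algebra_simps)
  qed
  have F0: "(F \<longlongrightarrow> 0) (at e within {0<..<2*pi})" if e: "wt e = 0" for e
  proof (rule Lim_null_comparison)
    show "\<forall>\<^sub>F x in at e within {0<..<2*pi}. norm (F x) \<le> C * sqrt (wt x)"
      using C by (auto simp: eventually_at_filter)
    have "((\<lambda>x. C * sqrt (wt x)) \<longlongrightarrow> C * sqrt (wt e)) (at e within {0<..<2*pi})"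
      using DERIV_isCont[OF wt_has_derivative, of e]
      by (intro tendsto_intros) (auto simp: isCont_def intro: tendsto_within_subset)
    then show "((\<lambda>x. C * sqrt (wt x)) \<longlongrightarrow> 0) (at e within {0<..<2*pi})" using e by simp
  qed
  have He: "H e = d" if e: "wt e = 0" "e \<in> {0..2*pi}" for e
  proof -
    have nt: "at e within {0<..<2*pi} \<noteq> bot"
      using e by (auto simp: trivial_limit_within wt_def
          intro: islimpt_greaterThanLessThan1 islimpt_greaterThanLessThan2)
    have "(H \<longlongrightarrow> H e) (at e within {0..2*pi})"
      using cH e(2) by (simp add: continuous_on_def)
    then have "(H \<longlongrightarrow> H e) (at e within {0<..<2*pi})"
      by (rule tendsto_within_subset) auto
    moreover have "(H \<longlongrightarrow> 0 + d) (at e within {0<..<2*pi})"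
    proof (rule Lim_transform_eventually)
      show "((\<lambda>x. F x + d) \<longlongrightarrow> 0 + d) (at e within {0<..<2*pi})"
        by (intro tendsto_intros F0 e)
      show "\<forall>\<^sub>F x in at e within {0<..<2*pi}. F x + d = H x"
        using diff by (auto simp: eventually_at_filter)
    qed
    ultimately show ?thesis using tendsto_unique[OF nt] by fastforce
  qed
  have "H 0 = 0" by (simp add: H_def)
  moreover have "H 0 = d" "H (2*pi) = d" by (rule He; simp add: wt_def)+
  ultimately have d0: "d = 0" "H (2*pi) = 0" by auto
  show I: "integral {0..2*pi} f = 0" using d0 by (simp add: H_def)
  show "pinned_primitive f x = F x" if x: "x \<in> {0<..<2*pi}" for x
    using diff[OF x] x by (subst pinned_primitive_eq[OF f]) (auto simp: I d0 H_def)
qed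

text \<open>
  With \<open>G = V u\<close> and \<open>F\<close> from \<open>first_order_solution\<close>, put \<open>f = F'\<close>. Differentiating
  \<open>w f = G + (w' + z) F\<close> gives \<open>w f' = u - mean u + z f - F / 2\<close>, and \<open>\<bar>F\<bar>, \<bar>G\<bar> = O(sqrt w)\<close> makes
  \<open>w \<bar>f\<bar>\<^sup>2\<close> bounded, as required by the energy estimate.
\<close>

lemma zero_mean_solution:
  assumes z: "\<bar>Re z\<bar> > pi / 4"
  obtains B where "\<And>u. square_integrable u \<Longrightarrow>
    \<exists>f F k. interior_primitive F f \<and> interior_primitive f k \<and> square_integrable f \<and>
      norm_sq f \<le> B * norm_sq (zero_mean_proj u) \<and>
      (\<forall>x\<in>{0<..<2*pi}. pinned_primitive f x = F x \<and>
        of_real (wt x) * k x = zero_mean_proj u x + z * f x - 1 / 2 * F x)"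
proof -
  define c where "c = \<bar>Re z\<bar> - pi / 4"
  have c: "c > 0" using z by (simp add: c_def)
  define m where "m = 1 + (pi / 2 + norm z) / c"
  have m0: "m \<ge> 0" using c by (simp add: m_def)
  define P where "P = (m\<^sup>2 + (1 / c)\<^sup>2 * (pi\<^sup>2 / 4) / 2) * (4 / pi)"
  show thesis
  proof (rule that[of "P / c + 1 / c\<^sup>2"], goal_cases)
    case (1 u)
    let ?g = "zero_mean_proj u" and ?G = "pinned_primitive u"
    define K where "K = sqrt (4 / pi * norm_sq ?g)"
    have K0: "K \<ge> 0" and K2: "K\<^sup>2 = 4 / pi * norm_sq ?g"
      using norm_sq_nonneg[of ?g] by (auto simp: K_def)
    have g: "square_integrable ?g" using 1 by (rule square_integrable_zero_mean_proj)
    have G: "interior_primitive ?G ?g"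
      using pinned_primitive_primitive(1)[OF 1] by (auto simp: interior_primitive_def intro: primitive_on_subinterval)
    have Gb: "norm (?G x) \<le> K * sqrt (wt x)" if "x \<in> {0<..<2*pi}" for x
      using pinned_primitive_bound[OF 1 that] by (simp add: K_def)
    obtain F where F': "\<And>x. x \<in> {0<..<2*pi} \<Longrightarrow>
        (F has_vector_derivative (?G x + (of_real (dwt x) + z) * F x) / of_real (wt x)) (at x)"
      and Fb: "\<And>x. x \<in> {0<..<2*pi} \<Longrightarrow> norm (F x) \<le> K / c * sqrt (wt x)"
      using first_order_solution[OF z interior_primitive_continuous[OF G] Gb] unfolding c_def by metis
    define f where "f x = (?G x + (of_real (dwt x) + z) * F x) / of_real (wt x)" for x
    define k where "k x = (?g x + z * f x - 1 / 2 * F x) / of_real (wt x)" for x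
    have wf: "of_real (wt x) * f x = ?G x + (of_real (dwt x) + z) * F x" if "x \<in> {0<..<2*pi}" for x
      using wt_pos[OF that] by (simp add: f_def)
    have wk: "of_real (wt x) * k x = ?g x + z * f x - 1 / 2 * F x" if "x \<in> {0<..<2*pi}" for x
      using wt_pos[OF that] by (simp add: k_def)
    have cF: "continuous_on {0<..<2*pi} F"
      by (intro continuous_at_imp_continuous_on ballI has_vector_derivative_continuous[OF F'])
    have "continuous_on {0<..<2*pi} f"
      unfolding f_def using wt_pos
      by (intro continuous_intros cF interior_primitive_continuous[OF G]) force
    then have pF: "interior_primitive F f"
      using F' by (intro interior_primitive_C1) (auto simp: f_def)
    have pf: "interior_primitive f k"
    proof -
      have inv: "interior_primitive (\<lambda>x. 1 / of_real (wt x)) (\<lambda>x. - of_real (dwt x) / of_real (wt x) ^ 2)"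
      proof (rule interior_primitive_C1)
        fix x :: real assume x: "x \<in> {0<..<2*pi}"
        have "((\<lambda>x. 1 / wt x) has_real_derivative - dwt x / (wt x)^2) (at x)"
          using wt_pos[OF x] by (auto intro!: derivative_eq_intros wt_has_derivative simp: power2_eq_square)
        then have "((\<lambda>x. complex_of_real (1 / wt x)) has_vector_derivative of_real (- dwt x / (wt x)^2)) (at x)"
          by (intro has_vector_derivative_of_real) (simp flip: has_real_derivative_iff_has_vector_derivative)
        then show "((\<lambda>x. 1 / complex_of_real (wt x)) has_vector_derivative - of_real (dwt x) / of_real (wt x) ^ 2) (at x)"
          by simp
      next
        show "continuous_on {0<..<2*pi} (\<lambda>x. - complex_of_real (dwt x) / of_real (wt x) ^ 2)"
          using wt_pos by (intro continuous_intros) force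
      qed
      have N: "interior_primitive (\<lambda>x. ?G x + (of_real (dwt x) + z) * F x)
          (\<lambda>x. ?g x + (- 1 / 2 * F x + (of_real (dwt x) + z) * f x))"
        by (rule interior_primitive_add[OF G interior_primitive_mult[OF interior_primitive_dwt pF]])
      have "interior_primitive f (\<lambda>x. - of_real (dwt x) / of_real (wt x) ^ 2 * (?G x + (of_real (dwt x) + z) * F x)
          + 1 / of_real (wt x) * (?g x + (- 1 / 2 * F x + (of_real (dwt x) + z) * f x)))"
        using interior_primitive_mult[OF inv N] by (simp add: f_def[abs_def])
      then show ?thesis
      proof (rule interior_primitive_cong)
        fix x :: real assume x: "x \<in> {0<..<2*pi}"
        show "k x = - of_real (dwt x) / of_real (wt x) ^ 2 * (?G x + (of_real (dwt x) + z) * F x)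
          + 1 / of_real (wt x) * (?g x + (- 1 / 2 * F x + (of_real (dwt x) + z) * f x))"
          unfolding wf[OF x, symmetric] k_def using wt_pos[OF x]
          by (simp add: field_simps power2_eq_square)
      qed
    qed
    have M: "wt x * (norm (f x))\<^sup>2 + (norm (F x))\<^sup>2 / 2 \<le> P * norm_sq ?g" if x: "x \<in> {0<..<2*pi}" for x
    proof -
      have w: "wt x > 0" using x by (rule wt_pos)
      have "norm (of_real (dwt x) + z) \<le> pi / 2 + norm z"
        using norm_triangle_ineq[of "of_real (dwt x)" z] abs_dwt_le[of x] x by auto
      then have "norm ((of_real (dwt x) + z) * F x) \<le> (pi / 2 + norm z) * (K / c * sqrt (wt x))"
        unfolding norm_mult using Fb[OF x] by (intro mult_mono) auto
      then have "norm (of_real (wt x) * f x) \<le> K * sqrt (wt x) + (pi / 2 + norm z) * (K / c * sqrt (wt x))"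
        unfolding wf[OF x] using Gb[OF x] norm_triangle_ineq[of "?G x" "(of_real (dwt x) + z) * F x"] by linarith
      also have "\<dots> = K * m * sqrt (wt x)" using c by (simp add: m_def field_simps)
      finally have "wt x * norm (f x) \<le> K * m * sqrt (wt x)" using w by (simp add: norm_mult)
      then have "(wt x * norm (f x))\<^sup>2 \<le> (K * m * sqrt (wt x))\<^sup>2" using w by (intro power_mono) auto
      then have "wt x * (wt x * (norm (f x))\<^sup>2) \<le> wt x * (K\<^sup>2 * m\<^sup>2)"
        using w by (simp add: power_mult_distrib power2_eq_square[of "wt x"] mult_ac)
      then have 1: "wt x * (norm (f x))\<^sup>2 \<le> K\<^sup>2 * m\<^sup>2" using w by simp
      have "(norm (F x))\<^sup>2 \<le> (K / c * sqrt (wt x))\<^sup>2" using Fb[OF x] by (intro power_mono) auto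
      also have "\<dots> = K\<^sup>2 * (1 / c)\<^sup>2 * wt x" using w by (simp add: power_mult_distrib power_divide)
      also have "\<dots> \<le> K\<^sup>2 * (1 / c)\<^sup>2 * (pi\<^sup>2 / 4)"
        using wt_le[of x] x by (intro mult_left_mono) auto
      finally have "(norm (F x))\<^sup>2 / 2 \<le> K\<^sup>2 * ((1 / c)\<^sup>2 * (pi\<^sup>2 / 4) / 2)" by simp
      with 1 have "wt x * (norm (f x))\<^sup>2 + (norm (F x))\<^sup>2 / 2 \<le> K\<^sup>2 * (m\<^sup>2 + (1 / c)\<^sup>2 * (pi\<^sup>2 / 4) / 2)"
        by (simp add: distrib_left)
      also have "\<dots> = P * norm_sq ?g" unfolding K2 P_def by (simp add: mult_ac)
      finally show ?thesis .
    qed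
    note E = energy_estimate[OF z pF pf g wk M]
    have "pinned_primitive f x = F x" if "x \<in> {0<..<2*pi}" for x
      using pinned_primitive_unique(2)[OF E(1) pF Fb that] .
    moreover have "norm_sq f \<le> (P / c + 1 / c\<^sup>2) * norm_sq ?g"
      using E(2) by (simp add: c_def[symmetric] algebra_simps)
    ultimately show ?case using pF pf E(1) wk by blast
  qed
qed

text \<open>
  Constants are annihilated by \<open>A\<close>, so a right-hand side with mean \<open>m\<close> is accounted for by the
  constant \<open>- m / z\<close>.
\<close>

lemma resolvent_exists:
  assumes z: "\<bar>Re z\<bar> > pi / 4"
  obtains B where "\<And>g. \<exists>f\<in>dom_A. op_A f - scaleC z f = g \<and> norm f \<le> B * norm g"
proof -
  obtain B where B: "\<And>u. square_integrable u \<Longrightarrow>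
    \<exists>f F k. interior_primitive F f \<and> interior_primitive f k \<and> square_integrable f \<and>
      norm_sq f \<le> B * norm_sq (zero_mean_proj u) \<and>
      (\<forall>x\<in>{0<..<2*pi}. pinned_primitive f x = F x \<and>
        of_real (wt x) * k x = zero_mean_proj u x + z * f x - 1 / 2 * F x)"
    using zero_mean_solution[OF z] by blast
  have z0: "z \<noteq> 0" using z by auto
  show thesis
  proof (rule that[of "sqrt \<bar>B\<bar> * 2 + 1 / norm z"])
    fix g :: l2
    define u where "u = rep_l2 g"
    have u: "square_integrable u" and gu: "g = abs_l2 u"
      by (auto simp: u_def square_integrable_rep abs_rep_l2)
    define m where "m = integral {0..2*pi} u / (2*pi)"
    have proj: "zero_mean_proj u = (\<lambda>x. u x - m)"
      using zero_mean_proj_eq[OF u] by (auto simp: m_def)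
    obtain f F k where f: "interior_primitive f k" "square_integrable f"
      and Ef: "norm_sq f \<le> B * norm_sq (zero_mean_proj u)"
      and eq: "\<And>x. x \<in> {0<..<2*pi} \<Longrightarrow> pinned_primitive f x = F x"
        "\<And>x. x \<in> {0<..<2*pi} \<Longrightarrow> of_real (wt x) * k x = u x - m + z * f x - 1 / 2 * F x"
      using B[OF u] unfolding proj by blast
    define v where "v x = f x + - (m / z)" for x
    have v: "square_integrable v"
      unfolding v_def by (intro square_integrable_add f square_integrable_const)
    have "interior_primitive v k"
      using interior_primitive_add[OF f(1) interior_primitive_const[of "- (m / z)"]] by (simp add: v_def[abs_def])
    then have vk: "has_weak_deriv v k" by (rule interior_primitive_has_weak_deriv)
    have sF: "square_integrable (pinned_primitive f)"
      by (rule square_integrable_pinned_primitive[OF f(2)])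
    have "square_integrable (\<lambda>x. (u x - m) + z * f x - 1 / 2 * pinned_primitive f x)"
      by (intro square_integrable_diff square_integrable_add square_integrable_mult_left u f sF square_integrable_const)
    then have wk: "square_integrable (\<lambda>x. of_real (wt x) * k x)"
      by (rule square_integrable_spike(1)[OF _ negligible_empty]) (simp add: eq)
    have A: "op_A (abs_l2 v) - scaleC z (abs_l2 v) = g"
    proof -
      have pv: "pinned_primitive v x = F x" if "x \<in> {0<..<2*pi}" for x
        unfolding v_def using that eq(1)[OF that] by (subst pinned_primitive_add_const[OF f(2)]) auto
      have sv: "square_integrable (pinned_primitive v)"
        by (rule square_integrable_spike(1)[OF sF negligible_empty]) (simp add: pv eq)
      have "op_A (abs_l2 v) - scaleC z (abs_l2 v)
          = abs_l2 (\<lambda>x. of_real (wt x) * k x + 1 / 2 * pinned_primitive v x - z * v x)"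
        unfolding op_A_eq(2)[OF v vk wk] abs_l2_scaleC[OF v]
        by (intro abs_l2_diff square_integrable_add square_integrable_mult_left wk v sv)
      also have "\<dots> = abs_l2 u"
      proof (rule abs_l2_eqI[OF u negligible_empty])
        fix x :: real assume "x \<in> {0<..<2*pi} - {}"
        then have x: "x \<in> {0<..<2*pi}" by simp
        show "of_real (wt x) * k x + 1 / 2 * pinned_primitive v x - z * v x = u x"
          unfolding eq(2)[OF x] pv[OF x] v_def using z0 by (simp add: field_simps)
      qed
      finally show ?thesis by (simp add: gu)
    qed
    have nc: "norm (abs_l2 (\<lambda>_. c)) = sqrt (2*pi) * norm c" for c
      by (simp add: norm_abs_l2 square_integrable_const norm_sq_def real_sqrt_mult)
    have nm: "sqrt (2*pi) * norm m \<le> norm g"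
    proof -
      have "(norm (integral {0..2*pi} u))\<^sup>2 \<le> 2*pi * norm_sq u"
        using norm_integral_le_norm_sq[OF u, of 0 "2*pi"] by simp
      then have "norm (integral {0..2*pi} u) \<le> sqrt (2*pi) * sqrt (norm_sq u)"
        by (simp add: real_le_rsqrt flip: real_sqrt_mult)
      moreover have "norm (integral {0..2*pi} u) = sqrt (2*pi) * (sqrt (2*pi) * norm m)"
        by (simp add: m_def norm_divide norm_mult mult.assoc[symmetric])
      ultimately show ?thesis by (simp add: gu norm_abs_l2[OF u])
    qed
    have "norm (abs_l2 (\<lambda>x. u x - m)) \<le> norm g + norm g"
      using norm_triangle_ineq4[of "abs_l2 u" "abs_l2 (\<lambda>_. m)"] nm nc[of m]
      by (simp add: gu abs_l2_diff[OF u square_integrable_const])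
    then have nproj: "sqrt (norm_sq (zero_mean_proj u)) \<le> 2 * norm g"
      unfolding proj by (subst (asm) norm_abs_l2) (auto intro: square_integrable_diff u square_integrable_const)
    have nf: "norm (abs_l2 f) \<le> sqrt \<bar>B\<bar> * 2 * norm g"
    proof -
      have "norm_sq f \<le> \<bar>B\<bar> * norm_sq (zero_mean_proj u)"
        using Ef mult_right_mono[OF abs_ge_self norm_sq_nonneg, of B "zero_mean_proj u"] by linarith
      then have "sqrt (norm_sq f) \<le> sqrt \<bar>B\<bar> * sqrt (norm_sq (zero_mean_proj u))"
        by (simp flip: real_sqrt_mult)
      also have "\<dots> \<le> sqrt \<bar>B\<bar> * (2 * norm g)" using nproj by (intro mult_left_mono) auto
      finally show ?thesis by (simp add: norm_abs_l2[OF f(2)])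
    qed
    have "norm (abs_l2 v) \<le> norm (abs_l2 f) + norm (abs_l2 (\<lambda>_. - (m / z)))"
      using norm_triangle_ineq[of "abs_l2 f" "abs_l2 (\<lambda>_. - (m / z))"]
      by (simp add: abs_l2_add[OF f(2) square_integrable_const] v_def[abs_def])
    also have "norm (abs_l2 (\<lambda>_. - (m / z))) = sqrt (2*pi) * norm m / norm z"
      unfolding nc by (simp add: norm_divide)
    also have "norm (abs_l2 f) + sqrt (2*pi) * norm m / norm z \<le> sqrt \<bar>B\<bar> * 2 * norm g + norm g / norm z"
      using nf nm by (intro add_mono divide_right_mono) auto
    finally have "norm (abs_l2 v) \<le> (sqrt \<bar>B\<bar> * 2 + 1 / norm z) * norm g"
      by (simp add: algebra_simps)
    with A op_A_eq(1)[OF v vk wk]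
    show "\<exists>f\<in>dom_A. op_A f - scaleC z f = g \<and> norm f \<le> (sqrt \<bar>B\<bar> * 2 + 1 / norm z) * norm g"
      by blast
  qed
qed

section \<open>Growth of the homogeneous solution\<close>

text \<open>
  In the coordinate \<open>t = logit x\<close> the weight is \<open>(\<pi> / (2 cosh (t/2)))\<^sup>2\<close> and \<open>\<bar>\<rho>\<bar> = exp (2 Re z t / \<pi>)\<close>, so
  that \<open>\<bar>\<rho>\<bar> sqrt w\<close> is bounded iff \<open>\<bar>2 Re z / \<pi>\<bar> \<le> 1/2\<close>.
\<close>

lemma sqrt_wt_eq:
  assumes x: "x \<in> {0<..<2*pi}"
  shows "sqrt (wt x) = pi / (exp (logit x / 2) + exp (- (logit x / 2)))"
proof -
  define p q where "p = sqrt x" and "q = sqrt (2*pi - x)"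
  have pq: "p > 0" "q > 0" "x = p * p" "2*pi - x = q * q"
    using x by (auto simp: p_def q_def)
  have E: "exp (logit x / 2) = p / q"
  proof -
    have "logit x / 2 = ln p - ln q"
      using x by (simp add: logit_def p_def q_def ln_sqrt)
    then have "exp (logit x / 2) = exp (ln p - ln q)" by (simp only:)
    then show ?thesis using pq by (simp add: exp_diff)
  qed
  then have E': "exp (- (logit x / 2)) = q / p"
    by (simp add: exp_minus)
  have "2 * pi = p * p + q * q" using pq by linarith
  then have sum: "p / q + q / p = 2 * pi / (p * q)"
    using pq(1,2) by (simp add: field_simps)
  have "sqrt (wt x) = p * q / 2"
    by (simp add: wt_def p_def q_def real_sqrt_mult real_sqrt_divide)
  then show ?thesis
    unfolding E E' sum by simp
qed

definition expit :: "real \<Rightarrow> real" where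
  "expit t = 2 * pi / (1 + exp (- t))"

lemma logit_expit: "expit t \<in> {0<..<2*pi}" "logit (expit t) = t"
proof -
  have e: "0 < 1 + exp (- t)" using exp_gt_zero[of "- t"] by linarith
  show r: "expit t \<in> {0<..<2*pi}" using e by (auto simp: expit_def divide_less_eq)
  have "2 * pi - expit t = 2 * pi * exp (- t) / (1 + exp (- t))"
    using e by (simp add: expit_def field_simps)
  then have "logit (expit t) = (ln (2*pi) - ln (1 + exp (- t))) - (ln (2*pi) + ln (exp (- t)) - ln (1 + exp (- t)))"
    unfolding logit_def using e by (simp add: expit_def ln_div ln_mult)
  then show "logit (expit t) = t" by simp
qed

lemma logit_strict_mono:
  assumes "0 < a" "a < b" "b < 2*pi"
  shows "logit a < logit b"
  using assms unfolding logit_def by (intro diff_strict_mono) auto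

lemma homogeneous_solution_bounded:
  assumes z: "\<bar>Re z\<bar> \<le> pi / 4" and x: "x \<in> {0<..<2*pi}"
  shows "norm (rho z x) * sqrt (wt x) \<le> pi"
proof -
  define t where "t = logit x"
  have "\<bar>2 * Re z / pi\<bar> \<le> 1 / 2" using z by (simp add: abs_mult field_simps)
  then have "\<bar>2 * Re z / pi * t\<bar> \<le> 1 / 2 * \<bar>t\<bar>"
    unfolding abs_mult by (intro mult_right_mono) auto
  then have "2 * Re z / pi * t \<le> \<bar>t\<bar> / 2" by linarith
  then have "exp (2 * Re z / pi * t) \<le> exp (\<bar>t\<bar> / 2)" by (simp only: exp_le_cancel_iff)
  also have "\<dots> \<le> exp (t / 2) + exp (- (t / 2))" by (cases "t \<ge> 0") auto
  finally have "exp (2 * Re z / pi * t) \<le> exp (t / 2) + exp (- (t / 2))" .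
  moreover have "exp (t / 2) + exp (- (t / 2)) > 0" by (intro add_pos_pos) auto
  moreover have "a * (pi / b) \<le> pi" if "a \<le> b" "b > 0" for a b :: real
    using mult_right_mono[of a b "pi / b"] that by simp
  ultimately show ?thesis
    unfolding norm_rho sqrt_wt_eq[OF x] t_def[symmetric] by blast
qed

text \<open>
  The point is chosen in the coordinate \<open>t\<close>, far out on the side determined by the sign of \<open>Re z\<close>.
\<close>

lemma homogeneous_solution_unbounded:
  assumes z: "\<bar>Re z\<bar> > pi / 4"
  obtains x where "x \<in> {0<..<2*pi}" "norm (rho z x) * sqrt (wt x) > B"
proof -
  define d where "d = \<bar>2 * Re z / pi\<bar> - 1 / 2"
  have d: "d > 0" using z by (simp add: d_def abs_mult field_simps)
  define T where "T = max 0 (B / d)"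
  define t where "t = sgn (Re z) * T"
  have sz: "sgn (Re z) * Re z = \<bar>Re z\<bar>" "\<bar>sgn (Re z)\<bar> = 1"
    using z pi_gt_zero by (auto simp: sgn_real_def abs_real_def)
  have t: "2 * Re z / pi * t = (d + 1 / 2) * T" "\<bar>t\<bar> = T"
  proof -
    have "2 * Re z / pi * t = 2 / pi * (sgn (Re z) * Re z) * T" by (simp add: t_def)
    also have "\<dots> = (d + 1 / 2) * T" unfolding sz(1) by (simp add: d_def abs_mult)
    finally show "2 * Re z / pi * t = (d + 1 / 2) * T" .
    show "\<bar>t\<bar> = T" unfolding t_def abs_mult sz(2) by (simp add: T_def)
  qed
  show thesis
  proof (rule that[of "expit t"])
    show "expit t \<in> {0<..<2*pi}" by (rule logit_expit)
    have "exp (t / 2) \<le> exp (T / 2)" "exp (- (t / 2)) \<le> exp (T / 2)"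
      using t(2) by auto
    then have "exp (t / 2) + exp (- (t / 2)) \<le> 2 * exp (T / 2)" by linarith
    moreover have "exp (t / 2) + exp (- (t / 2)) > 0" by (intro add_pos_pos) auto
    ultimately have "pi / (2 * exp (T / 2)) \<le> sqrt (wt (expit t))"
      unfolding sqrt_wt_eq[OF logit_expit(1)] logit_expit(2) by (intro divide_left_mono) auto
    then have "exp ((d + 1 / 2) * T) * (pi / (2 * exp (T / 2))) \<le> norm (rho z (expit t)) * sqrt (wt (expit t))"
      unfolding norm_rho logit_expit(2) t(1) by (intro mult_left_mono) auto
    moreover have "exp ((d + 1 / 2) * T) * (pi / (2 * exp (T / 2))) = pi / 2 * exp (d * T)"
      by (simp add: distrib_right exp_add)
    moreover have "B < pi / 2 * exp (d * T)"
    proof -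
      have "B \<le> d * T" using d by (auto simp: T_def max_def field_simps)
      also have "\<dots> < exp (d * T)" using exp_ge_add_one_self[of "d * T"] by linarith
      also have "1 * exp (d * T) \<le> pi / 2 * exp (d * T)" using pi_gt3 by (intro mult_right_mono) auto
      finally show ?thesis by simp
    qed
    ultimately show "B < norm (rho z (expit t)) * sqrt (wt (expit t))" by linarith
  qed
qed

section \<open>Absence of eigenvalues outside the strip\<close>

text \<open>
  Since \<open>logit' = \<pi> / (2 w)\<close>, this says in quantitative form that \<open>1/w\<close> is not integrable at either
  end.
\<close>

lemma logit_diff_le_integral:
  assumes u: "u absolutely_integrable_on {0..2*pi}" and d: "d > 0"
    and ab: "0 < a" "a \<le> b" "b < 2*pi"
    and low: "\<And>x. x \<in> {a..b} \<Longrightarrow> d \<le> wt x * norm (u x :: complex)"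
  shows "logit b - logit a \<le> pi / (2 * d) * integral {0..2*pi} (\<lambda>x. norm (u x))"
proof -
  have ui: "(\<lambda>x. norm (u x)) integrable_on {0..2*pi}"
    using u by (simp add: absolutely_integrable_on_def)
  have ui': "(\<lambda>x. norm (u x)) integrable_on {a..b}"
    using integrable_subinterval_real[OF ui, of a b] ab by auto
  have L: "((\<lambda>x. pi / (2 * wt x)) has_integral logit b - logit a) {a..b}"
  proof (rule fundamental_theorem_of_calculus[OF ab(2)])
    fix x assume "x \<in> {a..b}"
    then show "(logit has_vector_derivative pi / (2 * wt x)) (at x within {a..b})"
      using ab logit_has_derivative[of x]
      by (auto simp: has_real_derivative_iff_has_vector_derivative intro: has_vector_derivative_at_within)
  qed
  have "integral {a..b} (\<lambda>x. pi / (2 * wt x)) \<le> integral {a..b} (\<lambda>x. pi / (2 * d) * norm (u x))"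
  proof (rule integral_le)
    show "(\<lambda>x. pi / (2 * wt x)) integrable_on {a..b}" using L by blast
    show "(\<lambda>x. pi / (2 * d) * norm (u x)) integrable_on {a..b}"
      using ui' by (rule integrable_on_mult_right)
    fix x assume x: "x \<in> {a..b}"
    then have "wt x > 0" using ab by (intro wt_pos) auto
    then show "pi / (2 * wt x) \<le> pi / (2 * d) * norm (u x)"
      using low[OF x] d by (simp add: field_simps)
  qed
  also have "\<dots> = pi / (2 * d) * integral {a..b} (\<lambda>x. norm (u x))" by simp
  also have "\<dots> \<le> pi / (2 * d) * integral {0..2*pi} (\<lambda>x. norm (u x))"
    using ui ui' ab d by (intro mult_left_mono integral_subset_le) auto
  finally show ?thesis using L by (simp add: integral_unique)
qed

text \<open>
  If \<open>w u\<close> had a nonzero limit at the peak, then \<open>u\<close> would be comparable to \<open>1/w\<close> there and fail to be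
  integrable.
\<close>

lemma weighted_limit_zero:
  assumes u: "u absolutely_integrable_on {0..2*pi}"
    and \<zeta>: "continuous_on {0..2*pi} \<zeta>"
    and eq: "\<And>x. x \<in> {0<..<2*pi} \<Longrightarrow> of_real (wt x) * u x = (\<zeta> x :: complex)"
  shows "\<zeta> 0 = 0" "\<zeta> (2*pi) = 0"
proof -
  have near: "\<exists>d>0. \<forall>x\<in>{0<..<2*pi}. \<bar>x - e\<bar> < d \<longrightarrow> norm (\<zeta> e) / 2 \<le> wt x * norm (u x)"
    if e: "e \<in> {0..2*pi}" "\<zeta> e \<noteq> 0" for e
  proof -
    have "norm (\<zeta> e) / 2 > 0" using e by simp
    then obtain d where d: "d > 0" "\<forall>x\<in>{0..2*pi}. dist x e < d \<longrightarrow> dist (\<zeta> x) (\<zeta> e) < norm (\<zeta> e) / 2"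
      using \<zeta> e(1) unfolding continuous_on_iff by blast
    have "norm (\<zeta> e) / 2 \<le> wt x * norm (u x)" if x: "x \<in> {0<..<2*pi}" "\<bar>x - e\<bar> < d" for x
    proof -
      have "norm (\<zeta> x - \<zeta> e) < norm (\<zeta> e) / 2"
        using d(2) x by (auto simp: dist_norm)
      then have "norm (\<zeta> e) / 2 \<le> norm (\<zeta> x)"
        using norm_triangle_ineq2[of "\<zeta> e" "\<zeta> x"] by (simp add: norm_minus_commute)
      also have "\<dots> = wt x * norm (u x)"
        using eq[OF x(1), symmetric] wt_pos[OF x(1)] by (simp add: norm_mult)
      finally show ?thesis .
    qed
    with d(1) show ?thesis by blast
  qed
  have vanish: "\<zeta> e = 0"
    if e: "e \<in> {0..2*pi}"
      and far: "\<And>d J. d > 0 \<Longrightarrow>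
        \<exists>a b. 0 < a \<and> a \<le> b \<and> b < 2*pi \<and> e - d < a \<and> b < e + d \<and> J < logit b - logit a" for e
  proof (rule ccontr)
    assume n: "\<zeta> e \<noteq> 0"
    then obtain d where d: "d > 0"
      "\<And>x. x \<in> {0<..<2*pi} \<Longrightarrow> \<bar>x - e\<bar> < d \<Longrightarrow> norm (\<zeta> e) / 2 \<le> wt x * norm (u x)"
      using near[OF e] by auto
    define J where "J = pi / (2 * (norm (\<zeta> e) / 2)) * integral {0..2*pi} (\<lambda>x. norm (u x))"
    obtain a b where ab: "0 < a" "a \<le> b" "b < 2*pi" "e - d < a" "b < e + d" "J < logit b - logit a"
      using far[OF d(1)] by blast
    have "logit b - logit a \<le> J"
      unfolding J_def using n ab d(2) by (intro logit_diff_le_integral[OF u]) auto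
    with ab show False by linarith
  qed
  have le: "a \<le> b" if "logit a < logit b" "a < 2*pi" "0 < b" for a b
    using logit_strict_mono[of b a] that by (cases "a \<le> b") auto
  show "\<zeta> 0 = 0"
  proof (rule vanish)
    fix d J :: real assume "d > 0"
    then have b: "0 < min (d / 2) pi" "min (d / 2) pi < d" "min (d / 2) pi < 2*pi"
      by (auto simp: min_def)
    define b a where "b = min (d / 2) pi" and "a = expit (logit b - \<bar>J\<bar> - 1)"
    have "0 < a" "a < 2*pi" "logit a = logit b - \<bar>J\<bar> - 1"
      using logit_expit[of "logit b - \<bar>J\<bar> - 1"] by (auto simp: a_def)
    moreover have "0 < b" "b < d" "b < 2*pi" using b by (simp_all only: b_def)
    ultimately show "\<exists>a b. 0 < a \<and> a \<le> b \<and> b < 2*pi \<and> 0 - d < a \<and> b < 0 + d \<and> J < logit b - logit a"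
      using \<open>d > 0\<close> by (intro exI[of _ a] exI[of _ b] conjI le) auto
  qed simp
  show "\<zeta> (2*pi) = 0"
  proof (rule vanish)
    fix d J :: real assume "d > 0"
    then have a: "0 < max (2*pi - d / 2) pi" "2*pi - d < max (2*pi - d / 2) pi" "max (2*pi - d / 2) pi < 2*pi"
      by (auto simp: max_def intro: less_le_trans[OF pi_gt_zero])
    define a b where "a = max (2*pi - d / 2) pi" and "b = expit (logit a + \<bar>J\<bar> + 1)"
    have "0 < b" "b < 2*pi" "logit b = logit a + \<bar>J\<bar> + 1"
      using logit_expit[of "logit a + \<bar>J\<bar> + 1"] by (auto simp: b_def)
    moreover have "0 < a" "2*pi - d < a" "a < 2*pi" using a by (simp_all only: a_def)
    ultimately show "\<exists>a b. 0 < a \<and> a \<le> b \<and> b < 2*pi \<and> 2*pi - d < a \<and> b < 2*pi + d \<and> J < logit b - logit a"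
      using \<open>d > 0\<close> by (intro exI[of _ a] exI[of _ b] conjI le) auto
  qed simp
qed

text \<open>
  Let \<open>V = V u\<close> and \<open>m = mean u\<close> for an eigenfunction \<open>u\<close>. The integrated equation reads
  \<open>w u = C + (w' + z) V + m (w + z x)\<close>. Integrability of \<open>u\<close> makes the right-hand side vanish at \<open>0\<close>
  and at \<open>2\<pi>\<close>, where it equals \<open>C\<close> and \<open>C + 2\<pi> z m\<close>; so \<open>C = m = 0\<close>. What remains is the homogeneous
  equation \<open>w V' = (w' + z) V\<close>, hence \<open>V = c \<rho> w\<close>, and \<open>V = O(sqrt w)\<close> forces \<open>c = 0\<close>.
\<close>

lemma no_eigenvalue_outside_strip:
  assumes z: "\<bar>Re z\<bar> > pi / 4" and f: "f \<in> dom_A" and eig: "op_A f = scaleC z f"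
  shows "f = 0"
proof -
  obtain u k where u: "interior_primitive u k" "square_integrable u"
    "square_integrable (\<lambda>x. of_real (wt x) * k x)" and fu: "f = abs_l2 u"
    using dom_A_E[OF f] .
  let ?V = "pinned_primitive u"
  define m where "m = integral {0..2*pi} u / (2*pi)"
  have proj: "zero_mean_proj u = (\<lambda>x. u x - m)"
    using zero_mean_proj_eq[OF u(2)] by (auto simp: m_def)
  note V = pinned_primitive_primitive[OF u(2), unfolded proj]
  have iV: "interior_primitive ?V (\<lambda>x. u x - m)"
    using V(1) by (auto simp: interior_primitive_def intro: primitive_on_subinterval)
  have sA: "square_integrable (\<lambda>x. of_real (wt x) * k x + 1 / 2 * ?V x)"
    by (intro square_integrable_add square_integrable_mult_left u square_integrable_pinned_primitive)
  have "abs_l2 (\<lambda>x. of_real (wt x) * k x + 1 / 2 * ?V x) = abs_l2 (\<lambda>x. z * u x)"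
    using eig unfolding fu op_A_eq(2)[OF u(2) interior_primitive_has_weak_deriv[OF u(1)] u(3)]
      abs_l2_scaleC[OF u(2)] .
  then have "AE x in circle_measure. of_real (wt x) * k x + 1 / 2 * ?V x = z * u x"
    by (subst (asm) abs_l2_eq_iff) (intro sA square_integrable_mult_left u)+
  then obtain N where N: "negligible N"
    "\<And>x. x \<in> {0<..<2*pi} - N \<Longrightarrow> of_real (wt x) * k x + 1 / 2 * ?V x = z * u x"
    using ae_circleD by blast
  have dz: "interior_primitive (\<lambda>x. - (of_real (dwt x) + z)) (\<lambda>_. 1 / 2)"
    using interior_primitive_linear[OF interior_primitive_dwt bounded_linear_minus[OF bounded_linear_ident]]
    by simp
  have lin: "interior_primitive (\<lambda>x. - m * (of_real (wt x) + z * of_real x)) (\<lambda>x. - m * (of_real (dwt x) + z))"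
  proof (rule interior_primitive_C1)
    show "((\<lambda>x. - m * (of_real (wt x) + z * of_real x)) has_vector_derivative - m * (of_real (dwt x) + z)) (at x)" for x
    proof -
      have "((\<lambda>x. complex_of_real x) has_vector_derivative of_real 1) (at x)"
        by (intro has_vector_derivative_of_real) simp
      then have "((\<lambda>x. - m * (of_real (wt x) + z * of_real x)) has_vector_derivative - m * (of_real (dwt x) + z * of_real 1)) (at x)"
        by (intro has_vector_derivative_mult_right has_vector_derivative_add wt_has_vector_derivative)
      then show ?thesis by simp
    qed
  qed (intro continuous_intros)
  define \<zeta> where "\<zeta> C x = C + (of_real (dwt x) + z) * ?V x + m * (of_real (wt x) + z * of_real x)" for C x
  obtain C where C: "\<And>x. x \<in> {0<..<2*pi} \<Longrightarrow> of_real (wt x) * u x = \<zeta> C x"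
  proof -
    note I = interior_primitive_add[OF interior_primitive_add[OF interior_primitive_mult[OF interior_primitive_wt u(1)]
      interior_primitive_mult[OF dz iV]] lin]
    have "\<exists>C. \<forall>x\<in>{0<..<2*pi}. of_real (wt x) * u x + - (of_real (dwt x) + z) * ?V x
        + - m * (of_real (wt x) + z * of_real x) = C"
    proof (rule interior_primitive_zero_constant[OF I N(1)])
      fix x assume x: "x \<in> {0<..<2*pi} - N"
      then have "of_real (wt x) * k x = z * u x - 1 / 2 * ?V x"
        using N(2)[OF x] by (simp add: eq_diff_eq)
      then show "of_real (dwt x) * u x + of_real (wt x) * k x + (1 / 2 * ?V x + - (of_real (dwt x) + z) * (u x - m))
          + - m * (of_real (dwt x) + z) = 0"
        by (simp add: algebra_simps)
    qed
    then obtain C where "\<And>x. x \<in> {0<..<2*pi} \<Longrightarrow> of_real (wt x) * u x + - (of_real (dwt x) + z) * ?V x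
        + - m * (of_real (wt x) + z * of_real x) = C" by blast
    then show thesis
      by (intro that[of C]) (simp add: \<zeta>_def algebra_simps)
  qed
  have "continuous_on {0..2*pi} (\<zeta> C)"
    unfolding \<zeta>_def using primitive_on_continuous[OF V(1)] by (intro continuous_intros)
  from weighted_limit_zero[OF _ this C] u(2)
  have "\<zeta> C 0 = 0" "\<zeta> C (2*pi) = 0" by (auto simp: square_integrable_iff)
  then have "C = 0" "C + m * (z * (2*pi)) = 0"
    by (simp_all add: \<zeta>_def V(2,3) wt_def)
  then have C0: "C = 0" and m0: "m = 0" using z by auto
  have wu: "of_real (wt x) * u x = (of_real (dwt x) + z) * ?V x" if "x \<in> {0<..<2*pi}" for x
    using C[OF that] by (simp add: \<zeta>_def C0 m0)
  obtain c where c: "\<And>x. x \<in> {0<..<2*pi} \<Longrightarrow> ?V x = c * (rho z x * of_real (wt x))"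
  proof -
    \<comment> \<open>V is divided by the homogeneous solution; the quotient has derivative zero.\<close>
    define h where "h x = 1 / (rho z x * complex_of_real (wt x))" for x
    define h' where "h' x = - (of_real (dwt x) + z) * h x / of_real (wt x)" for x
    have h: "interior_primitive h h'"
    proof (rule interior_primitive_C1)
      fix x :: real assume x: "x \<in> {0<..<2*pi}"
      have w: "wt x > 0" using x by (rule wt_pos)
      have d: "((\<lambda>x. rho z x * of_real (wt x)) has_vector_derivative
          rho z x * of_real (dwt x) + z * rho z x / of_real (wt x) * of_real (wt x)) (at x)"
        by (intro has_vector_derivative_mult rho_has_derivative wt_has_vector_derivative x)
      have "((\<lambda>y. 1 / y) has_field_derivative - 1 / (rho z x * of_real (wt x))\<^sup>2) (at (rho z x * of_real (wt x)))"
        using w by (auto intro!: derivative_eq_intros simp: rho_nonzero power2_eq_square)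
      from field_vector_diff_chain_at[OF d this]
      have "(h has_vector_derivative (rho z x * of_real (dwt x) + z * rho z x / of_real (wt x) * of_real (wt x))
          * (- 1 / (rho z x * of_real (wt x))\<^sup>2)) (at x)"
        by (simp add: o_def h_def[abs_def])
      also have "(rho z x * of_real (dwt x) + z * rho z x / of_real (wt x) * of_real (wt x))
          * (- 1 / (rho z x * of_real (wt x))\<^sup>2) = h' x"
        using w rho_nonzero[of z x] by (simp add: h'_def h_def power2_eq_square field_simps)
      finally show "(h has_vector_derivative h' x) (at x)" .
    next
      show "continuous_on {0<..<2*pi} h'"
        unfolding h'_def h_def using wt_pos rho_nonzero
        by (intro continuous_intros continuous_on_rho) force+
    qed
    have "\<exists>c. \<forall>x\<in>{0<..<2*pi}. ?V x * h x = c"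
    proof (rule interior_primitive_zero_constant[OF interior_primitive_mult[OF iV h] negligible_empty])
      fix x :: real assume "x \<in> {0<..<2*pi} - {}"
      then have x: "x \<in> {0<..<2*pi}" by simp
      have "?V x * h' x = - ((of_real (dwt x) + z) * ?V x) * h x / of_real (wt x)"
        by (simp add: h'_def minus_divide_left algebra_simps)
      also have "\<dots> = - u x * h x"
        unfolding wu[OF x, symmetric] using wt_pos[OF x] by simp
      finally show "(u x - m) * h x + ?V x * h' x = 0"
        by (simp add: m0)
    qed
    then obtain c where c: "\<And>x. x \<in> {0<..<2*pi} \<Longrightarrow> ?V x * h x = c" by blast
    show thesis
    proof (rule that[of c])
      fix x :: real assume x: "x \<in> {0<..<2*pi}"
      show "?V x = c * (rho z x * of_real (wt x))"
        unfolding c[OF x, symmetric] h_def using wt_pos[OF x] rho_nonzero[of z x] by simp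
    qed
  qed
  have c0: "c = 0"
  proof (rule ccontr)
    assume "c \<noteq> 0"
    define K where "K = sqrt (4 / pi * norm_sq (zero_mean_proj u))"
    obtain x where x: "x \<in> {0<..<2*pi}" "norm (rho z x) * sqrt (wt x) > K / norm c"
      using homogeneous_solution_unbounded[OF z] .
    have w: "wt x > 0" using x(1) by (rule wt_pos)
    have "norm c * (norm (rho z x) * sqrt (wt x)) * sqrt (wt x) = norm (?V x)"
      using w by (simp add: c[OF x(1)] norm_mult)
    also have "\<dots> \<le> K * sqrt (wt x)"
      using pinned_primitive_bound[OF u(2) x(1)] by (simp add: K_def)
    finally have "norm c * (norm (rho z x) * sqrt (wt x)) \<le> K" using w by simp
    with x(2) \<open>c \<noteq> 0\<close> show False by (simp add: field_simps)
  qed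
  have "u x = 0" if x: "x \<in> {0<..<2*pi}" for x
    using wu[OF x] wt_pos[OF x] by (simp add: c[OF x] c0)
  then have "abs_l2 u = abs_l2 (\<lambda>_. 0)"
    by (intro abs_l2_eqI[OF square_integrable_zero negligible_empty]) auto
  then show "f = 0" by (simp add: fu zero_l2.abs_eq)
qed

section \<open>Eigenfunctions inside the strip\<close>

text \<open>
  With \<open>\<beta> = \<bar>4 Re z / \<pi>\<bar> < 1\<close>, \<open>\<bar>\<rho>\<bar>\<^sup>2\<close> is at most a multiple of the sum of the powers \<open>- \<beta>\<close> of the distances
  to the two ends, and these are integrable.
\<close>

lemma homogeneous_solution_square_integrable:
  assumes z: "\<bar>Re z\<bar> < pi / 4"
  obtains B where "\<And>a b. 0 < a \<Longrightarrow> a \<le> b \<Longrightarrow> b < 2*pi \<Longrightarrow> integral {a..b} (\<lambda>x. (norm (rho z x))\<^sup>2) \<le> B"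
proof -
  define \<beta> where "\<beta> = \<bar>4 * Re z / pi\<bar>"
  have \<beta>: "0 \<le> \<beta>" "\<beta> < 1" using z by (auto simp: \<beta>_def abs_mult field_simps)
  \<comment> \<open>These are t powr \<open>- \<beta>\<close> and a primitive of it, written with exp because p is compared with
      the exponential \<open>\<bar>\<rho>\<bar>\<close>.\<close>
  define p where "p t = exp (- \<beta> * ln t)" for t :: real
  define P where "P t = exp ((1 - \<beta>) * ln t) / (1 - \<beta>)" for t :: real
  have P: "(P has_real_derivative p t) (at t)" if "t > 0" for t
  proof -
    have "(P has_real_derivative exp ((1 - \<beta>) * ln t) * ((1 - \<beta>) * (1 / t)) / (1 - \<beta>)) (at t)"
      unfolding P_def using that \<beta>(2) by (auto intro!: derivative_eq_intros)
    also have "exp ((1 - \<beta>) * ln t) * ((1 - \<beta>) * (1 / t)) / (1 - \<beta>) = exp ((1 - \<beta>) * ln t) / exp (ln t)"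
      using that \<beta>(2) by simp
    also have "\<dots> = p t" by (simp add: p_def algebra_simps flip: exp_diff)
    finally show ?thesis .
  qed
  have P_bound: "0 \<le> P t" "P t \<le> P (2*pi)" if "0 < t" "t < 2*pi" for t
  proof -
    show "0 \<le> P t" using \<beta>(2) by (simp add: P_def)
    have "(1 - \<beta>) * ln t \<le> (1 - \<beta>) * ln (2*pi)" using that \<beta>(2) by (intro mult_left_mono) auto
    then show "P t \<le> P (2*pi)" using \<beta>(2) by (simp add: P_def divide_right_mono)
  qed
  define c where "c = exp (\<beta> * ln (2*pi))"
  have dom: "(norm (rho z x))\<^sup>2 \<le> c * (p x + p (2*pi - x))" if x: "x \<in> {0<..<2*pi}" for x
  proof -
    have "(norm (rho z x))\<^sup>2 = exp (4 * Re z / pi * logit x)"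
      by (simp add: norm_rho power2_eq_square flip: exp_add)
    also have "\<dots> \<le> exp (\<beta> * \<bar>logit x\<bar>)"
    proof -
      have "4 * Re z / pi * logit x \<le> \<beta> * \<bar>logit x\<bar>"
        unfolding \<beta>_def abs_mult[symmetric] by (rule abs_ge_self)
      then show ?thesis by (simp only: exp_le_cancel_iff)
    qed
    also have "\<dots> \<le> c * (p x + p (2*pi - x))"
    proof (cases "logit x \<ge> 0")
      case True
      have "\<beta> * ln x \<le> \<beta> * ln (2*pi)" using x \<beta>(1) by (intro mult_left_mono) auto
      then have "exp (\<beta> * \<bar>logit x\<bar>) \<le> exp (\<beta> * ln (2*pi) + - \<beta> * ln (2*pi - x))"
        using True by (simp add: logit_def algebra_simps)
      also have "\<dots> = c * p (2*pi - x)" by (simp only: c_def p_def exp_add)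
      also have "\<dots> \<le> c * (p x + p (2*pi - x))" by (simp add: c_def p_def)
      finally show ?thesis .
    next
      case False
      have "\<beta> * ln (2*pi - x) \<le> \<beta> * ln (2*pi)" using x \<beta>(1) by (intro mult_left_mono) auto
      then have "exp (\<beta> * \<bar>logit x\<bar>) \<le> exp (\<beta> * ln (2*pi) + - \<beta> * ln x)"
        using False by (simp add: logit_def algebra_simps)
      also have "\<dots> = c * p x" by (simp only: c_def p_def exp_add)
      also have "\<dots> \<le> c * (p x + p (2*pi - x))" by (simp add: c_def p_def)
      finally show ?thesis .
    qed
    finally show ?thesis .
  qed
  show thesis
  proof (rule that[of "c * (2 * P (2*pi))"])
    fix a b :: real assume ab: "0 < a" "a \<le> b" "b < 2*pi"
    have I: "((\<lambda>x. c * (p x + p (2*pi - x))) has_integral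
        c * (P b - P (2*pi - b)) - c * (P a - P (2*pi - a))) {a..b}"
    proof (rule fundamental_theorem_of_calculus[OF ab(2)])
      fix x assume x: "x \<in> {a..b}"
      have "((\<lambda>x. c * (P x - P (2*pi - x))) has_real_derivative c * (p x - p (2*pi - x) * (- 1))) (at x)"
        using x ab by (intro derivative_intros DERIV_cmult DERIV_chain2[OF P] P) (auto intro!: derivative_eq_intros)
      then show "((\<lambda>x. c * (P x - P (2*pi - x))) has_vector_derivative c * (p x + p (2*pi - x))) (at x within {a..b})"
        by (auto simp: has_real_derivative_iff_has_vector_derivative intro: has_vector_derivative_at_within)
    qed
    have "integral {a..b} (\<lambda>x. (norm (rho z x))\<^sup>2) \<le> integral {a..b} (\<lambda>x. c * (p x + p (2*pi - x)))"
    proof (rule integral_le)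
      have "continuous_on {a..b} (rho z)"
        using continuous_on_rho by (rule continuous_on_subset) (use ab in auto)
      then show "(\<lambda>x. (norm (rho z x))\<^sup>2) integrable_on {a..b}"
        by (intro integrable_continuous_real continuous_intros)
      show "(\<lambda>x. c * (p x + p (2*pi - x))) integrable_on {a..b}" using I by blast
      show "(norm (rho z x))\<^sup>2 \<le> c * (p x + p (2*pi - x))" if "x \<in> {a..b}" for x
        using that ab by (intro dom) auto
    qed
    also have "\<dots> = c * (P b - P (2*pi - b) - (P a - P (2*pi - a)))"
      using I by (simp add: integral_unique algebra_simps)
    also have "\<dots> \<le> c * (2 * P (2*pi))"
      using P_bound[of a] P_bound[of b] P_bound[of "2*pi - a"] P_bound[of "2*pi - b"] ab
      by (intro mult_left_mono) (auto simp: c_def)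
    finally show "integral {a..b} (\<lambda>x. (norm (rho z x))\<^sup>2) \<le> c * (2 * P (2*pi))" .
  qed
qed

text \<open>
  The eigenfunction is \<open>f = (\<rho> w)' = \<rho> (w' + z)\<close>. Its zeros satisfy \<open>w' = - z\<close>, which happens at one
  point at most, so its class is not zero.
\<close>

lemma eigenfunction_exists:
  assumes z: "\<bar>Re z\<bar> < pi / 4"
  obtains f where "f \<in> dom_A" "op_A f = scaleC z f" "f \<noteq> 0"
proof -
  define F where "F x = rho z x * of_real (wt x)" for x
  define f where "f x = rho z x * (of_real (dwt x) + z)" for x
  define k where "k x = (z * f x - 1 / 2 * F x) / of_real (wt x)" for x
  have cf: "continuous_on {0<..<2*pi} f"
    unfolding f_def by (intro continuous_intros continuous_on_rho)
  have cF: "continuous_on {0<..<2*pi} F"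
    unfolding F_def by (intro continuous_intros continuous_on_rho)
  have F: "interior_primitive F f"
  proof (rule interior_primitive_C1[OF _ cf])
    fix x :: real assume x: "x \<in> {0<..<2*pi}"
    have "(F has_vector_derivative rho z x * of_real (dwt x) + z * rho z x / of_real (wt x) * of_real (wt x)) (at x)"
      unfolding F_def by (intro has_vector_derivative_mult rho_has_derivative wt_has_vector_derivative x)
    then show "(F has_vector_derivative f x) (at x)"
      using wt_pos[OF x] by (simp add: f_def algebra_simps)
  qed
  have f: "interior_primitive f k"
  proof (rule interior_primitive_C1)
    fix x :: real assume x: "x \<in> {0<..<2*pi}"
    have "(f has_vector_derivative rho z x * (- 1 / 2 + 0) + z * rho z x / of_real (wt x) * (of_real (dwt x) + z)) (at x)"
      unfolding f_def
      by (intro has_vector_derivative_mult rho_has_derivative has_vector_derivative_add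
          dwt_has_vector_derivative has_vector_derivative_const x)
    also have "rho z x * (- 1 / 2 + 0) + z * rho z x / of_real (wt x) * (of_real (dwt x) + z) = k x"
      using wt_pos[OF x] by (simp add: k_def f_def F_def field_simps)
    finally show "(f has_vector_derivative k x) (at x)" .
  next
    show "continuous_on {0<..<2*pi} k"
      unfolding k_def using wt_pos by (intro continuous_intros cf cF) force
  qed
  obtain B where B: "\<And>a b. 0 < a \<Longrightarrow> a \<le> b \<Longrightarrow> b < 2*pi \<Longrightarrow> integral {a..b} (\<lambda>x. (norm (rho z x))\<^sup>2) \<le> B"
    using homogeneous_solution_square_integrable[OF z] by blast
  have sf: "square_integrable f"
  proof (rule square_integrable_of_interior_bound(1)[OF cf])
    fix a b :: real assume ab: "0 < a" "a \<le> b" "b < 2*pi"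
    define c where "c = (pi / 2 + norm z)\<^sup>2"
    have sub: "{a..b} \<subseteq> {0<..<2*pi}" using ab by auto
    have "integral {a..b} (\<lambda>x. (norm (f x))\<^sup>2) \<le> integral {a..b} (\<lambda>x. c * (norm (rho z x))\<^sup>2)"
    proof (rule integral_le)
      show "(\<lambda>x. (norm (f x))\<^sup>2) integrable_on {a..b}"
        by (intro integrable_continuous_real continuous_intros continuous_on_subset[OF cf sub])
      show "(\<lambda>x. c * (norm (rho z x))\<^sup>2) integrable_on {a..b}"
        by (intro integrable_continuous_real continuous_intros continuous_on_subset[OF continuous_on_rho sub])
      fix x assume "x \<in> {a..b}"
      then have "norm (of_real (dwt x) + z) \<le> pi / 2 + norm z"
        using norm_triangle_ineq[of "of_real (dwt x)" z] abs_dwt_le[of x] ab by auto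
      then have "(norm (of_real (dwt x) + z))\<^sup>2 \<le> c" unfolding c_def by (intro power_mono) auto
      then have "(norm (of_real (dwt x) + z))\<^sup>2 * (norm (rho z x))\<^sup>2 \<le> c * (norm (rho z x))\<^sup>2"
        by (rule mult_right_mono) simp
      then show "(norm (f x))\<^sup>2 \<le> c * (norm (rho z x))\<^sup>2"
        by (simp add: f_def norm_mult power_mult_distrib mult.commute)
    qed
    also have "\<dots> \<le> c * B" using B[OF ab] by (simp add: c_def mult_left_mono)
    finally show "integral {a..b} (\<lambda>x. (norm (f x))\<^sup>2) \<le> c * B" .
  qed
  have Fb: "norm (F x) \<le> pi * sqrt (wt x)" if x: "x \<in> {0<..<2*pi}" for x
  proof -
    have "norm (F x) = norm (rho z x) * sqrt (wt x) * sqrt (wt x)"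
      using wt_pos[OF x] by (simp add: F_def norm_mult)
    also have "\<dots> \<le> pi * sqrt (wt x)"
      using homogeneous_solution_bounded[of z x] z x wt_pos[OF x] by (intro mult_right_mono) auto
    finally show ?thesis .
  qed
  have V: "pinned_primitive f x = F x" if "x \<in> {0<..<2*pi}" for x
    using pinned_primitive_unique(2)[OF sf F Fb that] .
  have wk: "of_real (wt x) * k x = z * f x - 1 / 2 * F x" if "x \<in> {0<..<2*pi}" for x
    using wt_pos[OF that] by (simp add: k_def)
  have "square_integrable (\<lambda>x. z * f x - 1 / 2 * pinned_primitive f x)"
    by (intro square_integrable_diff square_integrable_mult_left sf square_integrable_pinned_primitive)
  then have swk: "square_integrable (\<lambda>x. of_real (wt x) * k x)"
    by (rule square_integrable_spike(1)[OF _ negligible_empty]) (simp add: wk V)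
  note A = op_A_eq[OF sf interior_primitive_has_weak_deriv[OF f] swk]
  show thesis
  proof (rule that[OF A(1)])
    show "op_A (abs_l2 f) = scaleC z (abs_l2 f)"
      unfolding A(2) abs_l2_scaleC[OF sf]
      by (rule abs_l2_eqI[OF square_integrable_mult_left[OF sf] negligible_empty]) (simp add: wk V)
    show "abs_l2 f \<noteq> 0"
    proof
      assume "abs_l2 f = 0"
      then have "AE x in circle_measure. f x = 0"
        using abs_l2_eq_iff[OF sf square_integrable_zero] by (simp add: zero_l2.abs_eq)
      then obtain N where N: "negligible N" "\<And>x. x \<in> {0<..<2*pi} - N \<Longrightarrow> f x = 0"
        using ae_circleD[of "\<lambda>x. f x = 0"] by blast
      have "{0<..<2*pi} \<subseteq> N \<union> {pi + 2 * Re z}"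
      proof
        fix x :: real assume x: "x \<in> {0<..<2*pi}"
        show "x \<in> N \<union> {pi + 2 * Re z}"
        proof (rule ccontr)
          assume n: "x \<notin> N \<union> {pi + 2 * Re z}"
          then have "of_real (dwt x) + z = 0" using N(2)[of x] x by (simp add: f_def rho_nonzero)
          then have "Re (of_real (dwt x) + z) = 0" by (simp only: zero_complex.sel)
          with n show False by (simp add: dwt_def field_simps)
        qed
      qed
      then have "negligible {0<..<2*pi}"
        using N(1) negligible_subset[of "N \<union> {pi + 2 * Re z}"] by simp
      moreover have "pi \<in> {0<..<2*pi}" by simp
      then have "{0<..<2*pi} \<noteq> {}" by blast
      from open_not_negligible[OF open_greaterThanLessThan this] have "\<not> negligible {0<..<2*pi}" .
      ultimately show False by simp
    qed
  qed
qed

section \<open>The spectrum\<close>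

lemma resolvent_set_outside_strip:
  assumes z: "\<bar>Re z\<bar> > pi / 4"
  shows "z \<in> resolvent_set dom_A op_A"
proof -
  let ?T = "\<lambda>f. op_A f - scaleC z f"
  obtain B where "\<And>g. \<exists>f\<in>dom_A. ?T f = g \<and> norm f \<le> B * norm g"
    using resolvent_exists[OF z] by blast
  then obtain R where R: "\<And>g. R g \<in> dom_A" "\<And>g. ?T (R g) = g" "\<And>g. norm (R g) \<le> B * norm g"
    by metis
  have inj: "f = g" if "f \<in> dom_A" "g \<in> dom_A" "?T f = ?T g" for f g
  proof -
    have neg: "scaleC (- 1) h = - h" for h
      using scaleC_of_real[of "- 1" h] by simp
    have "?T (f + scaleC (- 1) g) = 0"
      unfolding shifted_op_A_lincomb[OF that(1,2)] by (simp add: neg that(3))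
    then have "op_A (f + scaleC (- 1) g) = scaleC z (f + scaleC (- 1) g)"
      by (simp only: right_minus_eq)
    then have "f + scaleC (- 1) g = 0"
      by (rule no_eigenvalue_outside_strip[OF z op_A_lincomb(1)[OF that(1,2)]])
    then show ?thesis by (simp add: neg)
  qed
  have comb: "R (g + scaleC c h) = R g + scaleC c (R h)" for g h c
    by (rule inj) (simp_all add: R op_A_lincomb(1) shifted_op_A_lincomb)
  have "bounded_linear R"
  proof (rule bounded_linear_intro)
    show "R (g + h) = R g + R h" for g h
      using comb[of g 1 h] scaleC_of_real[of 1] by simp
    show "R (r *\<^sub>R g) = r *\<^sub>R R g" for r g
    proof -
      have "h + scaleC (of_real (r - 1)) h = r *\<^sub>R h" for h
        unfolding scaleC_of_real by (simp add: scaleR_left_diff_distrib)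
      then show ?thesis using comb[of g "of_real (r - 1)" g] by simp
    qed
    show "norm (R g) \<le> norm g * B" for g
      using R(3)[of g] by (simp add: mult.commute)
  qed
  moreover have "R (?T f) = f" if "f \<in> dom_A" for f
    by (rule inj) (simp_all add: R that)
  ultimately show ?thesis
    unfolding resolvent_set_def using R by blast
qed

text \<open>
  A bounded left inverse of \<open>A - z\<close> with norm at most \<open>K\<close> excludes eigenvalues \<open>z'\<close> with
  \<open>\<bar>z' - z\<bar> K < 1\<close>; but \<open>z' = (1 - e) z\<close> lies in the open strip and is an eigenvalue for every small
  \<open>e > 0\<close>. This covers the boundary lines together with the interior.
\<close>

lemma strip_in_spectrum:
  assumes z: "\<bar>Re z\<bar> \<le> pi / 4"
  shows "z \<in> spectrum dom_A op_A"
proof (rule ccontr)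
  assume "z \<notin> spectrum dom_A op_A"
  then obtain R where R: "bounded_linear R" "\<And>f. f \<in> dom_A \<Longrightarrow> R (op_A f - scaleC z f) = f"
    by (auto simp: spectrum_def resolvent_set_def)
  obtain K where K: "0 < K" "\<And>f. norm (R f) \<le> norm f * K"
    using bounded_linear.pos_bounded[OF R(1)] by blast
  define e where "e = 1 / (2 + norm z * K)"
  have den: "2 + norm z * K > 0" using K(1) by (simp add: add_pos_nonneg)
  have e: "0 < e" "e < 1" "e * norm z * K < 1"
    using den K(1) by (auto simp: e_def field_simps add_pos_nonneg)
  define z' where "z' = of_real (1 - e) * z"
  have "\<bar>Re z'\<bar> < pi / 4"
  proof -
    have "\<bar>Re z'\<bar> = (1 - e) * \<bar>Re z\<bar>" using e by (simp add: z'_def abs_mult)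
    also have "\<dots> \<le> (1 - e) * (pi / 4)" using z e by (intro mult_left_mono) auto
    also have "\<dots> < pi / 4" using e by simp
    finally show ?thesis .
  qed
  then obtain f where f: "f \<in> dom_A" "op_A f = scaleC z' f" "f \<noteq> 0"
    by (rule eigenfunction_exists)
  have "op_A f - scaleC z f = scaleC (z' - z) f"
    using scaleC_add_left[of "z' - z" z f] f(2) by simp
  then have "norm f \<le> norm (scaleC (z' - z) f) * K"
    using R(2)[OF f(1)] K(2)[of "op_A f - scaleC z f"] by simp
  also have "\<dots> = (e * norm z * K) * norm f"
    using e(1) by (simp add: norm_scaleC z'_def algebra_simps norm_mult flip: left_diff_distrib)
  also have "\<dots> < 1 * norm f"
    using e(3) f(3) by (intro mult_strict_right_mono) auto
  finally show False by simp
qed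

theorem theorem3:
  shows "spectrum dom_A op_A = {z. - (pi / 4) \<le> Re z \<and> Re z \<le> pi / 4}"
proof (rule set_eqI)
  fix z
  have "z \<in> spectrum dom_A op_A \<longleftrightarrow> \<bar>Re z\<bar> \<le> pi / 4"
    using strip_in_spectrum[of z] resolvent_set_outside_strip[of z]
    by (cases "\<bar>Re z\<bar> \<le> pi / 4") (auto simp: spectrum_def not_le)
  also have "\<dots> \<longleftrightarrow> - (pi / 4) \<le> Re z \<and> Re z \<le> pi / 4"
    by linarith
  finally show "z \<in> spectrum dom_A op_A \<longleftrightarrow> z \<in> {z. - (pi / 4) \<le> Re z \<and> Re z \<le> pi / 4}"
    by simp
qed

end
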